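(* Assume hypothesis (sur): the restriction map $\rho:\mathbf X^*\to H^*=H$, dual to the inclusion $H=\mathbf X^I\subseteq\mathbf X$, is surjective. Then the functor $\mathfrak t$ restricts to a fully faithful embedding of the torsionfree class $\mathcal F_G$ into the category $\mathrm{Mod}^I(G)$.
   Context: Setting. $\mathfrak F$ is a locally compact nonarchimedean field of any characteristic, with ring of integers $\mathfrak O$, prime element $\pi$ and residue field $\mathbb F_q$ of characteristic $p$; $\mathbf G$ is a connected reductive $\mathfrak F$-split group over $\mathfrak F$, $G=\mathbf G(\mathfrak F)$. Fix a chamber $C$ of the semisimple Bruhat–Tits building of $G$ and a hyperspecial vertex $x_0$ of $C$. Let $\mathbf G_{x_0}$ be the Bruhat–Tits group scheme over $\mathfrak O$ attached to $x_0$ (generic fibre $\mathbf G$; special fibre $\overline{\mathbf G}_{x_0}$ connected reductive and $\mathbb F_q$-split) and $K=\mathbf G_{x_0}(\mathfrak O)$. The pointwise stabilizer $J\subseteq K$ of $C$ is an Iwahori subgroup; it corresponds to a Borel subgroup $\overline{\mathbf B}$ of $\overline{\mathbf G}_{x_0}$ with unipotent radical $\overline{\mathbf N}$. Let $I$ be the preimage of $\overline{\mathbf N}(\mathbb F_q)$ in $K$ (the pro-$p$-Iwahori subgroup), and $K_m=\ker(K\to\mathbf G_{x_0}(\mathfrak O/\pi^m\mathfrak O))$ for $m\ge1$. Let $k$ be an arbitrary field. $\mathbf X=\mathrm{ind}_I^G(1)$ is the space of compactly supported $k$-valued functions on $G/I$ with the left translation action of $G$, and $H=\mathrm{End}_{k[G]}(\mathbf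 X)^{\mathrm{op}}$, so $\mathbf X$ is a $(G,H)$-bimodule ($G$ on the left, $H$ on the right). $H$ is identified, as a right $H$-module, with $\mathbf X^I$ via $h\mapsto(\mathrm{char}_I)h$. $\mathrm{Mod}(H)$ is the category of left $H$-modules, $\mathrm{Mod}(G)$ the category of smooth $k$-representations of $G$, and $\mathrm{Mod}^I(G)$ the full subcategory of those $V$ generated by $V^I$ as $G$-representations. For a right (resp. left) $H$-module $Y$, $Y^*=\mathrm{Hom}_H(Y,H)$, a left (resp. right) $H$-module. $G$ acts on $\mathbf X^*$ by $(\lambda g)(x)=\lambda(gx)$ and hence on $\mathrm{Hom}_H(\mathbf X^*,M)$. For $M\in\mathrm{Mod}(H)$ let $\tau_M:\mathbf X\otimes_HM\to\mathrm{Hom}_H(\mathbf X^*,M)$, $x\otimes m\mapsto[\lambda\mapsto\lambda(x)m]$, and $\mathfrak t(M)=\mathrm{im}(\tau_M)\in\mathrm{Mod}^I(G)$. Torsion pair. Let $\mathbf Z_m=\mathrm{im}(\mathbf X^*\to(\mathbf X^{K_m})^* )$ (restriction of linear maps); it carries commuting actions of $H$ and $I$. With $(\,\cdot\,)_I$ denoting $I$-coinvariants, put $Z_m=\ker\big((\mathbf Z_m)_I\to((\mathbf X^{K_m})^* )_I\to(\mathbf X^I)^*=H\big)$, the second map being induced by restriction to $\mathbf X^I$; $Z_m$ is a left $H$-module. $\mathcal F_G$ is the full subcategory of all $M\in\mathrm{Mod}(H)$ with $\mathrm{Hom}_H(Z_m,M)=0$ for all $m\ge1$ (the torsionfree class of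 the torsion pair generated by the $Z_m$). *)

theory Defs
  imports
    "HOL-Analysis.Analysis"
    "HOL-Algebra.Algebra"
    "HOL-Algebra.Algebraic_Closure_Type"
    "HOL-Algebra.Free_Abelian_Groups"
    "HOL-Algebra.Left_Coset"
begin

no_notation Polynomials.var (\<open>X\<index>\<close>)
unbundle no fps_syntax

section \<open>Linear algebraic groups in $GL_n$\<close>

type_synonym ('a, 'n) mpoly = "('n \<times> 'n \<Rightarrow>\<^sub>0 nat) \<Rightarrow>\<^sub>0 'a"
  \<comment> \<open>polynomials in the matrix entries, with formal coefficients\<close>

definition mpeval :: "('a::comm_ring_1, 'n::finite) mpoly \<Rightarrow> 'a^'n^'n \<Rightarrow> 'a" where
  "mpeval p g = (\<Sum>m\<in>Poly_Mapping.keys p. Poly_Mapping.lookup p m *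
     (\<Prod>v\<in>Poly_Mapping.keys m. (g $ fst v $ snd v) ^ Poly_Mapping.lookup m v))"

definition coeffs_in :: "'a set \<Rightarrow> ('a::zero, 'n) mpoly \<Rightarrow> bool" where
  "coeffs_in C p \<longleftrightarrow> (\<forall>m\<in>Poly_Mapping.keys p. Poly_Mapping.lookup p m \<in> C)"

definition det_poly :: "('a::comm_ring_1, 'n::finite) mpoly" where
  "det_poly = det (\<chi> i j. Poly_Mapping.single (Poly_Mapping.single (i, j) 1) 1)"

definition ideal_gen :: "'p set \<Rightarrow> 'p::comm_ring_1 set" where
  "ideal_gen S = {\<Sum>s\<in>T. q s * s | T q. finite T \<and> T \<subseteq> S}"

definition mat_map :: "('a \<Rightarrow> 'b) \<Rightarrow> 'a^'n^'n \<Rightarrow> 'b^'n^'n" where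
  "mat_map f g = (\<chi> i j. f (g $ i $ j))"

definition GL :: "('a::comm_ring_1^'n^'n) monoid" where
  "GL = \<lparr>carrier = {g. invertible g}, monoid.mult = (**), one = mat 1\<rparr>"

definition zero_locus :: "('a::comm_ring_1, 'n::finite) mpoly set \<Rightarrow> ('a^'n^'n) set" where
  "zero_locus S = {g \<in> carrier GL. \<forall>p\<in>S. mpeval p g = 0}"

text \<open>From here up to Borel subgroups the field of type \<open>'l\<close> is thought of as algebraically
  closed, and algebraic groups are identified with their \<open>'l\<close>-points. Since the determinant is
  invertible on $GL_n$, polynomials in the matrix entries suffice to cut out closed subsets.\<close>

definition zar_closed :: "('l::field^'n::finite^'n) set \<Rightarrow> bool" where
  "zar_closed X \<longleftrightarrow> (\<exists>S. X = zero_locus S)"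

definition zar_connected :: "('l::field^'n::finite^'n) set \<Rightarrow> bool" where
  "zar_connected X \<longleftrightarrow> X \<noteq> {} \<and>
     (\<forall>Y Z. zar_closed Y \<and> zar_closed Z \<and> X \<subseteq> Y \<union> Z \<and> X \<inter> Y \<inter> Z = {} \<longrightarrow>
        X \<inter> Y = {} \<or> X \<inter> Z = {})"

definition closed_subgroup :: "('l::field^'n::finite^'n) set \<Rightarrow> bool" where
  "closed_subgroup X \<longleftrightarrow> zar_closed X \<and> subgroup X GL"

definition defined_over :: "'l set \<Rightarrow> ('l::field^'n::finite^'n) set \<Rightarrow> bool" where
  "defined_over C X \<longleftrightarrow>
     {p. \<forall>g\<in>X. mpeval p g = 0} = ideal_gen {p. coeffs_in C p \<and> (\<forall>g\<in>X. mpeval p g = 0)}"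

definition regular_over ::
    "'l set \<Rightarrow> ('l::field^'n::finite^'n) set \<Rightarrow> ('l^'n^'n \<Rightarrow> 'l^'n^'n) \<Rightarrow> bool" where
  "regular_over C X \<phi> \<longleftrightarrow> (\<exists>(P :: 'n \<Rightarrow> 'n \<Rightarrow> ('l, 'n) mpoly) (d::nat).
     (\<forall>i j. coeffs_in C (P i j)) \<and>
     (\<forall>g\<in>X. \<forall>i j. \<phi> g $ i $ j = mpeval (P i j) g / det g ^ d))"

definition alg_iso_over :: "'l set \<Rightarrow> ('l::field^'n::finite^'n) set \<Rightarrow> ('l^'n^'n) set
    \<Rightarrow> ('l^'n^'n \<Rightarrow> 'l^'n^'n) \<Rightarrow> bool" where
  "alg_iso_over C X Y \<phi> \<longleftrightarrow> \<phi> \<in> iso (GL\<lparr>carrier := X\<rparr>) (GL\<lparr>carrier := Y\<rparr>) \<and>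
     regular_over C X \<phi> \<and> regular_over C Y (inv_into X \<phi>)"

text \<open>The split torus of rank \<open>card R\<close>. A torus in $GL_n$ has rank at most $n$, so every split
  torus in $GL_n$ is isomorphic to one of these.\<close>

definition diag_torus :: "'n set \<Rightarrow> ('l::field^'n::finite^'n) set" where
  "diag_torus R = {g \<in> carrier GL. (\<forall>i j. i \<noteq> j \<longrightarrow> g $ i $ j = 0) \<and> (\<forall>i. i \<notin> R \<longrightarrow> g $ i $ i = 1)}"

definition split_torus :: "'l set \<Rightarrow> ('l::field^'n::finite^'n) set \<Rightarrow> bool" where
  "split_torus C T \<longleftrightarrow> closed_subgroup T \<and> defined_over C T \<and>
     (\<exists>R \<phi>. alg_iso_over C (diag_torus R) T \<phi>)"

definition maximal_torus :: "('l::field^'n::finite^'n) set \<Rightarrow> ('l^'n^'n) set \<Rightarrow> bool" where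
  "maximal_torus X T \<longleftrightarrow> split_torus UNIV T \<and> T \<subseteq> X \<and>
     (\<forall>T'. split_torus UNIV T' \<and> T \<subseteq> T' \<and> T' \<subseteq> X \<longrightarrow> T' = T)"

definition split_over :: "'l set \<Rightarrow> ('l::field^'n::finite^'n) set \<Rightarrow> bool" where
  "split_over C X \<longleftrightarrow> (\<exists>T. maximal_torus X T \<and> split_torus C T)"

definition unipotent :: "'l::field^'n::finite^'n \<Rightarrow> bool" where
  "unipotent g \<longleftrightarrow> (\<exists>d. ((\<lambda>A. A ** (g - mat 1)) ^^ d) (mat 1) = 0)"

definition conn_normal_unipotent :: "('l::field^'n::finite^'n) set \<Rightarrow> ('l^'n^'n) set \<Rightarrow> bool" where
  "conn_normal_unipotent X N \<longleftrightarrow> closed_subgroup N \<and> zar_connected N \<and>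
     N \<lhd> (GL\<lparr>carrier := X\<rparr>) \<and> (\<forall>g\<in>N. unipotent g)"

definition is_unipotent_radical :: "('l::field^'n::finite^'n) set \<Rightarrow> ('l^'n^'n) set \<Rightarrow> bool" where
  "is_unipotent_radical X N \<longleftrightarrow> conn_normal_unipotent X N \<and>
     (\<forall>N'. conn_normal_unipotent X N' \<longrightarrow> N' \<subseteq> N)"

definition connected_reductive :: "('l::field^'n::finite^'n) set \<Rightarrow> bool" where
  "connected_reductive X \<longleftrightarrow> closed_subgroup X \<and> zar_connected X \<and> is_unipotent_radical X {mat 1}"

definition conn_solvable :: "('l::field^'n::finite^'n) set \<Rightarrow> bool" where
  "conn_solvable B \<longleftrightarrow> closed_subgroup B \<and> zar_connected B \<and> solvable (GL\<lparr>carrier := B\<rparr>)"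

definition borel_subgroup :: "('l::field^'n::finite^'n) set \<Rightarrow> ('l^'n^'n) set \<Rightarrow> bool" where
  "borel_subgroup X B \<longleftrightarrow> conn_solvable B \<and> B \<subseteq> X \<and>
     (\<forall>B'. conn_solvable B' \<and> B \<subseteq> B' \<and> B' \<subseteq> X \<longrightarrow> B' = B)"


section \<open>Nonarchimedean local fields and integral models\<close>

text \<open>A locally compact nonarchimedean field with absolute value \<open>nrm\<close>, prime element \<open>pr\<close>, and
  residue field \<open>'r\<close>; only the values of the residue map \<open>rs\<close> on the ring of integers matter.\<close>

locale nonarch_local_field =
  fixes nrm :: "'f::field \<Rightarrow> real" and pr :: 'f and rs :: "'f \<Rightarrow> 'r::field"
  assumes nrm_nonneg: "0 \<le> nrm x"
    and nrm_zero: "nrm x = 0 \<longleftrightarrow> x = 0"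
    and nrm_mult: "nrm (x * y) = nrm x * nrm y"
    and nrm_ultra: "nrm (x + y) \<le> max (nrm x) (nrm y)"
    and nrm_nontrivial: "\<exists>x. x \<noteq> 0 \<and> nrm x \<noteq> 1"
    and locally_compact: "locally_compact_space (Metric_space.mtopology UNIV (\<lambda>x y. nrm (x - y)))"
    and prime_element: "nrm pr < 1" "nrm x < 1 \<Longrightarrow> nrm x \<le> nrm pr"
    and rs_add: "\<lbrakk>nrm x \<le> 1; nrm y \<le> 1\<rbrakk> \<Longrightarrow> rs (x + y) = rs x + rs y"
    and rs_mult: "\<lbrakk>nrm x \<le> 1; nrm y \<le> 1\<rbrakk> \<Longrightarrow> rs (x * y) = rs x * rs y"
    and rs_one: "rs 1 = 1"
    and rs_surj: "rs ` {x. nrm x \<le> 1} = UNIV"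
    and rs_kernel: "nrm x \<le> 1 \<Longrightarrow> rs x = 0 \<longleftrightarrow> nrm x < 1"

definition F_points :: "('f::field alg_closure^'n::finite^'n) set \<Rightarrow> ('f^'n^'n) monoid" where
  "F_points G = GL\<lparr>carrier := {g. mat_map to_ac g \<in> G}\<rparr>"

definition F_topology ::
    "('f::field \<Rightarrow> real) \<Rightarrow> ('f alg_closure^'n::finite^'n) set \<Rightarrow> ('f^'n^'n) topology" where
  "F_topology nrm G = Metric_space.mtopology (carrier (F_points G))
     (\<lambda>g h. Max (range (\<lambda>(i, j). nrm (g $ i $ j - h $ i $ j))))"

text \<open>The integral model is the schematic closure of \<open>G\<close> in $GL_{n,\mathfrak O}$, i.e. the closed
  subgroup scheme cut out by all integral polynomials vanishing on \<open>G\<close>. Every closed subgroup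
  scheme of $GL_{n,\mathfrak O}$ that is flat over the discrete valuation ring $\mathfrak O$ is the
  schematic closure of its generic fibre.\<close>

definition integral_equations ::
    "('f::field \<Rightarrow> real) \<Rightarrow> ('f alg_closure^'n::finite^'n) set \<Rightarrow> ('f, 'n) mpoly set" where
  "integral_equations nrm G = {p. coeffs_in {x. nrm x \<le> 1} p \<and>
     (\<forall>g\<in>G. mpeval (Poly_Mapping.map to_ac p) g = 0)}"

definition O_points ::
    "('f::field \<Rightarrow> real) \<Rightarrow> ('f alg_closure^'n::finite^'n) set \<Rightarrow> ('f^'n^'n) set" where
  "O_points nrm G = {g. (\<forall>i j. nrm (g $ i $ j) \<le> 1) \<and> nrm (det g) = 1 \<and>
     (\<forall>p\<in>integral_equations nrm G. mpeval p g = 0)}"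

definition congruence_subgroup ::
    "('f::field \<Rightarrow> real) \<Rightarrow> 'f \<Rightarrow> ('f alg_closure^'n::finite^'n) set \<Rightarrow> nat \<Rightarrow> ('f^'n^'n) set" where
  "congruence_subgroup nrm pr G m =
     {g \<in> O_points nrm G. \<forall>i j. nrm (g $ i $ j - mat 1 $ i $ j) \<le> nrm (pr ^ m)}"

definition special_equations :: "('f::field \<Rightarrow> real) \<Rightarrow> ('f \<Rightarrow> 'r::field)
    \<Rightarrow> ('f alg_closure^'n::finite^'n) set \<Rightarrow> ('r alg_closure, 'n) mpoly set" where
  "special_equations nrm rs G =
     Poly_Mapping.map (to_ac \<circ> rs) ` integral_equations nrm G"

abbreviation special_fibre :: "('f::field \<Rightarrow> real) \<Rightarrow> ('f \<Rightarrow> 'r::field)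
    \<Rightarrow> ('f alg_closure^'n::finite^'n) set \<Rightarrow> ('r alg_closure^'n^'n) set" where
  "special_fibre nrm rs G \<equiv> zero_locus (special_equations nrm rs G)"

text \<open>Reducedness of $L[x_{ij}, \det^{-1}]/(S)$. For a group scheme of finite type over a field,
  reducedness over the algebraic closure is equivalent to smoothness.\<close>

definition reduced_scheme :: "('l::field, 'n::finite) mpoly set \<Rightarrow> bool" where
  "reduced_scheme S \<longleftrightarrow> (\<forall>f (r::nat). (\<exists>d. det_poly ^ d * f ^ r \<in> ideal_gen S) \<longrightarrow>
     (\<exists>d. det_poly ^ d * f \<in> ideal_gen S))"

text \<open>A split connected reductive group \<open>G\<close> over \<open>'f\<close> with a hyperspecial vertex and a chamber
  containing it. The hyperspecial vertex is given by its Bruhat--Tits group scheme: the smooth affine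
  $\mathfrak O$-models of \<open>G\<close> whose special fibre is connected reductive are exactly the Bruhat--Tits
  group schemes of the hyperspecial vertices. Such a scheme is affine of finite type and flat over
  $\mathfrak O$, hence a closed subgroup scheme of some $GL_{n,\mathfrak O}$; \<open>G\<close> is embedded in
  $GL_n$ accordingly. The chambers containing the vertex correspond to the Borel subgroups \<open>B\<close>,
  defined over the residue field, of the special fibre; \<open>N\<close> is the unipotent radical of \<open>B\<close>.\<close>

locale hyperspecial_setting = nonarch_local_field nrm pr rs
  for nrm :: "'f::field \<Rightarrow> real" and pr :: 'f and rs :: "'f \<Rightarrow> 'r::field" +
  fixes G :: "('f alg_closure^'n::finite^'n) set"
    and B N :: "('r alg_closure^'n^'n) set"
  assumes generic_reductive: "connected_reductive G"
    and generic_defined: "defined_over (range to_ac) G"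
    and generic_split: "split_over (range to_ac) G"
    and special_smooth: "reduced_scheme (special_equations nrm rs G)"
    and special_reductive: "connected_reductive (special_fibre nrm rs G)"
    and special_split: "split_over (range to_ac) (special_fibre nrm rs G)"
    and borel: "borel_subgroup (special_fibre nrm rs G) B" "defined_over (range to_ac) B"
    and radical: "is_unipotent_radical B N"

definition pro_p_Iwahori :: "('f::field \<Rightarrow> real) \<Rightarrow> ('f \<Rightarrow> 'r::field)
    \<Rightarrow> ('f alg_closure^'n::finite^'n) set \<Rightarrow> ('r alg_closure^'n^'n) set \<Rightarrow> ('f^'n^'n) set" where
  "pro_p_Iwahori nrm rs G N = {g \<in> O_points nrm G. mat_map (to_ac \<circ> rs) g \<in> N}"


section \<open>Modules and representations\<close>

text \<open>Modules over not necessarily commutative rings use the library's \<open>module\<close> records (with the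
  multiplicative fields left unspecified). For a right module, \<open>smult r y\<close> stands for $y r$.
  Homomorphisms are extensional functions.\<close>

definition left_module :: "('r, 'a) ring_scheme \<Rightarrow> ('r, 'm, 'b) module_scheme \<Rightarrow> bool" where
  "left_module R M \<longleftrightarrow> abelian_group M \<and>
     (\<forall>r\<in>carrier R. \<forall>x\<in>carrier M. r \<odot>\<^bsub>M\<^esub> x \<in> carrier M) \<and>
     (\<forall>r\<in>carrier R. \<forall>x\<in>carrier M. \<forall>y\<in>carrier M. r \<odot>\<^bsub>M\<^esub> (x \<oplus>\<^bsub>M\<^esub> y) = r \<odot>\<^bsub>M\<^esub> x \<oplus>\<^bsub>M\<^esub> r \<odot>\<^bsub>M\<^esub> y) \<and>
     (\<forall>r\<in>carrier R. \<forall>s\<in>carrier R. \<forall>x\<in>carrier M. (r \<oplus>\<^bsub>R\<^esub> s) \<odot>\<^bsub>M\<^esub> x = r \<odot>\<^bsub>M\<^esub> x \<oplus>\<^bsub>M\<^esub> s \<odot>\<^bsub>M\<^esub> x) \<and>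
     (\<forall>r\<in>carrier R. \<forall>s\<in>carrier R. \<forall>x\<in>carrier M. (r \<otimes>\<^bsub>R\<^esub> s) \<odot>\<^bsub>M\<^esub> x = r \<odot>\<^bsub>M\<^esub> (s \<odot>\<^bsub>M\<^esub> x)) \<and>
     (\<forall>x\<in>carrier M. \<one>\<^bsub>R\<^esub> \<odot>\<^bsub>M\<^esub> x = x)"

definition lmod_hom :: "('r, 'a) ring_scheme \<Rightarrow> ('r, 'm, 'b) module_scheme
    \<Rightarrow> ('r, 'n, 'c) module_scheme \<Rightarrow> ('m \<Rightarrow> 'n) set" where
  "lmod_hom R M N = {f \<in> carrier M \<rightarrow>\<^sub>E carrier N.
     (\<forall>x\<in>carrier M. \<forall>y\<in>carrier M. f (x \<oplus>\<^bsub>M\<^esub> y) = f x \<oplus>\<^bsub>N\<^esub> f y) \<and>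
     (\<forall>r\<in>carrier R. \<forall>x\<in>carrier M. f (r \<odot>\<^bsub>M\<^esub> x) = r \<odot>\<^bsub>N\<^esub> f x)}"

text \<open>The left module $Y^* = \mathrm{Hom}_R(Y,R)$ of a right module \<open>Y\<close>.\<close>

definition dual :: "('r, 'a) ring_scheme \<Rightarrow> ('r, 'y, 'b) module_scheme \<Rightarrow> ('r, 'y \<Rightarrow> 'r) module" where
  "dual R Y = \<lparr>
     carrier = {l \<in> carrier Y \<rightarrow>\<^sub>E carrier R.
       (\<forall>x\<in>carrier Y. \<forall>y\<in>carrier Y. l (x \<oplus>\<^bsub>Y\<^esub> y) = l x \<oplus>\<^bsub>R\<^esub> l y) \<and>
       (\<forall>r\<in>carrier R. \<forall>x\<in>carrier Y. l (r \<odot>\<^bsub>Y\<^esub> x) = l x \<otimes>\<^bsub>R\<^esub> r)},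
     monoid.mult = undefined, monoid.one = undefined,
     ring.zero = (\<lambda>x\<in>carrier Y. \<zero>\<^bsub>R\<^esub>),
     ring.add = (\<lambda>l l'. \<lambda>x\<in>carrier Y. l x \<oplus>\<^bsub>R\<^esub> l' x),
     module.smult = (\<lambda>r l. \<lambda>x\<in>carrier Y. r \<otimes>\<^bsub>R\<^esub> l x)\<rparr>"

text \<open>The tensor product over \<open>R\<close> of a right module \<open>Y\<close> and a left module \<open>M\<close>, as a quotient of the
  free abelian group on pairs.\<close>

definition tensor_relations :: "('r, 'a) ring_scheme \<Rightarrow> ('r, 'y, 'b) module_scheme
    \<Rightarrow> ('r, 'm, 'c) module_scheme \<Rightarrow> ('y \<times> 'm \<Rightarrow>\<^sub>0 int) set" where
  "tensor_relations R Y M =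
     {frag_of (x \<oplus>\<^bsub>Y\<^esub> y, m) - frag_of (x, m) - frag_of (y, m) | x y m.
        x \<in> carrier Y \<and> y \<in> carrier Y \<and> m \<in> carrier M} \<union>
     {frag_of (x, m \<oplus>\<^bsub>M\<^esub> n) - frag_of (x, m) - frag_of (x, n) | x m n.
        x \<in> carrier Y \<and> m \<in> carrier M \<and> n \<in> carrier M} \<union>
     {frag_of (r \<odot>\<^bsub>Y\<^esub> x, m) - frag_of (x, r \<odot>\<^bsub>M\<^esub> m) | r x m.
        r \<in> carrier R \<and> x \<in> carrier Y \<and> m \<in> carrier M}"

definition tensor :: "('r, 'a) ring_scheme \<Rightarrow> ('r, 'y, 'b) module_scheme
    \<Rightarrow> ('r, 'm, 'c) module_scheme \<Rightarrow> ('y \<times> 'm \<Rightarrow>\<^sub>0 int) set monoid" where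
  "tensor R Y M = free_Abelian_group (carrier Y \<times> carrier M) Mod
     generate (free_Abelian_group (carrier Y \<times> carrier M)) (tensor_relations R Y M)"

text \<open>Coinvariants of a left module \<open>M\<close> under a right action \<open>a\<close> of a group \<open>U\<close> commuting with the
  module structure; the subgroup divided out is then a submodule.\<close>

definition coinv_sub :: "'g set \<Rightarrow> ('g \<Rightarrow> 'm \<Rightarrow> 'm) \<Rightarrow> ('r, 'm, 'b) module_scheme \<Rightarrow> 'm set" where
  "coinv_sub U a M = generate (add_monoid M) {a g x \<ominus>\<^bsub>M\<^esub> x | g x. g \<in> U \<and> x \<in> carrier M}"

definition coinvariants ::
    "'g set \<Rightarrow> ('g \<Rightarrow> 'm \<Rightarrow> 'm) \<Rightarrow> ('r, 'm, 'b) module_scheme \<Rightarrow> ('r, 'm set) module" where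
  "coinvariants U a M = \<lparr>
     carrier = a_rcosets\<^bsub>M\<^esub> (coinv_sub U a M),
     monoid.mult = undefined, monoid.one = undefined,
     ring.zero = coinv_sub U a M,
     ring.add = (\<lambda>c d. c <+>\<^bsub>M\<^esub> d),
     module.smult = (\<lambda>r c. coinv_sub U a M <+>\<^bsub>M\<^esub> (smult M r ` c))\<rparr>"

definition type_ring :: "'k::field ring" where
  "type_ring = \<lparr>carrier = UNIV, monoid.mult = (*), one = 1, ring.zero = 0, ring.add = (+)\<rparr>"

record ('g, 'k, 'v) rep = "('k, 'v) module" +
  gact :: "'g \<Rightarrow> 'v \<Rightarrow> 'v"

definition smooth_rep :: "('g, 'a) monoid_scheme \<Rightarrow> 'g topology \<Rightarrow> ('g, 'k::field, 'v) rep \<Rightarrow> bool" where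
  "smooth_rep G \<T> V \<longleftrightarrow> Module.module type_ring V \<and>
     (\<forall>g\<in>carrier G. \<forall>v\<in>carrier V. gact V g v \<in> carrier V) \<and>
     (\<forall>g\<in>carrier G. \<forall>v\<in>carrier V. \<forall>w\<in>carrier V.
        gact V g (v \<oplus>\<^bsub>V\<^esub> w) = gact V g v \<oplus>\<^bsub>V\<^esub> gact V g w) \<and>
     (\<forall>g\<in>carrier G. \<forall>a. \<forall>v\<in>carrier V. gact V g (a \<odot>\<^bsub>V\<^esub> v) = a \<odot>\<^bsub>V\<^esub> gact V g v) \<and>
     (\<forall>v\<in>carrier V. gact V \<one>\<^bsub>G\<^esub> v = v) \<and>
     (\<forall>g\<in>carrier G. \<forall>h\<in>carrier G. \<forall>v\<in>carrier V. gact V (g \<otimes>\<^bsub>G\<^esub> h) v = gact V g (gact V h v)) \<and>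
     (\<forall>v\<in>carrier V. openin \<T> {g \<in> carrier G. gact V g v = v})"

definition rep_hom :: "('g, 'a) monoid_scheme \<Rightarrow> ('g, 'k::field, 'v) rep \<Rightarrow> ('g, 'k, 'w) rep
    \<Rightarrow> ('v \<Rightarrow> 'w) set" where
  "rep_hom G V W = {f \<in> lmod_hom type_ring V W.
     \<forall>g\<in>carrier G. \<forall>v\<in>carrier V. f (gact V g v) = gact W g (f v)}"

definition generated_by_invariants ::
    "('g, 'a) monoid_scheme \<Rightarrow> 'g set \<Rightarrow> ('g, 'k::field, 'v) rep \<Rightarrow> bool" where
  "generated_by_invariants G I V \<longleftrightarrow> (\<forall>W. submodule W type_ring V \<and>
     (\<forall>g\<in>carrier G. \<forall>w\<in>W. gact V g w \<in> W) \<and>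
     {v \<in> carrier V. \<forall>g\<in>I. gact V g v = v} \<subseteq> W \<longrightarrow> W = carrier V)"


section \<open>The universal module and the Hecke algebra\<close>

text \<open>Here \<open>G\<close> is an abstract group with a subgroup \<open>I\<close>. Since $G/I$ is discrete for \<open>I\<close> open,
  compactly supported functions on it are those of finite support; functions on $G/I$ are extended
  by zero to all subsets of \<open>G\<close>.\<close>

type_synonym ('g, 'k) ifun = "'g set \<Rightarrow> 'k"
type_synonym ('g, 'k) hecke = "('g, 'k) ifun \<Rightarrow> ('g, 'k) ifun"

definition ind_space :: "('g, 'a) monoid_scheme \<Rightarrow> 'g set \<Rightarrow> ('g, 'k::field) ifun set" where
  "ind_space G I = {x. finite {c. x c \<noteq> 0} \<and> {c. x c \<noteq> 0} \<subseteq> lcosets\<^bsub>G\<^esub> I}"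

definition translate :: "('g, 'a) monoid_scheme \<Rightarrow> 'g \<Rightarrow> ('g, 'k) ifun \<Rightarrow> ('g, 'k) ifun" where
  "translate G g x = (\<lambda>c. x (inv\<^bsub>G\<^esub> g <#\<^bsub>G\<^esub> c))"

text \<open>$H = \mathrm{End}_{k[G]}(\mathbf X)^{\mathrm{op}}$; note the order of composition in the
  multiplication.\<close>

definition hecke_algebra :: "('g, 'a) monoid_scheme \<Rightarrow> 'g set \<Rightarrow> ('g, 'k::field) hecke ring" where
  "hecke_algebra G I = \<lparr>
     carrier = {h \<in> ind_space G I \<rightarrow>\<^sub>E ind_space G I.
       (\<forall>x\<in>ind_space G I. \<forall>y\<in>ind_space G I. h (\<lambda>c. x c + y c) = (\<lambda>c. h x c + h y c)) \<and>
       (\<forall>a. \<forall>x\<in>ind_space G I. h (\<lambda>c. a * x c) = (\<lambda>c. a * h x c)) \<and>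
       (\<forall>g\<in>carrier G. \<forall>x\<in>ind_space G I. h (translate G g x) = translate G g (h x))},
     monoid.mult = (\<lambda>h h'. compose (ind_space G I) h' h),
     one = (\<lambda>x\<in>ind_space G I. x),
     ring.zero = (\<lambda>x\<in>ind_space G I. \<lambda>c. 0),
     ring.add = (\<lambda>h h'. \<lambda>x\<in>ind_space G I. \<lambda>c. h x c + h' x c)\<rparr>"

definition hecke_scalar :: "('g, 'a) monoid_scheme \<Rightarrow> 'g set \<Rightarrow> 'k::field \<Rightarrow> ('g, 'k) hecke" where
  "hecke_scalar G I a = (\<lambda>x\<in>ind_space G I. \<lambda>c. a * x c)"

text \<open>$\mathbf X$ as a right module over the Hecke algebra: $x h = h(x)$.\<close>

definition univ_module ::
    "('g, 'a) monoid_scheme \<Rightarrow> 'g set \<Rightarrow> (('g, 'k::field) hecke, ('g, 'k) ifun) module" where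
  "univ_module G I = \<lparr>carrier = ind_space G I, monoid.mult = undefined, monoid.one = undefined,
     ring.zero = (\<lambda>c. 0), ring.add = (\<lambda>x y c. x c + y c), module.smult = (\<lambda>h x. h x)\<rparr>"

definition inv_module :: "('g, 'a) monoid_scheme \<Rightarrow> 'g set \<Rightarrow> 'g set
    \<Rightarrow> (('g, 'k::field) hecke, ('g, 'k) ifun) module" where
  "inv_module G I U = (univ_module G I)
     \<lparr>carrier := {x \<in> ind_space G I. \<forall>g\<in>U. translate G g x = x}\<rparr>"

definition dual_X ::
    "('g, 'a) monoid_scheme \<Rightarrow> 'g set \<Rightarrow> (('g, 'k::field) hecke, ('g, 'k) ifun \<Rightarrow> ('g, 'k) hecke) module" where
  "dual_X G I = dual (hecke_algebra G I) (univ_module G I)"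

definition dual_inv :: "('g, 'a) monoid_scheme \<Rightarrow> 'g set \<Rightarrow> 'g set
    \<Rightarrow> (('g, 'k::field) hecke, ('g, 'k) ifun \<Rightarrow> ('g, 'k) hecke) module" where
  "dual_inv G I U = dual (hecke_algebra G I) (inv_module G I U)"

text \<open>The right action $(\lambda g)(x) = \lambda(gx)$ on functions with domain \<open>Y\<close>.\<close>

definition dual_act :: "('g, 'a) monoid_scheme \<Rightarrow> ('g, 'k) ifun set \<Rightarrow> 'g
    \<Rightarrow> (('g, 'k) ifun \<Rightarrow> 'h) \<Rightarrow> (('g, 'k) ifun \<Rightarrow> 'h)" where
  "dual_act G Y g l = (\<lambda>x\<in>Y. l (translate G g x))"

text \<open>Hypothesis (sur), with $H = \mathbf X^I$ as right $H$-modules.\<close>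

definition hyp_sur :: "('g, 'a) monoid_scheme \<Rightarrow> 'g set \<Rightarrow> 'k::field itself \<Rightarrow> bool" where
  "hyp_sur G I _ \<longleftrightarrow>
     (\<lambda>l. restrict l (carrier (inv_module G I I))) ` carrier (dual_X G I)
     = carrier (dual_inv G I I :: (('g, 'k) hecke, ('g, 'k) ifun \<Rightarrow> ('g, 'k) hecke) module)"


section \<open>The functor and the torsion pair\<close>

definition hom_rep :: "('g, 'a) monoid_scheme \<Rightarrow> 'g set \<Rightarrow> (('g, 'k::field) hecke, 'm) module
    \<Rightarrow> ('g, 'k, (('g, 'k) ifun \<Rightarrow> ('g, 'k) hecke) \<Rightarrow> 'm) rep" where
  "hom_rep G I M = \<lparr>
     carrier = lmod_hom (hecke_algebra G I) (dual_X G I) M,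
     monoid.mult = undefined, monoid.one = undefined,
     ring.zero = (\<lambda>l\<in>carrier (dual_X G I). \<zero>\<^bsub>M\<^esub>),
     ring.add = (\<lambda>\<phi> \<psi>. \<lambda>l\<in>carrier (dual_X G I). \<phi> l \<oplus>\<^bsub>M\<^esub> \<psi> l),
     module.smult = (\<lambda>a \<phi>. \<lambda>l\<in>carrier (dual_X G I). hecke_scalar G I a \<odot>\<^bsub>M\<^esub> \<phi> l),
     gact = (\<lambda>g \<phi>. \<lambda>l\<in>carrier (dual_X G I). \<phi> (dual_act G (ind_space G I) g l))\<rparr>"

text \<open>\<open>tau_lin\<close> is the additive extension of $(x,m) \mapsto [\lambda \mapsto \lambda(x)m]$ to the free
  abelian group; \<open>tau\<close> is the map it induces on the tensor product.\<close>

definition tau_lin :: "('g, 'a) monoid_scheme \<Rightarrow> 'g set \<Rightarrow> (('g, 'k::field) hecke, 'm) module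
    \<Rightarrow> (('g, 'k) ifun \<times> 'm \<Rightarrow>\<^sub>0 int) \<Rightarrow> (('g, 'k) ifun \<Rightarrow> ('g, 'k) hecke) \<Rightarrow> 'm" where
  "tau_lin G I M z = (\<lambda>l\<in>carrier (dual_X G I). \<Oplus>\<^bsub>M\<^esub>p\<in>Poly_Mapping.keys z.
     [Poly_Mapping.lookup z p] \<cdot>\<^bsub>M\<^esub> (l (fst p) \<odot>\<^bsub>M\<^esub> snd p))"

definition tau :: "('g, 'a) monoid_scheme \<Rightarrow> 'g set \<Rightarrow> (('g, 'k::field) hecke, 'm) module
    \<Rightarrow> (('g, 'k) ifun \<times> 'm \<Rightarrow>\<^sub>0 int) set \<Rightarrow> (('g, 'k) ifun \<Rightarrow> ('g, 'k) hecke) \<Rightarrow> 'm" where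
  "tau G I M c = the_elem (tau_lin G I M ` c)"

definition t_obj :: "('g, 'a) monoid_scheme \<Rightarrow> 'g set \<Rightarrow> (('g, 'k::field) hecke, 'm) module
    \<Rightarrow> ('g, 'k, (('g, 'k) ifun \<Rightarrow> ('g, 'k) hecke) \<Rightarrow> 'm) rep" where
  "t_obj G I M = (hom_rep G I M)
     \<lparr>carrier := tau G I M ` carrier (tensor (hecke_algebra G I) (univ_module G I) M)\<rparr>"

text \<open>The map $\mathfrak t(M) \to \mathfrak t(M')$ is the restriction of
  $\mathrm{Hom}_H(\mathbf X^*, f)$; by naturality of $\tau$ it is also induced by
  $\mathbf X \otimes_H f$.\<close>

definition t_mor :: "('g, 'a) monoid_scheme \<Rightarrow> 'g set \<Rightarrow> (('g, 'k::field) hecke, 'm) module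
    \<Rightarrow> (('g, 'k) hecke, 'm) module \<Rightarrow> ('m \<Rightarrow> 'm)
    \<Rightarrow> ((('g, 'k) ifun \<Rightarrow> ('g, 'k) hecke) \<Rightarrow> 'm) \<Rightarrow> (('g, 'k) ifun \<Rightarrow> ('g, 'k) hecke) \<Rightarrow> 'm" where
  "t_mor G I M M' f = (\<lambda>\<phi>\<in>carrier (t_obj G I M). compose (carrier (dual_X G I)) f \<phi>)"

text \<open>\<open>bold_Z G I U\<close> is $\mathrm{im}(\mathbf X^* \to (\mathbf X^U)^*)$, to be used for $U = K_m$.\<close>

definition bold_Z :: "('g, 'a) monoid_scheme \<Rightarrow> 'g set \<Rightarrow> 'g set
    \<Rightarrow> (('g, 'k::field) hecke, ('g, 'k) ifun \<Rightarrow> ('g, 'k) hecke) module" where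
  "bold_Z G I U = (dual_inv G I U)
     \<lparr>carrier := (\<lambda>l. restrict l (carrier (inv_module G I U))) ` carrier (dual_X G I)\<rparr>"

definition coinv_I :: "('g, 'a) monoid_scheme \<Rightarrow> 'g set \<Rightarrow> 'g set
    \<Rightarrow> (('g, 'k::field) hecke, ('g, 'k) ifun \<Rightarrow> ('g, 'k) hecke) module
    \<Rightarrow> (('g, 'k) hecke, (('g, 'k) ifun \<Rightarrow> ('g, 'k) hecke) set) module" where
  "coinv_I G I U = coinvariants I (dual_act G (carrier (inv_module G I U :: (('g, 'k) hecke, ('g, 'k) ifun) module)))"

text \<open>The two maps $(\mathbf Z_m)_I \to ((\mathbf X^{K_m})^*)_I \to (\mathbf X^I)^*$.\<close>

definition coinv_incl :: "('g, 'a) monoid_scheme \<Rightarrow> 'g set \<Rightarrow> 'g set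
    \<Rightarrow> (('g, 'k::field) ifun \<Rightarrow> ('g, 'k) hecke) set \<Rightarrow> (('g, 'k) ifun \<Rightarrow> ('g, 'k) hecke) set" where
  "coinv_incl G I U c = \<zero>\<^bsub>coinv_I G I U (dual_inv G I U)\<^esub> <+>\<^bsub>dual_inv G I U\<^esub> c"

definition coinv_restr :: "('g, 'a) monoid_scheme \<Rightarrow> 'g set
    \<Rightarrow> (('g, 'k::field) ifun \<Rightarrow> ('g, 'k) hecke) set \<Rightarrow> ('g, 'k) ifun \<Rightarrow> ('g, 'k) hecke" where
  "coinv_restr G I c =
     the_elem ((\<lambda>l. restrict l (carrier (inv_module G I I :: (('g, 'k) hecke, ('g, 'k) ifun) module))) ` c)"

definition Z_module :: "('g, 'a) monoid_scheme \<Rightarrow> 'g set \<Rightarrow> 'g set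
    \<Rightarrow> (('g, 'k::field) hecke, (('g, 'k) ifun \<Rightarrow> ('g, 'k) hecke) set) module" where
  "Z_module G I U = (coinv_I G I U (bold_Z G I U))
     \<lparr>carrier := {c \<in> carrier (coinv_I G I U (bold_Z G I U)).
        coinv_restr G I (coinv_incl G I U c) = \<zero>\<^bsub>dual_inv G I I\<^esub>}\<rparr>"

definition torsionfree :: "('g, 'a) monoid_scheme \<Rightarrow> 'g set \<Rightarrow> (nat \<Rightarrow> 'g set)
    \<Rightarrow> (('g, 'k::field) hecke, 'm) module \<Rightarrow> bool" where
  "torsionfree G I K M \<longleftrightarrow> left_module (hecke_algebra G I) M \<and>
     (\<forall>m\<ge>1. lmod_hom (hecke_algebra G I) (Z_module G I (K m)) M
        = {\<lambda>z\<in>carrier (Z_module G I (K m)). \<zero>\<^bsub>M\<^esub>})"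


section \<open>Categories\<close>

record ('o, 'a) category =
  Obj :: "'o set"
  Hom :: "'o \<Rightarrow> 'o \<Rightarrow> 'a set"
  Ident :: "'o \<Rightarrow> 'a"
  Comp :: "'o \<Rightarrow> 'o \<Rightarrow> 'o \<Rightarrow> 'a \<Rightarrow> 'a \<Rightarrow> 'a"
    \<comment> \<open>\<open>Comp C X Y Z g f\<close> is the composite of \<open>f\<close> from \<open>X\<close> to \<open>Y\<close> and \<open>g\<close> from \<open>Y\<close> to \<open>Z\<close>\<close>

definition is_functor ::
    "('o, 'a) category \<Rightarrow> ('p, 'b) category \<Rightarrow> ('o \<Rightarrow> 'p) \<Rightarrow> ('o \<Rightarrow> 'o \<Rightarrow> 'a \<Rightarrow> 'b) \<Rightarrow> bool" where
  "is_functor C D Fo Fm \<longleftrightarrow>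
     (\<forall>X\<in>Obj C. Fo X \<in> Obj D) \<and>
     (\<forall>X\<in>Obj C. \<forall>Y\<in>Obj C. \<forall>f\<in>Hom C X Y. Fm X Y f \<in> Hom D (Fo X) (Fo Y)) \<and>
     (\<forall>X\<in>Obj C. Fm X X (Ident C X) = Ident D (Fo X)) \<and>
     (\<forall>X\<in>Obj C. \<forall>Y\<in>Obj C. \<forall>Z\<in>Obj C. \<forall>f\<in>Hom C X Y. \<forall>g\<in>Hom C Y Z.
        Fm X Z (Comp C X Y Z g f) = Comp D (Fo X) (Fo Y) (Fo Z) (Fm Y Z g) (Fm X Y f))"

definition fully_faithful_functor ::
    "('o, 'a) category \<Rightarrow> ('p, 'b) category \<Rightarrow> ('o \<Rightarrow> 'p) \<Rightarrow> ('o \<Rightarrow> 'o \<Rightarrow> 'a \<Rightarrow> 'b) \<Rightarrow> bool" where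
  "fully_faithful_functor C D Fo Fm \<longleftrightarrow> is_functor C D Fo Fm \<and>
     (\<forall>X\<in>Obj C. \<forall>Y\<in>Obj C. bij_betw (Fm X Y) (Hom C X Y) (Hom D (Fo X) (Fo Y)))"

definition torsionfree_category :: "('g, 'a) monoid_scheme \<Rightarrow> 'g set \<Rightarrow> (nat \<Rightarrow> 'g set)
    \<Rightarrow> ((('g, 'k::field) hecke, 'm) module, 'm \<Rightarrow> 'm) category" where
  "torsionfree_category G I K = \<lparr>
     Obj = {M. torsionfree G I K M},
     Hom = lmod_hom (hecke_algebra G I),
     Ident = (\<lambda>M. \<lambda>x\<in>carrier M. x),
     Comp = (\<lambda>M M' M'' g f. compose (carrier M) g f)\<rparr>"

definition Mod_I_category :: "('g, 'a) monoid_scheme \<Rightarrow> 'g topology \<Rightarrow> 'g set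
    \<Rightarrow> (('g, 'k::field, 'v) rep, 'v \<Rightarrow> 'v) category" where
  "Mod_I_category G \<T> I = \<lparr>
     Obj = {V. smooth_rep G \<T> V \<and> generated_by_invariants G I V},
     Hom = rep_hom G,
     Ident = (\<lambda>V. \<lambda>v\<in>carrier V. v),
     Comp = (\<lambda>V V' V'' g f. compose (carrier V) g f)\<rparr>"

end

theory Submission
  imports Defs
begin

text \<open>The map $M \to \mathfrak t(M)^I$, $m \mapsto \tau_M(\mathrm{char}_I \otimes m)$, is an isomorphism for
  torsionfree \<open>M\<close>. It is injective because (sur) provides $\lambda_0 \in \mathbf X^*$ with
  $\lambda_0(\mathrm{char}_I) = 1$. For surjectivity let $\varphi \in \mathfrak t(M)^I$. By smoothness of
  $\mathbf X$ the value $\varphi(\lambda)$ depends only on the restriction of $\lambda$ to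
  $\mathbf X^{K_m}$ for some \<open>m\<close>, so $\varphi$ induces a map $(\mathbf Z_m)_I \to M$, which vanishes on
  $Z_m$ as $\mathrm{Hom}_H(Z_m, M) = 0$. Hence $\varphi$ kills every $\lambda$ with
  $\lambda(\mathrm{char}_I) = 0$, in particular $\lambda - \lambda(\mathrm{char}_I)\lambda_0$, and
  therefore $\varphi = \tau_M(\mathrm{char}_I \otimes \varphi(\lambda_0))$. A homomorphism
  $\mathfrak t(M) \to \mathfrak t(M')$ thus restricts to a map $M \to M'$ on \<open>I\<close>-invariants; it is
  \<open>H\<close>-linear since $\mathrm{char}_I h$ is a linear combination of translates of $\mathrm{char}_I$, and
  it determines the homomorphism since these translates span $\mathbf X$.\<close>

text \<open>The level m has to depend on the vector: an element of t(M) is a finite sum of pure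
  tensors, and m must be deep enough for K_m to fix every first factor; this is why torsionfreeness
  is demanded at all levels. The obstacle is that a functional in the dual of X^(K_m) that vanishes
  on X^I need not vanish in the I-coinvariants. The classes of such functionals make up Z_m, and on
  them an invariant vector could take values that are not governed by \<open>char_I\<close>. For
  matrices it remains to supply subgroup I and levels K_m such that I normalises each K_m, every
  conjugate of a deep K_m lies in I, and a set stable under right multiplication by some K_m is
  open. The tensor product is left behind early: t(M) is described as the image of formal integer
  combinations of pairs, so that statements about it reduce to pure tensors, and these reduce to
  translates of \<open>char_I\<close> in the first factor.\<close>

no_notation Multiset.subset_mset (infix \<open><#\<close> 50)

section \<open>Modules over noncommutative rings\<close>

text \<open>Cancellation in \<open>B\<close> gives everything. The maps are bare functions because
  scalar multiplication, evaluation of functionals and elements of t(M) are all used in this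
  way.\<close>

lemma
  assumes "abelian_group A" "abelian_group B" and f: "\<And>x. x \<in> carrier A \<Longrightarrow> f x \<in> carrier B"
    and add: "\<And>x y. \<lbrakk>x \<in> carrier A; y \<in> carrier A\<rbrakk> \<Longrightarrow> f (x \<oplus>\<^bsub>A\<^esub> y) = f x \<oplus>\<^bsub>B\<^esub> f y"
  shows additive_map_zero: "f \<zero>\<^bsub>A\<^esub> = \<zero>\<^bsub>B\<^esub>"
    and additive_map_neg: "x \<in> carrier A \<Longrightarrow> f (\<ominus>\<^bsub>A\<^esub> x) = \<ominus>\<^bsub>B\<^esub> f x"
    and additive_map_diff: "\<lbrakk>x \<in> carrier A; y \<in> carrier A\<rbrakk> \<Longrightarrow> f (x \<ominus>\<^bsub>A\<^esub> y) = f x \<ominus>\<^bsub>B\<^esub> f y"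
proof -
  interpret A: abelian_group A by fact
  interpret B: abelian_group B by fact
  have "f \<zero>\<^bsub>A\<^esub> \<oplus>\<^bsub>B\<^esub> f \<zero>\<^bsub>A\<^esub> = f \<zero>\<^bsub>A\<^esub> \<oplus>\<^bsub>B\<^esub> \<zero>\<^bsub>B\<^esub>"
    using add[of "\<zero>\<^bsub>A\<^esub>" "\<zero>\<^bsub>A\<^esub>"] f by simp
  then show z: "f \<zero>\<^bsub>A\<^esub> = \<zero>\<^bsub>B\<^esub>"
    using f[of "\<zero>\<^bsub>A\<^esub>"] B.add.l_cancel by simp
  have neg: "f (\<ominus>\<^bsub>A\<^esub> x) = \<ominus>\<^bsub>B\<^esub> f x" if "x \<in> carrier A" for x
    using add[of "\<ominus>\<^bsub>A\<^esub> x" x] that z f B.minus_equality by (simp add: A.l_neg)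
  then show "x \<in> carrier A \<Longrightarrow> f (\<ominus>\<^bsub>A\<^esub> x) = \<ominus>\<^bsub>B\<^esub> f x" .
  show "\<lbrakk>x \<in> carrier A; y \<in> carrier A\<rbrakk> \<Longrightarrow> f (x \<ominus>\<^bsub>A\<^esub> y) = f x \<ominus>\<^bsub>B\<^esub> f y"
    using add[of x "\<ominus>\<^bsub>A\<^esub> y"] neg by (simp add: a_minus_def)
qed

lemma abelian_groupI_neg:
  assumes "\<zero>\<^bsub>A\<^esub> \<in> carrier A"
    and "\<And>x y. \<lbrakk>x \<in> carrier A; y \<in> carrier A\<rbrakk> \<Longrightarrow> x \<oplus>\<^bsub>A\<^esub> y \<in> carrier A"
    and "\<And>x y z. \<lbrakk>x \<in> carrier A; y \<in> carrier A; z \<in> carrier A\<rbrakk>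
      \<Longrightarrow> (x \<oplus>\<^bsub>A\<^esub> y) \<oplus>\<^bsub>A\<^esub> z = x \<oplus>\<^bsub>A\<^esub> (y \<oplus>\<^bsub>A\<^esub> z)"
    and "\<And>x y. \<lbrakk>x \<in> carrier A; y \<in> carrier A\<rbrakk> \<Longrightarrow> x \<oplus>\<^bsub>A\<^esub> y = y \<oplus>\<^bsub>A\<^esub> x"
    and "\<And>x. x \<in> carrier A \<Longrightarrow> \<zero>\<^bsub>A\<^esub> \<oplus>\<^bsub>A\<^esub> x = x"
    and "\<And>x. x \<in> carrier A \<Longrightarrow> n x \<in> carrier A"
    and "\<And>x. x \<in> carrier A \<Longrightarrow> n x \<oplus>\<^bsub>A\<^esub> x = \<zero>\<^bsub>A\<^esub>"
  shows "abelian_group A"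
proof (rule abelian_groupI)
  show "\<exists>y\<in>carrier A. y \<oplus>\<^bsub>A\<^esub> x = \<zero>\<^bsub>A\<^esub>" if "x \<in> carrier A" for x
    using assms(6,7)[OF that] by blast
qed (rule assms; assumption)+

text \<open>Extensionality reduces every axiom to the values in \<open>A\<close>. Three groups of
  functions arise this way: duals, the Hecke algebra inside the maps from \<open>X\<close> to
  \<open>X\<close>, and t(M) inside the maps from the dual of \<open>X\<close> to
  \<open>M\<close>.\<close>

lemma abelian_group_extensional:
  assumes "abelian_group A" and F: "carrier F \<subseteq> D \<rightarrow>\<^sub>E carrier A"
    and zero: "\<zero>\<^bsub>F\<^esub> = (\<lambda>x\<in>D. \<zero>\<^bsub>A\<^esub>)"
    and add: "\<And>f g. f \<oplus>\<^bsub>F\<^esub> g = (\<lambda>x\<in>D. f x \<oplus>\<^bsub>A\<^esub> g x)"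
    and "\<zero>\<^bsub>F\<^esub> \<in> carrier F"
    and "\<And>f g. \<lbrakk>f \<in> carrier F; g \<in> carrier F\<rbrakk> \<Longrightarrow> f \<oplus>\<^bsub>F\<^esub> g \<in> carrier F"
    and "\<And>f. f \<in> carrier F \<Longrightarrow> (\<lambda>x\<in>D. \<ominus>\<^bsub>A\<^esub> f x) \<in> carrier F"
  shows "abelian_group F"
proof -
  interpret A: abelian_group A by fact
  have F1: "f x \<in> carrier A" if "f \<in> carrier F" "x \<in> D" for f x using F that by blast
  have F2: "f = g" if "f \<in> D \<rightarrow>\<^sub>E carrier A" "g \<in> extensional D" "\<And>x. x \<in> D \<Longrightarrow> f x = g x" for f g
    using that by (auto simp: PiE_def intro: extensionalityI)
  show ?thesis
  proof (rule abelian_groupI_neg[where n = "\<lambda>f. \<lambda>x\<in>D. \<ominus>\<^bsub>A\<^esub> f x"])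
    show "\<zero>\<^bsub>F\<^esub> \<oplus>\<^bsub>F\<^esub> f = f" if "f \<in> carrier F" for f
      using F2[of f "\<zero>\<^bsub>F\<^esub> \<oplus>\<^bsub>F\<^esub> f"] that F by (auto simp: zero add F1)
  qed (use assms(5-7) in \<open>auto simp: zero add F1 A.a_ac A.l_neg A.r_neg cong: restrict_cong\<close>)
qed

context
  fixes R :: "('r, 'a) ring_scheme" and M :: "('r, 'm, 'b) module_scheme"
  assumes M: "left_module R M"
begin

lemma left_module_group: "abelian_group M"
  using M by (simp add: left_module_def)

lemma left_module_closed: "\<lbrakk>r \<in> carrier R; x \<in> carrier M\<rbrakk> \<Longrightarrow> r \<odot>\<^bsub>M\<^esub> x \<in> carrier M"
  using M by (simp add: left_module_def)

lemma left_module_r_distr: "\<lbrakk>r \<in> carrier R; x \<in> carrier M; y \<in> carrier M\<rbrakk>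
    \<Longrightarrow> r \<odot>\<^bsub>M\<^esub> (x \<oplus>\<^bsub>M\<^esub> y) = r \<odot>\<^bsub>M\<^esub> x \<oplus>\<^bsub>M\<^esub> r \<odot>\<^bsub>M\<^esub> y"
  using M by (simp add: left_module_def)

lemma left_module_l_distr: "\<lbrakk>r \<in> carrier R; s \<in> carrier R; x \<in> carrier M\<rbrakk>
    \<Longrightarrow> (r \<oplus>\<^bsub>R\<^esub> s) \<odot>\<^bsub>M\<^esub> x = r \<odot>\<^bsub>M\<^esub> x \<oplus>\<^bsub>M\<^esub> s \<odot>\<^bsub>M\<^esub> x"
  using M by (simp add: left_module_def)

lemma left_module_assoc: "\<lbrakk>r \<in> carrier R; s \<in> carrier R; x \<in> carrier M\<rbrakk>
    \<Longrightarrow> (r \<otimes>\<^bsub>R\<^esub> s) \<odot>\<^bsub>M\<^esub> x = r \<odot>\<^bsub>M\<^esub> (s \<odot>\<^bsub>M\<^esub> x)"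
  using M by (simp add: left_module_def)

lemma left_module_one: "x \<in> carrier M \<Longrightarrow> \<one>\<^bsub>R\<^esub> \<odot>\<^bsub>M\<^esub> x = x"
  using M by (simp add: left_module_def)

lemma left_module_r_zero: "r \<in> carrier R \<Longrightarrow> r \<odot>\<^bsub>M\<^esub> \<zero>\<^bsub>M\<^esub> = \<zero>\<^bsub>M\<^esub>"
  by (rule additive_map_zero[OF left_module_group left_module_group])
    (auto intro: left_module_closed left_module_r_distr)

lemma left_module_r_neg:
  "\<lbrakk>r \<in> carrier R; x \<in> carrier M\<rbrakk> \<Longrightarrow> r \<odot>\<^bsub>M\<^esub> (\<ominus>\<^bsub>M\<^esub> x) = \<ominus>\<^bsub>M\<^esub> (r \<odot>\<^bsub>M\<^esub> x)"
  by (rule additive_map_neg[OF left_module_group left_module_group])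
    (auto intro: left_module_closed left_module_r_distr)

lemma left_module_l_zero:
  assumes "abelian_group R" "x \<in> carrier M" shows "\<zero>\<^bsub>R\<^esub> \<odot>\<^bsub>M\<^esub> x = \<zero>\<^bsub>M\<^esub>"
  by (rule additive_map_zero[OF assms(1) left_module_group, of "\<lambda>r. r \<odot>\<^bsub>M\<^esub> x"])
    (auto intro: left_module_closed left_module_l_distr assms)

lemma left_module_l_neg:
  assumes "abelian_group R" "r \<in> carrier R" "x \<in> carrier M"
  shows "(\<ominus>\<^bsub>R\<^esub> r) \<odot>\<^bsub>M\<^esub> x = \<ominus>\<^bsub>M\<^esub> (r \<odot>\<^bsub>M\<^esub> x)"
  by (rule additive_map_neg[OF assms(1) left_module_group, of "\<lambda>r. r \<odot>\<^bsub>M\<^esub> x"])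
    (auto intro: left_module_closed left_module_l_distr assms)

text \<open>Negatives are multiples by -1, so closure under addition and scalars already yields a
  subgroup.\<close>

lemma left_module_restrict:
  assumes R: "ring R" and S: "S \<subseteq> carrier M" "\<zero>\<^bsub>M\<^esub> \<in> S"
    and add: "\<And>x y. \<lbrakk>x \<in> S; y \<in> S\<rbrakk> \<Longrightarrow> x \<oplus>\<^bsub>M\<^esub> y \<in> S"
    and smult: "\<And>r x. \<lbrakk>r \<in> carrier R; x \<in> S\<rbrakk> \<Longrightarrow> r \<odot>\<^bsub>M\<^esub> x \<in> S"
  shows "left_module R (M\<lparr>carrier := S\<rparr>)"
proof -
  interpret R: ring R by fact
  interpret M: abelian_group M by (rule left_module_group)
  have neg: "\<ominus>\<^bsub>M\<^esub> x \<in> S" if "x \<in> S" for x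
    using smult[of "\<ominus>\<^bsub>R\<^esub> \<one>\<^bsub>R\<^esub>" x] that S left_module_l_neg[of "\<one>\<^bsub>R\<^esub>" x] left_module_one[of x]
    by (auto simp: R.is_abelian_group)
  have "abelian_group (M\<lparr>carrier := S\<rparr>)"
    by (rule abelian_groupI_neg[where n = "\<lambda>x. \<ominus>\<^bsub>M\<^esub> x"])
      (use S add neg in \<open>auto simp: subset_iff M.a_ac M.r_neg\<close>)
  with S smult show ?thesis
    by (auto simp: left_module_def subset_iff left_module_r_distr left_module_l_distr
        left_module_assoc left_module_one)
qed

end

section \<open>Homomorphisms of left modules and duals of right modules\<close>

lemma lmod_homI:
  assumes "\<And>x. x \<in> carrier M \<Longrightarrow> f x \<in> carrier N" "\<And>x. x \<notin> carrier M \<Longrightarrow> f x = undefined"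
    and "\<And>x y. \<lbrakk>x \<in> carrier M; y \<in> carrier M\<rbrakk> \<Longrightarrow> f (x \<oplus>\<^bsub>M\<^esub> y) = f x \<oplus>\<^bsub>N\<^esub> f y"
    and "\<And>r x. \<lbrakk>r \<in> carrier R; x \<in> carrier M\<rbrakk> \<Longrightarrow> f (r \<odot>\<^bsub>M\<^esub> x) = r \<odot>\<^bsub>N\<^esub> f x"
  shows "f \<in> lmod_hom R M N"
  using assms by (auto simp: lmod_hom_def PiE_def extensional_def)

lemma lmod_hom_closed: "\<lbrakk>f \<in> lmod_hom R M N; x \<in> carrier M\<rbrakk> \<Longrightarrow> f x \<in> carrier N"
  and lmod_hom_extensional: "f \<in> lmod_hom R M N \<Longrightarrow> f \<in> extensional (carrier M)"
  and lmod_hom_add: "\<lbrakk>f \<in> lmod_hom R M N; x \<in> carrier M; y \<in> carrier M\<rbrakk>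
    \<Longrightarrow> f (x \<oplus>\<^bsub>M\<^esub> y) = f x \<oplus>\<^bsub>N\<^esub> f y"
  and lmod_hom_smult: "\<lbrakk>f \<in> lmod_hom R M N; r \<in> carrier R; x \<in> carrier M\<rbrakk>
    \<Longrightarrow> f (r \<odot>\<^bsub>M\<^esub> x) = r \<odot>\<^bsub>N\<^esub> f x"
  by (auto simp: lmod_hom_def PiE_def extensional_def)

lemma dual_closed: "\<lbrakk>l \<in> carrier (dual R Y); x \<in> carrier Y\<rbrakk> \<Longrightarrow> l x \<in> carrier R"
  and dual_extensional: "l \<in> carrier (dual R Y) \<Longrightarrow> l \<in> extensional (carrier Y)"
  and dual_add: "\<lbrakk>l \<in> carrier (dual R Y); x \<in> carrier Y; y \<in> carrier Y\<rbrakk>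
    \<Longrightarrow> l (x \<oplus>\<^bsub>Y\<^esub> y) = l x \<oplus>\<^bsub>R\<^esub> l y"
  and dual_smult: "\<lbrakk>l \<in> carrier (dual R Y); r \<in> carrier R; x \<in> carrier Y\<rbrakk>
    \<Longrightarrow> l (r \<odot>\<^bsub>Y\<^esub> x) = l x \<otimes>\<^bsub>R\<^esub> r"
  by (auto simp: dual_def PiE_def)

lemma dual_subset: "carrier (dual R Y) \<subseteq> carrier Y \<rightarrow>\<^sub>E carrier R"
  by (auto simp: dual_def)

lemma dualI:
  assumes "l \<in> extensional (carrier Y)" "\<And>x. x \<in> carrier Y \<Longrightarrow> l x \<in> carrier R"
    and "\<And>x y. \<lbrakk>x \<in> carrier Y; y \<in> carrier Y\<rbrakk> \<Longrightarrow> l (x \<oplus>\<^bsub>Y\<^esub> y) = l x \<oplus>\<^bsub>R\<^esub> l y"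
    and "\<And>r x. \<lbrakk>r \<in> carrier R; x \<in> carrier Y\<rbrakk> \<Longrightarrow> l (r \<odot>\<^bsub>Y\<^esub> x) = l x \<otimes>\<^bsub>R\<^esub> r"
  shows "l \<in> carrier (dual R Y)"
  using assms by (auto simp: dual_def PiE_def)

lemma dual_simps:
  "\<zero>\<^bsub>dual R Y\<^esub> = (\<lambda>x\<in>carrier Y. \<zero>\<^bsub>R\<^esub>)"
  "l \<oplus>\<^bsub>dual R Y\<^esub> l' = (\<lambda>x\<in>carrier Y. l x \<oplus>\<^bsub>R\<^esub> l' x)"
  "r \<odot>\<^bsub>dual R Y\<^esub> l = (\<lambda>x\<in>carrier Y. r \<otimes>\<^bsub>R\<^esub> l x)"
  by (simp_all add: dual_def)

text \<open>Scalars of \<open>Y\<close> act on the values of a functional from the right, while r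
  multiplies them from the left; by associativity of \<open>R\<close> the two do not interfere,
  although \<open>R\<close> is noncommutative.\<close>

lemma left_module_dual:
  assumes "ring R"
    and Y: "\<And>x y. \<lbrakk>x \<in> carrier Y; y \<in> carrier Y\<rbrakk> \<Longrightarrow> x \<oplus>\<^bsub>Y\<^esub> y \<in> carrier Y"
      "\<And>r x. \<lbrakk>r \<in> carrier R; x \<in> carrier Y\<rbrakk> \<Longrightarrow> r \<odot>\<^bsub>Y\<^esub> x \<in> carrier Y"
  shows "left_module R (dual R Y)"
proof -
  interpret R: ring R by fact
  note [simp] = dual_closed dual_add dual_smult dual_simps
  have add: "l \<oplus>\<^bsub>dual R Y\<^esub> l' \<in> carrier (dual R Y)"
    if "l \<in> carrier (dual R Y)" "l' \<in> carrier (dual R Y)" for l l'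
    by (rule dualI) (use that in \<open>auto simp: Y R.a_ac R.l_distr\<close>)
  have zero: "\<zero>\<^bsub>dual R Y\<^esub> \<in> carrier (dual R Y)"
    by (rule dualI) (auto simp: Y)
  have smult: "r \<odot>\<^bsub>dual R Y\<^esub> l \<in> carrier (dual R Y)"
    if "r \<in> carrier R" "l \<in> carrier (dual R Y)" for r l
    by (rule dualI) (use that in \<open>auto simp: Y R.r_distr R.m_assoc\<close>)
  have neg: "(\<lambda>x\<in>carrier Y. \<ominus>\<^bsub>R\<^esub> l x) \<in> carrier (dual R Y)" if "l \<in> carrier (dual R Y)" for l
    by (rule dualI) (use that in \<open>auto simp: Y R.minus_add R.l_minus R.a_comm\<close>)
  have "abelian_group (dual R Y)"
  proof (rule abelian_group_extensional[OF R.is_abelian_group, of _ "carrier Y"])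
  qed (use add zero neg in \<open>simp_all only: dual_simps(1,2) dual_subset\<close>)
  moreover have "\<one>\<^bsub>R\<^esub> \<odot>\<^bsub>dual R Y\<^esub> l = l" if "l \<in> carrier (dual R Y)" for l
    by (rule extensionalityI[of _ "carrier Y"]) (use that dual_extensional in auto)
  ultimately show ?thesis
    unfolding left_module_def using smult
    by (auto simp: R.r_distr R.l_distr R.m_assoc cong: restrict_cong)
qed

section \<open>The Hecke algebra of a group and a subgroup\<close>

lemma ind_space_iff:
  "x \<in> ind_space G I \<longleftrightarrow> finite {c. x c \<noteq> 0} \<and> (\<forall>c. x c \<noteq> 0 \<longrightarrow> c \<in> lcosets\<^bsub>G\<^esub> I)"
  by (auto simp: ind_space_def)

lemma ind_space_zero [simp]: "(\<lambda>c. 0) \<in> ind_space G I"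
  by (simp add: ind_space_iff)

lemma ind_space_add [simp]:
  assumes "x \<in> ind_space G I" "y \<in> ind_space G I" shows "(\<lambda>c. x c + y c) \<in> ind_space G I"
proof -
  have "{c. x c + y c \<noteq> 0} \<subseteq> {c. x c \<noteq> 0} \<union> {c. y c \<noteq> 0}" by auto
  with assms show ?thesis
    unfolding ind_space_iff by (metis (no_types, lifting) add_0 finite_Un finite_subset)
qed

lemma ind_space_scale [simp]:
  assumes "x \<in> ind_space G I" shows "(\<lambda>c. a * x c) \<in> ind_space G I"
proof -
  have "{c. a * x c \<noteq> 0} \<subseteq> {c. x c \<noteq> 0}" by auto
  with assms show ?thesis
    unfolding ind_space_iff by (metis (no_types, lifting) finite_subset mult_zero_right)
qed

lemma ind_space_uminus [simp]: "x \<in> ind_space G I \<Longrightarrow> (\<lambda>c. - x c) \<in> ind_space G I"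
  by (simp add: ind_space_iff)

lemma univ_module_simps [simp]:
  "carrier (univ_module G I) = ind_space G I"
  "\<zero>\<^bsub>univ_module G I\<^esub> = (\<lambda>c. 0)"
  "x \<oplus>\<^bsub>univ_module G I\<^esub> y = (\<lambda>c. x c + y c)"
  "h \<odot>\<^bsub>univ_module G I\<^esub> x = h x"
  by (simp_all add: univ_module_def)

lemma inv_module_simps [simp]:
  "carrier (inv_module G I U) = {x \<in> ind_space G I. \<forall>g\<in>U. translate G g x = x}"
  "x \<oplus>\<^bsub>inv_module G I U\<^esub> y = (\<lambda>c. x c + y c)"
  "h \<odot>\<^bsub>inv_module G I U\<^esub> x = h x"
  by (simp_all add: univ_module_def inv_module_def)

lemma univ_module_eq: "univ_module G I = inv_module G I {}"
  by (simp add: inv_module_def univ_module_def)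

lemma abelian_group_univ_module: "abelian_group (univ_module G I)"
  by (rule abelian_groupI_neg[where n = "\<lambda>x c. - x c"]) (auto simp: algebra_simps)

lemma translate_add: "translate G g (\<lambda>c. x c + y c) = (\<lambda>c. translate G g x c + translate G g y c)"
  and translate_scale: "translate G g (\<lambda>c. a * x c) = (\<lambda>c. a * translate G g x c)"
  and translate_uminus: "translate G g (\<lambda>c. - x c) = (\<lambda>c. - translate G g x c)"
  and translate_zero: "translate G g (\<lambda>c. 0) = (\<lambda>c. 0)"
  by (simp_all add: translate_def)

lemma hecke_simps:
  "h \<otimes>\<^bsub>hecke_algebra G I\<^esub> h' = compose (ind_space G I) h' h"
  "\<one>\<^bsub>hecke_algebra G I\<^esub> = (\<lambda>x\<in>ind_space G I. x)"
  "\<zero>\<^bsub>hecke_algebra G I\<^esub> = (\<lambda>x\<in>ind_space G I. \<lambda>c. 0)"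
  "h \<oplus>\<^bsub>hecke_algebra G I\<^esub> h' = (\<lambda>x\<in>ind_space G I. \<lambda>c. h x c + h' x c)"
  by (simp_all add: hecke_algebra_def)

definition char_I :: "'g set \<Rightarrow> ('g, 'k::field) ifun" where
  "char_I I = (\<lambda>c. if c = I then 1 else 0)"

text \<open>On elements outside the carrier the multiplication of a record is arbitrary; \<open>reflect\<close> rules out
  that translation moves subsets of the type that are not contained in the group into it.\<close>

locale hecke_pair = group G for G :: "('g, 'a) monoid_scheme" (structure) +
  fixes I :: "'g set"
  assumes subgroup_I: "subgroup I G"
    and reflect: "\<lbrakk>g \<in> carrier G; g \<otimes> x \<in> carrier G\<rbrakk> \<Longrightarrow> x \<in> carrier G"
begin

abbreviation X :: "('g, 'k::field) ifun set" where "X \<equiv> ind_space G I"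
abbreviation H :: "('g, 'k::field) hecke ring" where "H \<equiv> hecke_algebra G I"
abbreviation tr :: "'g \<Rightarrow> ('g, 'k::field) ifun \<Rightarrow> ('g, 'k) ifun" where "tr \<equiv> translate G"

lemma I_subset: "I \<subseteq> carrier G"
  by (rule subgroup.subset[OF subgroup_I])

lemma lcosets_iff: "c \<in> lcosets I \<longleftrightarrow> (\<exists>g\<in>carrier G. c = g <# I)"
  by (auto simp: LCOSETS_def)

lemma l_coset_subset_iff: "g \<in> carrier G \<Longrightarrow> g <# c \<subseteq> carrier G \<longleftrightarrow> c \<subseteq> carrier G"
  using reflect by (auto simp: l_coset_def)

lemma lcosets_subset: "c \<in> lcosets I \<Longrightarrow> c \<subseteq> carrier G"
  using I_subset by (auto simp: lcosets_iff l_coset_def)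

lemma l_coset_mem: "\<lbrakk>g \<in> carrier G; c \<in> lcosets I\<rbrakk> \<Longrightarrow> g <# c \<in> lcosets I"
  using I_subset lcos_m_assoc by (fastforce simp: lcosets_iff)

lemma l_coset_cancel:
  assumes "g \<in> carrier G" "c \<subseteq> carrier G"
  shows "g <# (inv g <# c) = c" "inv g <# (g <# c) = c"
  using assms by (simp_all add: lcos_m_assoc lcos_mult_one)

text \<open>\<open>translate\<close> evaluates at g^-1 c for every subset c of the type. If that set
  is a coset, \<open>reflect\<close> forces c into the group, where c = g (g^-1 c) shows that c is
  the translate of a coset from the support of x.\<close>

lemma translate_closed [simp]:
  assumes "g \<in> carrier G" "x \<in> X" shows "tr g x \<in> X"
proof -
  have *: "c \<in> (\<lambda>d. g <# d) ` {d. x d \<noteq> 0} \<and> c \<in> lcosets I" if "x (inv g <# c) \<noteq> 0" for c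
  proof -
    have "inv g <# c \<in> lcosets I" using that assms by (auto simp: ind_space_iff)
    then have "c = g <# (inv g <# c)"
      using l_coset_cancel assms lcosets_subset l_coset_subset_iff by (metis inv_closed)
    then show ?thesis using l_coset_mem[OF assms(1) \<open>inv g <# c \<in> lcosets I\<close>] that by auto
  qed
  then have "{c. x (inv g <# c) \<noteq> 0} \<subseteq> (\<lambda>d. g <# d) ` {d. x d \<noteq> 0}" by blast
  with * assms show ?thesis
    by (auto simp: ind_space_iff translate_def intro: finite_subset)
qed

text \<open>On subsets of the group this is associativity of cosets together with the formula for
  the inverse of a product. On all other subsets both sides are 0, since translates of such a set
  again stick out of the group.\<close>

lemma translate_mult:
  assumes "g \<in> carrier G" "h \<in> carrier G" "x \<in> X"
  shows "tr (g \<otimes> h) x = tr g (tr h x)"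
proof
  fix c
  have z: "x d = 0" if "\<not> d \<subseteq> carrier G" for d
    using that assms lcosets_subset by (auto simp: ind_space_iff)
  show "tr (g \<otimes> h) x c = tr g (tr h x) c"
  proof (cases "c \<subseteq> carrier G")
    case True
    then show ?thesis using assms by (simp add: translate_def lcos_m_assoc inv_mult_group)
  next
    case False
    then show ?thesis using assms by (simp add: translate_def z l_coset_subset_iff)
  qed
qed

lemma translate_one: assumes "x \<in> X" shows "tr \<one> x = x"
proof
  fix c
  have z: "x d = 0" if "\<not> d \<subseteq> carrier G" for d
    using that assms lcosets_subset by (auto simp: ind_space_iff)
  show "tr \<one> x c = x c"
    by (cases "c \<subseteq> carrier G") (simp_all add: translate_def lcos_mult_one z l_coset_subset_iff)
qed

lemma translate_char_I:
  assumes "g \<in> carrier G" shows "tr g (char_I I) = (\<lambda>c. if c = g <# I then 1 else 0)"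
proof -
  have "inv g <# c = I \<longleftrightarrow> c = g <# I" for c
    using l_coset_cancel[OF assms] l_coset_subset_iff[of "inv g" c] I_subset assms by auto
  then show ?thesis by (simp add: translate_def char_I_def)
qed

lemma char_I_mem [simp]: "char_I I \<in> X"
proof -
  have "I = \<one> <# I" by (simp add: lcos_mult_one[OF I_subset])
  then have "I \<in> lcosets I" unfolding lcosets_iff by (rule bexI) simp
  then show ?thesis by (auto simp: ind_space_iff char_I_def)
qed

lemma l_coset_I:
  assumes "g \<in> I" shows "g <# I = I"
proof
  interpret I: subgroup I G by (rule subgroup_I)
  show "g <# I \<subseteq> I" using assms by (auto simp: l_coset_def)
  show "I \<subseteq> g <# I"
  proof
    fix h assume "h \<in> I"
    then have "h = g \<otimes> (inv g \<otimes> h)" "inv g \<otimes> h \<in> I"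
      using assms by (simp_all flip: m_assoc)
    then show "h \<in> g <# I" by (auto simp: l_coset_def)
  qed
qed

lemma translate_I_char_I [simp]: "g \<in> I \<Longrightarrow> tr g (char_I I) = char_I I"
  using translate_char_I[of g] l_coset_I[of g] I_subset by (auto simp: char_I_def)

text \<open>Induction on the support: removing one coset g I from it subtracts a multiple of a
  translate of \<open>char_I\<close>. So these translates span \<open>X\<close>.\<close>

lemma ind_space_induct [consumes 1, case_names zero add basis]:
  fixes x :: "('g, 'k::field) ifun"
  assumes x: "x \<in> X" and zero: "P (\<lambda>c. 0)"
    and add: "\<And>x y. \<lbrakk>x \<in> X; y \<in> X; P x; P y\<rbrakk> \<Longrightarrow> P (\<lambda>c. x c + y c)"
    and basis: "\<And>a g. g \<in> carrier G \<Longrightarrow> P (\<lambda>c. a * tr g (char_I I) c)"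
  shows "P x"
proof -
  have "\<forall>x\<in>X. {c. x c \<noteq> 0} = S \<longrightarrow> P x" if "finite S" for S :: "'g set set"
    using that
  proof (induction S)
    case empty
    have "x = (\<lambda>c. 0)" if "{c. x c \<noteq> 0} = {}" for x :: "('g, 'k) ifun"
      using that by auto
    with zero show ?case by metis
  next
    case (insert d S)
    show ?case
    proof (intro ballI impI)
      fix x :: "('g, 'k) ifun" assume x: "x \<in> X" "{c. x c \<noteq> 0} = insert d S"
      then have "d \<in> lcosets I" by (auto simp: ind_space_iff)
      then obtain g where g: "g \<in> carrier G" "d = g <# I" by (auto simp: lcosets_iff)
      have "{c. (x(d := 0)) c \<noteq> 0} = S" using x insert.hyps by auto
      moreover from this have "x(d := 0) \<in> X"
        using x insert.hyps by (auto simp: ind_space_iff)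
      ultimately have "P (x(d := 0))" "x(d := 0) \<in> X" using insert.IH by auto
      moreover have "x = (\<lambda>c. (x(d := 0)) c + x d * tr g (char_I I) c)"
        using g by (auto simp: translate_char_I)
      ultimately show "P x"
        using add[of "x(d := 0)" "\<lambda>c. x d * tr g (char_I I) c"] basis[OF g(1)] g(1) by auto
    qed
  qed
  with x show ?thesis by (auto simp: ind_space_iff)
qed

section \<open>The ring structure of the Hecke algebra\<close>

lemma heckeI:
  assumes "h \<in> extensional X" "\<And>x. x \<in> X \<Longrightarrow> h x \<in> X"
    and "\<And>x y. \<lbrakk>x \<in> X; y \<in> X\<rbrakk> \<Longrightarrow> h (\<lambda>c. x c + y c) = (\<lambda>c. h x c + h y c)"
    and "\<And>a x. x \<in> X \<Longrightarrow> h (\<lambda>c. a * x c) = (\<lambda>c. a * h x c)"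
    and "\<And>g x. \<lbrakk>g \<in> carrier G; x \<in> X\<rbrakk> \<Longrightarrow> h (tr g x) = tr g (h x)"
  shows "h \<in> carrier H"
  using assms by (auto simp: hecke_algebra_def PiE_def)

lemma hecke_extensional: "h \<in> carrier H \<Longrightarrow> h \<in> extensional X"
  and hecke_closed [simp]: "\<lbrakk>h \<in> carrier H; x \<in> X\<rbrakk> \<Longrightarrow> h x \<in> X"
  and hecke_add: "\<lbrakk>h \<in> carrier H; x \<in> X; y \<in> X\<rbrakk> \<Longrightarrow> h (\<lambda>c. x c + y c) = (\<lambda>c. h x c + h y c)"
  and hecke_scale: "\<lbrakk>h \<in> carrier H; x \<in> X\<rbrakk> \<Longrightarrow> h (\<lambda>c. a * x c) = (\<lambda>c. a * h x c)"
  and hecke_translate: "\<lbrakk>h \<in> carrier H; g \<in> carrier G; x \<in> X\<rbrakk> \<Longrightarrow> h (tr g x) = tr g (h x)"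
  by (auto simp: hecke_algebra_def PiE_def)

lemma hecke_zero: assumes "h \<in> carrier H" shows "h (\<lambda>c. 0) = (\<lambda>c. 0)"
  using hecke_scale[OF assms ind_space_zero, of 0] by simp

text \<open>Linearity and equivariance carry agreement at \<open>char_I\<close> to its translates,
  which span \<open>X\<close>. Identities in \<open>H\<close> can thus be verified at a single
  vector.\<close>

lemma hecke_eqI:
  fixes h :: "('g, 'k::field) hecke"
  assumes h: "h \<in> carrier H" "h' \<in> carrier H" and eq: "h (char_I I) = h' (char_I I)"
  shows "h = h'"
proof (rule extensionalityI[of _ X])
  fix x :: "('g, 'k) ifun" assume "x \<in> X"
  then show "h x = h' x"
    by (induction rule: ind_space_induct) (use h eq in
      \<open>simp_all add: hecke_zero hecke_add hecke_scale hecke_translate\<close>)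
qed (use h hecke_extensional in auto)

lemma ring_hecke: "ring (H :: ('g, 'k::field) hecke ring)"
proof (rule ringI)
  have sub: "carrier (H :: ('g, 'k) hecke ring) \<subseteq> X \<rightarrow>\<^sub>E carrier (univ_module G I)"
    by (auto simp: hecke_algebra_def)
  show "abelian_group (H :: ('g, 'k) hecke ring)"
  proof (rule abelian_group_extensional[OF abelian_group_univ_module sub])
    show "f \<oplus>\<^bsub>H\<^esub> g \<in> carrier H" if fg: "f \<in> carrier H" "g \<in> carrier H" for f g :: "('g, 'k) hecke"
      unfolding hecke_simps
      by (rule heckeI) (simp_all add: hecke_add[OF fg(1)] hecke_add[OF fg(2)] hecke_scale[OF fg(1)]
          hecke_scale[OF fg(2)] hecke_translate[OF fg(1)] hecke_translate[OF fg(2)] fg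
          translate_add algebra_simps)
    show "\<zero>\<^bsub>H\<^esub> \<in> carrier (H :: ('g, 'k) hecke ring)"
      unfolding hecke_simps by (rule heckeI) (simp_all add: translate_zero)
    show "(\<lambda>x\<in>X. \<ominus>\<^bsub>univ_module G I\<^esub> f x) \<in> carrier H"
      if f: "f \<in> carrier H" for f :: "('g, 'k) hecke"
    proof -
      \<comment> \<open>The general construction forms negatives with the abstract inverse of
        \<open>univ_module\<close>, which has to be identified with the pointwise one before
        linearity can be read off.\<close>
      have "\<ominus>\<^bsub>univ_module G I\<^esub> x = (\<lambda>c. - x c)" if "x \<in> X" for x :: "('g, 'k) ifun"
      proof -
        interpret abelian_group "univ_module G I :: (('g, 'k) hecke, ('g, 'k) ifun) module"
          by (rule abelian_group_univ_module)
        show ?thesis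
          by (rule minus_equality) (use that in auto)
      qed
      then have "(\<lambda>x\<in>X. \<ominus>\<^bsub>univ_module G I\<^esub> f x) = (\<lambda>x\<in>X. \<lambda>c. - f x c)"
        using f by (auto cong: restrict_cong)
      moreover have "\<dots> \<in> carrier H"
        by (rule heckeI) (simp_all add: hecke_add[OF f] hecke_scale[OF f] hecke_translate[OF f] f
            translate_uminus)
      ultimately show ?thesis by simp
    qed
  qed (simp_all add: hecke_simps)
  show "monoid (H :: ('g, 'k) hecke ring)"
  proof (rule monoidI)
    fix h h' :: "('g, 'k) hecke" assume h: "h \<in> carrier H" "h' \<in> carrier H"
    show "h \<otimes>\<^bsub>H\<^esub> h' \<in> carrier H"
      unfolding hecke_simps
      by (rule heckeI) (simp_all add: compose_def h hecke_add[OF h(1)] hecke_add[OF h(2)]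
        hecke_scale[OF h(1)] hecke_scale[OF h(2)] hecke_translate[OF h(1)] hecke_translate[OF h(2)])
    show "h \<otimes>\<^bsub>H\<^esub> h' \<otimes>\<^bsub>H\<^esub> h'' = h \<otimes>\<^bsub>H\<^esub> (h' \<otimes>\<^bsub>H\<^esub> h'')" for h''
      using h by (simp add: hecke_simps compose_def cong: restrict_cong)
    show "\<one>\<^bsub>H\<^esub> \<otimes>\<^bsub>H\<^esub> h = h" "h \<otimes>\<^bsub>H\<^esub> \<one>\<^bsub>H\<^esub> = h"
      using h hecke_extensional[OF h(1)]
      by (simp_all add: hecke_simps compose_def extensional_restrict cong: restrict_cong)
  next
    show "\<one>\<^bsub>H\<^esub> \<in> carrier (H :: ('g, 'k) hecke ring)"
      unfolding hecke_simps by (rule heckeI) simp_all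
  qed
next
  fix f g h :: "('g, 'k) hecke" assume h: "f \<in> carrier H" "g \<in> carrier H" "h \<in> carrier H"
  \<comment> \<open>The product is that of the opposite ring: the right factor \<open>h\<close> is
    applied last, so this law is where additivity of \<open>h\<close> enters, while the next one is
    pointwise.\<close>
  show "(f \<oplus>\<^bsub>H\<^esub> g) \<otimes>\<^bsub>H\<^esub> h = f \<otimes>\<^bsub>H\<^esub> h \<oplus>\<^bsub>H\<^esub> g \<otimes>\<^bsub>H\<^esub> h"
    using h by (simp add: hecke_simps compose_def hecke_add[OF h(3)] cong: restrict_cong)
  show "h \<otimes>\<^bsub>H\<^esub> (f \<oplus>\<^bsub>H\<^esub> g) = h \<otimes>\<^bsub>H\<^esub> f \<oplus>\<^bsub>H\<^esub> h \<otimes>\<^bsub>H\<^esub> g"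
    using h by (simp add: hecke_simps compose_def cong: restrict_cong)
qed

end

section \<open>Duals of invariants\<close>

context hecke_pair begin

lemma hecke_scalar_apply: "x \<in> X \<Longrightarrow> hecke_scalar G I a x = (\<lambda>c. a * x c)"
  by (simp add: hecke_scalar_def)

lemma hecke_scalar_mem [simp]: "hecke_scalar G I a \<in> carrier H"
  unfolding hecke_scalar_def
  by (rule heckeI) (simp_all add: algebra_simps translate_scale)

text \<open>Centrality of the scalars is k-linearity of \<open>h\<close>.\<close>

lemma hecke_scalar_comm:
  assumes "h \<in> carrier H"
  shows "h \<otimes>\<^bsub>H\<^esub> hecke_scalar G I a = hecke_scalar G I a \<otimes>\<^bsub>H\<^esub> h"
  using assms by (simp add: hecke_simps compose_def hecke_scalar_apply hecke_scale[OF assms]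
      cong: restrict_cong)

lemma hecke_scalar_add:
  "hecke_scalar G I (a + b) = hecke_scalar G I a \<oplus>\<^bsub>H\<^esub> hecke_scalar G I b"
  by (simp add: hecke_simps hecke_scalar_def algebra_simps cong: restrict_cong)

lemma hecke_scalar_mult:
  "hecke_scalar G I (a * b) = hecke_scalar G I a \<otimes>\<^bsub>H\<^esub> hecke_scalar G I b"
  by (simp add: hecke_simps compose_def hecke_scalar_def algebra_simps cong: restrict_cong)

lemma hecke_scalar_one: "hecke_scalar G I 1 = \<one>\<^bsub>H\<^esub>"
  by (simp add: hecke_simps hecke_scalar_def)

abbreviation Y :: "'g set \<Rightarrow> ('g, 'k::field) ifun set" where
  "Y U \<equiv> {x \<in> X. \<forall>g\<in>U. tr g x = x}"

lemma Y_hecke: "\<lbrakk>U \<subseteq> carrier G; h \<in> carrier H; x \<in> Y U\<rbrakk> \<Longrightarrow> h x \<in> Y U"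
  by (auto simp: subset_iff simp flip: hecke_translate)

lemma dual_inv_iff:
  "l \<in> carrier (dual_inv G I U) \<longleftrightarrow> l \<in> extensional (Y U) \<and> (\<forall>x\<in>Y U. l x \<in> carrier H) \<and>
    (\<forall>x\<in>Y U. \<forall>y\<in>Y U. l (\<lambda>c. x c + y c) = l x \<oplus>\<^bsub>H\<^esub> l y) \<and>
    (\<forall>h\<in>carrier H. \<forall>x\<in>Y U. l (h x) = l x \<otimes>\<^bsub>H\<^esub> h)"
  unfolding dual_inv_def dual_def by (auto simp: PiE_def)

text \<open>Invariance under the empty set is no condition, so facts about the dual of X^U
  specialise to the dual of \<open>X\<close>.\<close>

lemma dual_X_eq: "dual_X G I = dual_inv G I {}"
  by (simp add: dual_X_def dual_inv_def univ_module_eq)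

lemma dual_inv_simps:
  "\<zero>\<^bsub>dual_inv G I U\<^esub> = (\<lambda>x\<in>Y U. \<zero>\<^bsub>H\<^esub>)"
  "l \<oplus>\<^bsub>dual_inv G I U\<^esub> l' = (\<lambda>x\<in>Y U. l x \<oplus>\<^bsub>H\<^esub> l' x)"
  "h \<odot>\<^bsub>dual_inv G I U\<^esub> l = (\<lambda>x\<in>Y U. h \<otimes>\<^bsub>H\<^esub> l x)"
  by (simp_all add: dual_inv_def dual_simps)

lemma left_module_dual_inv: "U \<subseteq> carrier G \<Longrightarrow> left_module H (dual_inv G I U)"
  unfolding dual_inv_def
  by (rule left_module_dual[OF ring_hecke])
    (auto simp: translate_add subset_iff simp flip: hecke_translate)

lemma dual_inv_closed: "\<lbrakk>l \<in> carrier (dual_inv G I U); x \<in> Y U\<rbrakk> \<Longrightarrow> l x \<in> carrier H"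
  and dual_inv_add: "\<lbrakk>l \<in> carrier (dual_inv G I U); x \<in> Y U; y \<in> Y U\<rbrakk>
    \<Longrightarrow> l (\<lambda>c. x c + y c) = l x \<oplus>\<^bsub>H\<^esub> l y"
  and dual_inv_smult: "\<lbrakk>l \<in> carrier (dual_inv G I U); h \<in> carrier H; x \<in> Y U\<rbrakk>
    \<Longrightarrow> l (h x) = l x \<otimes>\<^bsub>H\<^esub> h"
  and dual_inv_extensional: "l \<in> carrier (dual_inv G I U) \<Longrightarrow> l \<in> extensional (Y U)"
  unfolding dual_inv_iff by blast+

lemmas dual_X_closed = dual_inv_closed[of _ "{}", folded dual_X_eq, simplified]
  and dual_X_add = dual_inv_add[of _ "{}", folded dual_X_eq, simplified]
  and dual_X_smult = dual_inv_smult[of _ "{}", folded dual_X_eq, simplified]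
  and dual_X_extensional = dual_inv_extensional[of _ "{}", folded dual_X_eq, simplified]
  and dual_X_simps = dual_inv_simps[of "{}", folded dual_X_eq, simplified]
  and left_module_dual_X = left_module_dual_inv[of "{}", folded dual_X_eq, simplified]

lemma dual_X_scale:
  assumes "l \<in> carrier (dual_X G I)" "x \<in> X"
  shows "l (\<lambda>c. a * x c) = l x \<otimes>\<^bsub>H\<^esub> hecke_scalar G I a"
  using dual_X_smult[OF assms(1) hecke_scalar_mem assms(2), of a] assms
  by (simp add: hecke_scalar_apply)

lemma dual_X_zero: assumes l: "l \<in> carrier (dual_X G I)" shows "l (\<lambda>c. 0) = \<zero>\<^bsub>H\<^esub>"
  using additive_map_zero[OF abelian_group_univ_module[of G I] ring.is_abelian_group[OF ring_hecke],
      of l] dual_X_closed[OF l] dual_X_add[OF l] by simp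

text \<open>The actions of \<open>G\<close> and \<open>H\<close> on \<open>X\<close> commute, so
  precomposing with a translation keeps right H-linearity; \<open>stable\<close> keeps the
  translated argument inside the domain X^U.\<close>

lemma dual_act_closed:
  assumes l: "l \<in> carrier (dual_inv G I U)" and g: "g \<in> carrier G" and U: "U \<subseteq> carrier G"
    and stable: "\<And>x. x \<in> (Y U :: ('g, 'k::field) ifun set) \<Longrightarrow> tr g x \<in> Y U"
  shows "dual_act G (Y U) g (l :: ('g, 'k) ifun \<Rightarrow> ('g, 'k) hecke) \<in> carrier (dual_inv G I U)"
proof -
  have hY: "h x \<in> Y U" if "x \<in> Y U" "h \<in> carrier H" for h :: "('g, 'k) hecke" and x
    using Y_hecke[OF U] that by blast
  have aY: "(\<lambda>c. x c + y c) \<in> Y U" if "x \<in> Y U" "y \<in> Y U" for x y :: "('g, 'k) ifun"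
    using that by (auto simp: translate_add)
  have lh: "l (h x) = l x \<otimes>\<^bsub>H\<^esub> h" if "x \<in> Y U" "h \<in> carrier H" for h x
    using dual_inv_smult[OF l] that by blast
  have la: "l (\<lambda>c. x c + y c) = l x \<oplus>\<^bsub>H\<^esub> l y" if "x \<in> Y U" "y \<in> Y U" for x y
    using dual_inv_add[OF l] that by blast
  have lc: "l x \<in> carrier H" if "x \<in> Y U" for x
    using dual_inv_closed[OF l] that by blast
  have ht: "tr g (h x) = h (tr g x)" if "x \<in> Y U" "h \<in> carrier H" for h :: "('g, 'k) hecke" and x
    using hecke_translate[OF that(2) g] that(1) by simp
  define S where "S = (Y U :: ('g, 'k) ifun set)"
  show ?thesis
    using hY aY lh la lc ht stable
    unfolding dual_inv_iff dual_act_def S_def[symmetric] by (simp add: translate_add)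
qed

lemma dual_act_smult:
  assumes "\<And>x. x \<in> (Y U :: ('g, 'k::field) ifun set) \<Longrightarrow> tr g x \<in> Y U"
  shows "dual_act G (Y U) g (h \<odot>\<^bsub>dual_inv G I U\<^esub> l) =
    h \<odot>\<^bsub>dual_inv G I U\<^esub> dual_act G (Y U) g (l :: ('g, 'k) ifun \<Rightarrow> ('g, 'k) hecke)"
  using assms unfolding dual_inv_simps dual_act_def by (intro restrict_ext) simp

lemma dual_act_X_closed:
  "\<lbrakk>l \<in> carrier (dual_X G I); g \<in> carrier G\<rbrakk> \<Longrightarrow> dual_act G X g l \<in> carrier (dual_X G I)"
  using dual_act_closed[of l "{}" g] by (simp add: dual_X_eq)

lemma dual_act_X_apply: "x \<in> X \<Longrightarrow> dual_act G X g l x = l (tr g x)"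
  by (simp add: dual_act_def)

text \<open>The element of \<open>H\<close> that corresponds to \<open>x \<in> X\<^sup>I\<close> under $H = \mathbf X^I$; the choice of
  coset representatives does not matter since \<open>x\<close> is invariant under \<open>I\<close>.\<close>

definition hecke_of :: "('g, 'k::field) ifun \<Rightarrow> ('g, 'k) hecke" where
  "hecke_of x = (\<lambda>y\<in>X. \<lambda>c. \<Sum>d | y d \<noteq> 0. y d * tr (SOME g. g \<in> carrier G \<and> d = g <# I) x c)"

lemma hecke_of_add:
  assumes "y \<in> X" "z \<in> X"
  shows "hecke_of x (\<lambda>c. y c + z c) = (\<lambda>c. hecke_of x y c + hecke_of x z c)"
proof -
  let ?r = "\<lambda>d c. tr (SOME g. g \<in> carrier G \<and> d = g <# I) x c"
  let ?S = "{d. y d \<noteq> 0} \<union> {d. z d \<noteq> 0}"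
  have fin: "finite ?S" using assms by (auto simp: ind_space_iff)
  \<comment> \<open>The supports of y, z and y + z differ, in the last case also through
    cancellation; all three sums are extended by zero terms to the union of the first two
    supports.\<close>
  have *: "hecke_of x w c = (\<Sum>d\<in>?S. w d * ?r d c)" if "w \<in> X" "{d. w d \<noteq> 0} \<subseteq> ?S" for w c
    unfolding hecke_of_def using that by (auto intro!: sum.mono_neutral_left[OF fin])
  show ?thesis
  proof
    fix c
    have "{d. y d + z d \<noteq> 0} \<subseteq> ?S" by auto
    then show "hecke_of x (\<lambda>c. y c + z c) c = hecke_of x y c + hecke_of x z c"
      using assms by (simp add: * distrib_right sum.distrib)
  qed
qed

lemma hecke_of_scale:
  assumes "y \<in> X" shows "hecke_of x (\<lambda>c. a * y c) = (\<lambda>c. a * hecke_of x y c)"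
  using assms by (cases "a = 0") (simp_all add: hecke_of_def sum_distrib_left mult.assoc)

lemma hecke_of_basis:
  fixes x :: "('g, 'k::field) ifun"
  assumes x: "x \<in> X" "\<And>g. g \<in> I \<Longrightarrow> tr g x = x" and g: "g \<in> carrier G"
  shows "hecke_of x (tr g (char_I I)) = tr g x"
proof -
  define r where "r = (SOME h. h \<in> carrier G \<and> g <# I = h <# I)"
  have r: "r \<in> carrier G \<and> g <# I = r <# I"
    unfolding r_def by (rule someI[of _ g]) (use g in simp)
  then have "inv g \<otimes> r \<in> I"
    using subgroup.lcos_module_imp[OF subgroup_I is_group g] lcos_self[OF _ subgroup_I] by auto
  then have "tr g (tr (inv g \<otimes> r) x) = tr g x" using x by simp
  moreover have "tr g (tr (inv g \<otimes> r) x) = tr r x"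
    using translate_mult[of g "inv g \<otimes> r" x] g r x by (simp flip: m_assoc)
  moreover have in_X: "(\<lambda>c. if c = g <# I then 1 else 0) \<in> (X :: ('g, 'k) ifun set)"
    using translate_closed[OF g char_I_mem] by (simp add: translate_char_I[OF g])
  moreover have "{d. tr g (char_I I :: ('g, 'k) ifun) d \<noteq> 0} = {g <# I}"
    using g by (auto simp: translate_char_I)
  ultimately show ?thesis
    using g in_X
    by (simp add: hecke_of_def translate_char_I r_def[symmetric])
qed

text \<open>Frobenius reciprocity: an I-invariant vector determines an equivariant endomorphism of
  \<open>X\<close>. Closure and equivariance are checked on translates of \<open>char_I\<close>,
  where \<open>hecke_of_basis\<close> gives the value.\<close>

lemma hecke_of_mem:
  assumes x: "(x :: ('g, 'k::field) ifun) \<in> X" "\<And>g. g \<in> I \<Longrightarrow> tr g x = x"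
  shows "hecke_of x \<in> carrier H"
proof -
  have z: "hecke_of x (\<lambda>c. 0) = (\<lambda>c. 0)" by (simp add: hecke_of_def)
  have cl: "hecke_of x y \<in> X" if "y \<in> X" for y
    using that
  proof (induction rule: ind_space_induct)
    case (basis a g)
    then show ?case
      by (simp add: hecke_of_scale hecke_of_basis[OF x] x(1))
  qed (use z in \<open>simp_all add: hecke_of_add\<close>)
  have eq: "hecke_of x (tr g y) = tr g (hecke_of x y)" if "y \<in> X" "g \<in> carrier G" for y g
    using that
  proof (induction rule: ind_space_induct)
    case (basis a h)
    then show ?case
      by (simp add: hecke_of_scale translate_scale hecke_of_basis[OF x] x(1)
          flip: translate_mult)
  qed (use z cl in \<open>simp_all add: hecke_of_add translate_add translate_zero\<close>)
  show ?thesis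
    by (rule heckeI) (use cl eq in \<open>simp_all add: hecke_of_add hecke_of_scale\<close>, simp add: hecke_of_def)
qed

lemma hecke_of_char_I:
  assumes "x \<in> X" "\<And>g. g \<in> I \<Longrightarrow> tr g x = x"
  shows "hecke_of x (char_I I) = x"
  using hecke_of_basis[OF assms one_closed] assms(1) by (simp add: translate_one)

text \<open>The identification of X^I with \<open>H\<close> is itself a functional on X^I with value
  1 at \<open>char_I\<close>; (sur) extends it to all of \<open>X\<close>.\<close>

lemma dual_one_on_char_I:
  assumes "hyp_sur G I TYPE('k::field)"
  obtains l where "l \<in> carrier (dual_X G I)"
    "l (char_I I :: ('g, 'k) ifun) = \<one>\<^bsub>(H :: ('g, 'k) hecke ring)\<^esub>"
proof -
  let ?l = "(\<lambda>x\<in>Y I. hecke_of x) :: ('g, 'k) ifun \<Rightarrow> ('g, 'k) hecke"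
  interpret H: ring "H :: ('g, 'k) hecke ring" by (rule ring_hecke)
  have mem: "hecke_of x \<in> carrier H" and ch: "hecke_of x (char_I I) = x"
    if "x \<in> Y I" for x :: "('g, 'k) ifun"
    using hecke_of_mem hecke_of_char_I that by auto
  have "?l \<in> carrier (dual_inv G I I)"
    unfolding dual_inv_iff
  proof (intro conjI ballI)
    fix x y :: "('g, 'k) ifun" assume xy: "x \<in> Y I" "y \<in> Y I"
    then have a: "(\<lambda>c. x c + y c) \<in> Y I" by (auto simp: translate_add)
    \<comment> \<open>Both sides lie in \<open>H\<close>, so they are compared at
      \<open>char_I\<close>, where \<open>hecke_of x\<close> returns x.\<close>
    have "hecke_of (\<lambda>c. x c + y c) = hecke_of x \<oplus>\<^bsub>H\<^esub> hecke_of y"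
      by (rule hecke_eqI[OF mem[OF a] H.a_closed[OF mem[OF xy(1)] mem[OF xy(2)]]])
        (use xy ch a in \<open>simp add: hecke_simps\<close>)
    then show "?l (\<lambda>c. x c + y c) = ?l x \<oplus>\<^bsub>H\<^esub> ?l y" using a xy by simp
  next
    fix x :: "('g, 'k) ifun" and h :: "('g, 'k) hecke" assume xh: "x \<in> Y I" "h \<in> carrier H"
    then have a: "h x \<in> Y I" using Y_hecke[OF I_subset] by blast
    have "hecke_of (h x) = hecke_of x \<otimes>\<^bsub>H\<^esub> h"
      by (rule hecke_eqI[OF mem[OF a] H.m_closed[OF mem[OF xh(1)] xh(2)]])
        (use xh ch a in \<open>simp add: hecke_simps compose_def\<close>)
    then show "?l (h x) = ?l x \<otimes>\<^bsub>H\<^esub> h" using a xh by simp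
  qed (use mem in simp_all)
  then have "?l \<in> (\<lambda>l. restrict l (carrier (inv_module G I I))) ` carrier (dual_X G I)"
    using assms unfolding hyp_sur_def by simp
  then obtain l where l: "l \<in> carrier (dual_X G I)" "?l = restrict l (Y I)"
    by auto
  have ci: "char_I I \<in> (Y I :: ('g, 'k) ifun set)" by simp
  have "l (char_I I) = hecke_of (char_I I)" using fun_cong[OF l(2), of "char_I I"] ci by simp
  also have "\<dots> = \<one>\<^bsub>H\<^esub>"
    by (rule hecke_eqI[OF mem[OF ci] H.one_closed]) (use ch[OF ci] in \<open>simp add: hecke_simps(2)\<close>)
  finally show thesis using that l(1) by blast
qed

text \<open>Each invariant x is \<open>char_I\<close> times \<open>hecke_of x\<close>, so
  \<open>char_I\<close> generates X^I over \<open>H\<close>. In particular a functional vanishing at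
  \<open>char_I\<close> vanishes on X^I.\<close>

lemma dual_X_on_invariants:
  assumes l: "l \<in> carrier (dual_X G I)" and x: "x \<in> Y I"
  shows "l x = l (char_I I) \<otimes>\<^bsub>H\<^esub> hecke_of x"
  using dual_X_smult[OF l hecke_of_mem char_I_mem, of x] hecke_of_char_I[of x] x by simp

end

section \<open>The image of $\tau_M$\<close>

context abelian_group begin

lemma int_add_pow_closed: "a \<in> carrier G \<Longrightarrow> add_pow G (k :: int) a \<in> carrier G"
  unfolding add_pow_def using group.int_pow_closed[OF a_group] by simp

lemma int_add_pow_add:
  "a \<in> carrier G \<Longrightarrow> add_pow G (k + n :: int) a = add_pow G k a \<oplus> add_pow G n a"
  unfolding add_pow_def using group.int_pow_mult[OF a_group] by simp

lemma int_add_pow_zero: "add_pow G (0 :: int) a = \<zero>"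
  unfolding add_pow_def by simp

lemma int_add_pow_one: "a \<in> carrier G \<Longrightarrow> add_pow G (1 :: int) a = a"
  unfolding add_pow_def using group.int_pow_1[OF a_group] by simp

lemma add_diff_diff_cancel:
  assumes "a \<in> carrier G" "b \<in> carrier G" shows "(a \<oplus> b) \<ominus> a \<ominus> b = \<zero>"
  using assms r_neg[of "a \<oplus> b"] by (simp add: a_minus_def minus_add a_assoc)

lemma finsum_keys_superset:
  assumes f: "f \<in> S \<rightarrow> carrier G" and A: "finite A" "Poly_Mapping.keys z \<subseteq> A" "A \<subseteq> S"
  shows "(\<Oplus>p\<in>Poly_Mapping.keys z. add_pow G (Poly_Mapping.lookup z p :: int) (f p))
    = (\<Oplus>p\<in>A. add_pow G (Poly_Mapping.lookup z p) (f p))"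
proof (rule add.finprod_mono_neutral_cong_left[OF A(1,2)])
  show "add_pow G (Poly_Mapping.lookup z p) (f p) = \<zero>" if "p \<in> A - Poly_Mapping.keys z" for p
    using that by (simp add: in_keys_iff int_add_pow_zero)
qed (use f A in \<open>auto intro!: int_add_pow_closed\<close>)

text \<open>Coefficients may cancel, so the support of z + w can be smaller than the union of the
  supports; every sum is therefore rewritten over that union, where coefficients 0 contribute
  nothing.\<close>

lemma finsum_keys_add:
  assumes f: "f \<in> S \<rightarrow> carrier G"
    and z: "Poly_Mapping.keys z \<subseteq> S" and w: "Poly_Mapping.keys w \<subseteq> S"
  shows "(\<Oplus>p\<in>Poly_Mapping.keys (z + w). add_pow G (Poly_Mapping.lookup (z + w) p :: int) (f p))
    = (\<Oplus>p\<in>Poly_Mapping.keys z. add_pow G (Poly_Mapping.lookup z p) (f p)) \<oplus>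
      (\<Oplus>p\<in>Poly_Mapping.keys w. add_pow G (Poly_Mapping.lookup w p) (f p))"
proof -
  let ?A = "Poly_Mapping.keys z \<union> Poly_Mapping.keys w"
  have fA: "f p \<in> carrier G" if "p \<in> ?A" for p using that f z w by auto
  have "(\<Oplus>p\<in>?A. add_pow G (Poly_Mapping.lookup (z + w) p) (f p)) =
      (\<Oplus>p\<in>?A. add_pow G (Poly_Mapping.lookup z p) (f p) \<oplus> add_pow G (Poly_Mapping.lookup w p) (f p))"
    by (rule add.finprod_cong')
      (use fA in \<open>auto simp: lookup_add int_add_pow_add intro!: int_add_pow_closed\<close>)
  also have "\<dots> = (\<Oplus>p\<in>?A. add_pow G (Poly_Mapping.lookup z p) (f p)) \<oplus>
      (\<Oplus>p\<in>?A. add_pow G (Poly_Mapping.lookup w p) (f p))"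
    by (rule finsum_addf) (use fA in \<open>auto intro!: int_add_pow_closed\<close>)
  finally show ?thesis
    using finsum_keys_superset[OF f, of ?A z] finsum_keys_superset[OF f, of ?A w]
      finsum_keys_superset[OF f, of ?A "z + w"] keys_add[of z w] z w by simp
qed

end

section \<open>The map \<tau> and the elements of t(M)\<close>

context hecke_pair begin

text \<open>The image under \<tau> of the pure tensor of x and m, written without the tensor
  product.\<close>

definition tau_elt ::
    "(('g, 'k::field) hecke, 'm) module \<Rightarrow> ('g, 'k) ifun \<Rightarrow> 'm \<Rightarrow> (('g, 'k) ifun \<Rightarrow> ('g, 'k) hecke) \<Rightarrow> 'm"
  where "tau_elt M x m = (\<lambda>l\<in>carrier (dual_X G I). l x \<odot>\<^bsub>M\<^esub> m)"

lemma t_obj_simps: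
  "\<zero>\<^bsub>t_obj G I M\<^esub> = (\<lambda>l\<in>carrier (dual_X G I). \<zero>\<^bsub>M\<^esub>)"
  "\<phi> \<oplus>\<^bsub>t_obj G I M\<^esub> \<psi> = (\<lambda>l\<in>carrier (dual_X G I). \<phi> l \<oplus>\<^bsub>M\<^esub> \<psi> l)"
  "a \<odot>\<^bsub>t_obj G I M\<^esub> \<phi> = (\<lambda>l\<in>carrier (dual_X G I). hecke_scalar G I a \<odot>\<^bsub>M\<^esub> \<phi> l)"
  "gact (t_obj G I M) g \<phi> = (\<lambda>l\<in>carrier (dual_X G I). \<phi> (dual_act G X g l))"
  by (simp_all add: t_obj_def hom_rep_def)

context
  fixes M :: "(('g, 'k::field) hecke, 'm) module"
  assumes M: "left_module H M"
begin

interpretation M: abelian_group M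
  by (rule left_module_group[OF M])

interpretation H: ring "H :: ('g, 'k) hecke ring"
  by (rule ring_hecke)

lemma tau_lin_eq:
  "l \<in> carrier (dual_X G I) \<Longrightarrow> tau_lin G I M z l = (\<Oplus>\<^bsub>M\<^esub>p\<in>Poly_Mapping.keys z.
     [Poly_Mapping.lookup z p] \<cdot>\<^bsub>M\<^esub> (l (fst p) \<odot>\<^bsub>M\<^esub> snd p))"
  by (simp add: tau_lin_def)

lemma tau_closed:
  "\<lbrakk>l \<in> carrier (dual_X G I); x \<in> X; m \<in> carrier M\<rbrakk> \<Longrightarrow> l x \<odot>\<^bsub>M\<^esub> m \<in> carrier M"
  using left_module_closed[OF M dual_X_closed] by blast

lemma tau_lin_closed:
  assumes "Poly_Mapping.keys z \<subseteq> X \<times> carrier M" "l \<in> carrier (dual_X G I)"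
  shows "tau_lin G I M z l \<in> carrier M"
  unfolding tau_lin_eq[OF assms(2)]
  by (rule M.finsum_closed) (use assms tau_closed in \<open>auto intro!: M.int_add_pow_closed\<close>)

lemma tau_lin_add:
  assumes "Poly_Mapping.keys z \<subseteq> X \<times> carrier M" "Poly_Mapping.keys w \<subseteq> X \<times> carrier M"
    "l \<in> carrier (dual_X G I)"
  shows "tau_lin G I M (z + w) l = tau_lin G I M z l \<oplus>\<^bsub>M\<^esub> tau_lin G I M w l"
  unfolding tau_lin_eq[OF assms(3)]
  by (rule M.finsum_keys_add[OF _ assms(1,2)]) (use tau_closed assms(3) in auto)

lemma tau_lin_zero: "l \<in> carrier (dual_X G I) \<Longrightarrow> tau_lin G I M 0 l = \<zero>\<^bsub>M\<^esub>"
  by (simp add: tau_lin_eq)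

lemma tau_lin_frag_of:
  assumes "x \<in> X" "m \<in> carrier M" "l \<in> carrier (dual_X G I)"
  shows "tau_lin G I M (frag_of (x, m)) l = l x \<odot>\<^bsub>M\<^esub> m"
  using tau_closed[OF assms(3,1,2)] by (simp add: tau_lin_eq assms M.int_add_pow_one)

lemma tau_lin_uminus:
  assumes z: "Poly_Mapping.keys z \<subseteq> X \<times> carrier M" and l: "l \<in> carrier (dual_X G I)"
  shows "tau_lin G I M (- z) l = \<ominus>\<^bsub>M\<^esub> tau_lin G I M z l"
  using tau_lin_add[OF _ z l, of "- z"] z tau_lin_closed[OF _ l] M.minus_equality
  by (simp add: tau_lin_zero[OF l])

lemma tau_lin_diff:
  assumes z: "Poly_Mapping.keys z \<subseteq> X \<times> carrier M" and w: "Poly_Mapping.keys w \<subseteq> X \<times> carrier M"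
    and l: "l \<in> carrier (dual_X G I)"
  shows "tau_lin G I M (z - w) l = tau_lin G I M z l \<ominus>\<^bsub>M\<^esub> tau_lin G I M w l"
  using tau_lin_add[OF z _ l, of "- w"] tau_lin_uminus[OF w l] w by (simp add: a_minus_def)

lemma tau_lin_extensional: "tau_lin G I M z \<in> extensional (carrier (dual_X G I))"
  by (simp add: tau_lin_def)

lemma tau_lin_eqI:
  assumes "f \<in> extensional (carrier (dual_X G I))"
    and "\<And>l. l \<in> carrier (dual_X G I) \<Longrightarrow> tau_lin G I M z l = f l"
  shows "tau_lin G I M z = f"
  by (rule extensionalityI[OF tau_lin_extensional assms])

text \<open>This makes \<tau> well defined. For fixed l the formal combinations killed at l form a
  subgroup, so it is enough that it contains the three kinds of relations; the balanced ones use
  right H-linearity of l. The support condition travels along because additivity of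
  \<open>tau_lin\<close> depends on it.\<close>

lemma tau_lin_relations:
  assumes z: "z \<in> generate (free_Abelian_group (X \<times> carrier M)) (tensor_relations H (univ_module G I) M)"
    and l: "l \<in> carrier (dual_X G I)"
  shows "Poly_Mapping.keys z \<subseteq> X \<times> carrier M \<and> tau_lin G I M z l = \<zero>\<^bsub>M\<^esub>"
proof -
  let ?F = "free_Abelian_group (X \<times> carrier M)"
  let ?K = "{z \<in> carrier ?F. tau_lin G I M z l = \<zero>\<^bsub>M\<^esub>}"
  note lc = dual_X_closed[OF l] and cl = left_module_closed[OF M]
  interpret F: group ?F by simp
  have keys: "Poly_Mapping.keys (a - b) \<subseteq> S"
    if "Poly_Mapping.keys a \<subseteq> S" "Poly_Mapping.keys b \<subseteq> S" for a b :: "'x \<Rightarrow>\<^sub>0 int" and S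
    using keys_diff[of a b] that by blast
  have "subgroup ?K ?F"
  proof
    show "x \<otimes>\<^bsub>?F\<^esub> y \<in> ?K" if "x \<in> ?K" "y \<in> ?K" for x y
      using that keys_add[of x y] by (auto simp: tau_lin_add[OF _ _ l])
    show "inv\<^bsub>?F\<^esub> x \<in> ?K" if "x \<in> ?K" for x
      using that by (simp add: tau_lin_uminus[OF _ l])
  qed (auto simp: tau_lin_zero[OF l])
  moreover have "tensor_relations H (univ_module G I) M \<subseteq> ?K"
  proof -
    have "frag_of (\<lambda>c. x c + y c, m) - frag_of (x, m) - frag_of (y, m) \<in> ?K"
      if "x \<in> X" "y \<in> X" "m \<in> carrier M" for x y m
    proof -
      have "tau_lin G I M (frag_of (\<lambda>c. x c + y c, m) - frag_of (x, m) - frag_of (y, m)) l =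
        (l x \<oplus>\<^bsub>H\<^esub> l y) \<odot>\<^bsub>M\<^esub> m \<ominus>\<^bsub>M\<^esub> l x \<odot>\<^bsub>M\<^esub> m \<ominus>\<^bsub>M\<^esub> l y \<odot>\<^bsub>M\<^esub> m"
        using that by (simp add: tau_lin_diff[OF _ _ l] tau_lin_frag_of l dual_X_add[OF l] keys)
      also have "\<dots> = \<zero>\<^bsub>M\<^esub>"
        using that lc cl
        by (simp add: left_module_l_distr[OF M] M.add_diff_diff_cancel)
      finally show ?thesis using that by (simp add: keys)
    qed
    moreover have "frag_of (x, m \<oplus>\<^bsub>M\<^esub> n) - frag_of (x, m) - frag_of (x, n) \<in> ?K"
      if "x \<in> X" "m \<in> carrier M" "n \<in> carrier M" for x m n
    proof -
      have "tau_lin G I M (frag_of (x, m \<oplus>\<^bsub>M\<^esub> n) - frag_of (x, m) - frag_of (x, n)) l =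
        l x \<odot>\<^bsub>M\<^esub> (m \<oplus>\<^bsub>M\<^esub> n) \<ominus>\<^bsub>M\<^esub> l x \<odot>\<^bsub>M\<^esub> m \<ominus>\<^bsub>M\<^esub> l x \<odot>\<^bsub>M\<^esub> n"
        using that by (simp add: tau_lin_diff[OF _ _ l] tau_lin_frag_of l keys)
      also have "\<dots> = \<zero>\<^bsub>M\<^esub>"
        using that lc cl
        by (simp add: left_module_r_distr[OF M] M.add_diff_diff_cancel)
      finally show ?thesis using that by (simp add: keys)
    qed
    moreover have "frag_of (h x, m) - frag_of (x, h \<odot>\<^bsub>M\<^esub> m) \<in> ?K"
      if "h \<in> carrier H" "x \<in> X" "m \<in> carrier M" for h x m
      using that lc cl
      by (simp add: tau_lin_diff[OF _ _ l] tau_lin_frag_of l keys dual_X_smult[OF l]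
          left_module_assoc[OF M] a_minus_def M.r_neg)
    ultimately show ?thesis unfolding tensor_relations_def by fastforce
  qed
  ultimately have "generate ?F (tensor_relations H (univ_module G I) M) \<subseteq> ?K"
    by (intro F.generate_subgroup_incl)
  with z show ?thesis by auto
qed

text \<open>Adding relations changes nothing, so the image of a coset is a singleton and
  \<open>the_elem\<close> in \<open>tau\<close> returns its element.\<close>

lemma tau_coset:
  assumes z: "Poly_Mapping.keys z \<subseteq> X \<times> carrier M"
  shows "tau G I M (generate (free_Abelian_group (X \<times> carrier M))
      (tensor_relations H (univ_module G I) M) #>\<^bsub>free_Abelian_group (X \<times> carrier M)\<^esub> z)
    = tau_lin G I M z"
proof -
  let ?F = "free_Abelian_group (X \<times> carrier M)"
  let ?N = "generate ?F (tensor_relations H (univ_module G I) M)"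
  have "tau_lin G I M (n + z) = tau_lin G I M z" if "n \<in> ?N" for n
  proof (rule tau_lin_eqI[OF tau_lin_extensional])
    fix l :: "('g, 'k) ifun \<Rightarrow> ('g, 'k) hecke" assume l: "l \<in> carrier (dual_X G I)"
    show "tau_lin G I M (n + z) l = tau_lin G I M z l"
      using tau_lin_relations[OF that l] tau_lin_closed[OF z l] by (simp add: tau_lin_add z l)
  qed
  moreover have "0 \<in> ?N" using generate.one[of ?F] by simp
  ultimately have "tau_lin G I M ` (?N #>\<^bsub>?F\<^esub> z) = {tau_lin G I M z}"
    by (force simp: r_coset_def)
  then show ?thesis by (simp add: tau_def)
qed

text \<open>Cosets disappear here: from now on vectors of t(M) are handled through formal
  combinations of pairs instead of the quotient group.\<close>

lemma t_carrier:
  "carrier (t_obj G I M) = tau_lin G I M ` {z. Poly_Mapping.keys z \<subseteq> X \<times> carrier M}"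
proof -
  let ?F = "free_Abelian_group (X \<times> carrier M)"
  let ?N = "generate ?F (tensor_relations H (univ_module G I) M)"
  let ?Z = "{z. Poly_Mapping.keys z \<subseteq> X \<times> carrier M}"
  have "carrier (tensor H (univ_module G I) M) = (\<lambda>z. ?N #>\<^bsub>?F\<^esub> z) ` ?Z"
    by (auto simp: tensor_def FactGroup_def RCOSETS_def)
  then have "carrier (t_obj G I M) = (\<lambda>z. tau G I M (?N #>\<^bsub>?F\<^esub> z)) ` ?Z"
    by (simp add: t_obj_def image_image)
  also have "\<dots> = tau_lin G I M ` ?Z"
    by (rule image_cong) (simp_all add: tau_coset)
  finally show ?thesis .
qed

lemma t_zero: "\<zero>\<^bsub>t_obj G I M\<^esub> \<in> carrier (t_obj G I M)"
proof -
  have "tau_lin G I M 0 = \<zero>\<^bsub>t_obj G I M\<^esub>"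
    by (rule tau_lin_eqI) (simp_all add: t_obj_simps tau_lin_zero)
  then show ?thesis unfolding t_carrier by (intro image_eqI[where x = 0]) auto
qed

lemma tau_lin_plus:
  assumes "Poly_Mapping.keys z \<subseteq> X \<times> carrier M" "Poly_Mapping.keys w \<subseteq> X \<times> carrier M"
  shows "tau_lin G I M (z + w) = tau_lin G I M z \<oplus>\<^bsub>t_obj G I M\<^esub> tau_lin G I M w"
  by (rule tau_lin_eqI) (simp_all add: t_obj_simps tau_lin_add assms)

lemma t_add:
  assumes "\<phi> \<in> carrier (t_obj G I M)" "\<psi> \<in> carrier (t_obj G I M)"
  shows "\<phi> \<oplus>\<^bsub>t_obj G I M\<^esub> \<psi> \<in> carrier (t_obj G I M)"
proof -
  obtain z w where "\<phi> = tau_lin G I M z" "\<psi> = tau_lin G I M w"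
    "Poly_Mapping.keys z \<subseteq> X \<times> carrier M" "Poly_Mapping.keys w \<subseteq> X \<times> carrier M"
    using assms unfolding t_carrier by auto
  then show ?thesis
    unfolding t_carrier using keys_add[of z w]
    by (intro image_eqI[where x = "z + w"]) (auto simp: tau_lin_plus)
qed

lemma tau_elt_eq: "\<lbrakk>x \<in> X; m \<in> carrier M\<rbrakk> \<Longrightarrow> tau_lin G I M (frag_of (x, m)) = tau_elt M x m"
  by (rule tau_lin_eqI) (simp_all add: tau_elt_def tau_lin_frag_of)

lemma tau_elt_mem: "\<lbrakk>x \<in> X; m \<in> carrier M\<rbrakk> \<Longrightarrow> tau_elt M x m \<in> carrier (t_obj G I M)"
  unfolding t_carrier by (intro image_eqI[where x = "frag_of (x, m)"]) (auto simp: tau_elt_eq)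

lemma t_extensional: "\<phi> \<in> carrier (t_obj G I M) \<Longrightarrow> \<phi> \<in> extensional (carrier (dual_X G I))"
  and t_closed: "\<lbrakk>\<phi> \<in> carrier (t_obj G I M); l \<in> carrier (dual_X G I)\<rbrakk> \<Longrightarrow> \<phi> l \<in> carrier M"
  unfolding t_carrier using tau_lin_extensional tau_lin_closed by blast+

lemma t_eqI:
  assumes "\<phi> \<in> carrier (t_obj G I M)" "\<psi> \<in> extensional (carrier (dual_X G I))"
    "\<And>l. l \<in> carrier (dual_X G I) \<Longrightarrow> \<phi> l = \<psi> l"
  shows "\<phi> = \<psi>"
  by (rule extensionalityI[OF t_extensional[OF assms(1)] assms(2,3)])

lemma t_induct_tensor:
  assumes \<phi>: "\<phi> \<in> carrier (t_obj G I M)" and zero: "P \<zero>\<^bsub>t_obj G I M\<^esub>"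
    and add: "\<And>\<phi> \<psi>. \<lbrakk>\<phi> \<in> carrier (t_obj G I M); \<psi> \<in> carrier (t_obj G I M); P \<phi>; P \<psi>\<rbrakk>
      \<Longrightarrow> P (\<phi> \<oplus>\<^bsub>t_obj G I M\<^esub> \<psi>)"
    and elt: "\<And>x m. \<lbrakk>x \<in> X; m \<in> carrier M\<rbrakk> \<Longrightarrow> P (tau_elt M x m)"
  shows "P \<phi>"
proof -
  let ?Q = "\<lambda>z. Poly_Mapping.keys z \<subseteq> X \<times> carrier M \<and> P (tau_lin G I M z)"
  obtain z where z: "\<phi> = tau_lin G I M z" "Poly_Mapping.keys z \<subseteq> X \<times> carrier M"
    using \<phi> unfolding t_carrier by auto
  have plus: "?Q (a + b)" if "?Q a" "?Q b" for a b
    using that keys_add[of a b] add[of "tau_lin G I M a" "tau_lin G I M b"]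
    by (auto simp: tau_lin_plus t_carrier)
  have "tau_lin G I M 0 = \<zero>\<^bsub>t_obj G I M\<^esub>"
    by (rule tau_lin_eqI) (simp_all add: t_obj_simps tau_lin_zero)
  then have 0: "?Q 0" using zero by simp
  \<comment> \<open>Induction over a free abelian group builds differences. Carrying -z along turns
    a - b into a + (-b), and the negative of a pure tensor is again pure, formed with -m; so
    \<open>P\<close> is never asked to respect negation.\<close>
  have "?Q z \<and> ?Q (- z)"
    using z(2)
  proof (induction z rule: frag_induction)
    case zero
    then show ?case using 0 by simp
  next
    case (one p)
    obtain x m where p: "p = (x, m)" "x \<in> X" "m \<in> carrier M" using one by (cases p) auto
    have "tau_lin G I M (- frag_of p) = tau_elt M x (\<ominus>\<^bsub>M\<^esub> m)"
      by (rule tau_lin_eqI) (use p in \<open>auto simp: tau_elt_def tau_lin_uminus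
          tau_lin_frag_of left_module_r_neg[OF M dual_X_closed]\<close>)
    then show ?case using elt[of x m] elt[of x "\<ominus>\<^bsub>M\<^esub> m"] p by (simp add: tau_elt_eq)
  next
    case (diff a b)
    then show ?case using plus[of a "- b"] plus[of b "- a"] by simp
  qed
  then show ?thesis using z(1) by simp
qed

end
end

lemma left_module_add_closed:
  assumes "left_module R M" "x \<in> carrier M" "y \<in> carrier M" shows "x \<oplus>\<^bsub>M\<^esub> y \<in> carrier M"
  by (rule abelian_monoid.a_closed[OF abelian_group.axioms(1)[OF left_module_group[OF assms(1)]] assms(2,3)])

lemma left_module_zero_closed:
  assumes "left_module R M" shows "\<zero>\<^bsub>M\<^esub> \<in> carrier M"
  by (rule abelian_monoid.zero_closed[OF abelian_group.axioms(1)[OF left_module_group[OF assms]]])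

lemma type_ring_simps [simp]:
  "carrier type_ring = UNIV" "a \<otimes>\<^bsub>type_ring\<^esub> b = a * b" "\<one>\<^bsub>type_ring\<^esub> = 1"
  "\<zero>\<^bsub>type_ring\<^esub> = 0" "a \<oplus>\<^bsub>type_ring\<^esub> b = a + b"
  by (simp_all add: type_ring_def)

lemma cring_type_ring: "cring (type_ring :: 'k::field ring)"
proof (rule cringI)
  show "abelian_group (type_ring :: 'k ring)"
    by (rule abelian_groupI_neg[where n = uminus]) (simp_all add: algebra_simps)
  show "comm_monoid (type_ring :: 'k ring)"
    by (rule comm_monoidI) (simp_all add: algebra_simps)
qed (simp add: algebra_simps)

section \<open>The representation of the group on t(M)\<close>

context hecke_pair begin

context
  fixes M :: "(('g, 'k::field) hecke, 'm) module"
  assumes M: "left_module H M"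
begin

interpretation M: abelian_group M
  by (rule left_module_group[OF M])

lemma tau_elt_gact:
  assumes "x \<in> X" "g \<in> carrier G"
  shows "gact (t_obj G I M) g (tau_elt M x m) = tau_elt M (tr g x) m"
  unfolding t_obj_simps tau_elt_def
  by (rule restrict_ext) (simp add: dual_act_X_closed dual_act_X_apply assms)

text \<open>The scalar leaves l(a x) on the right of l(x), but acts on t(M) from the left of the
  values; the two agree because scalars are central in \<open>H\<close>.\<close>

lemma tau_elt_scale:
  assumes x: "x \<in> X" and m: "m \<in> carrier M"
  shows "a \<odot>\<^bsub>t_obj G I M\<^esub> tau_elt M x m = tau_elt M (\<lambda>c. a * x c) m"
  unfolding t_obj_simps tau_elt_def
proof (rule restrict_ext)
  fix l :: "('g, 'k) ifun \<Rightarrow> ('g, 'k) hecke" assume l: "l \<in> carrier (dual_X G I)"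
  note lx = dual_X_closed[OF l x]
  show "hecke_scalar G I a \<odot>\<^bsub>M\<^esub> (\<lambda>l\<in>carrier (dual_X G I). l x \<odot>\<^bsub>M\<^esub> m) l
      = l (\<lambda>c. a * x c) \<odot>\<^bsub>M\<^esub> m"
    using left_module_assoc[OF M hecke_scalar_mem lx m] l
    by (simp add: dual_X_scale[OF l x] hecke_scalar_comm[OF lx])
qed

lemma tau_elt_add:
  assumes x: "x \<in> X" "y \<in> X" and m: "m \<in> carrier M"
  shows "tau_elt M (\<lambda>c. x c + y c) m = tau_elt M x m \<oplus>\<^bsub>t_obj G I M\<^esub> tau_elt M y m"
  unfolding t_obj_simps tau_elt_def
  by (rule restrict_ext)
    (simp add: dual_X_add x left_module_l_distr[OF M dual_X_closed dual_X_closed] m)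

lemma tau_elt_zero:
  assumes m: "m \<in> carrier M" shows "tau_elt M (\<lambda>c. 0) m = \<zero>\<^bsub>t_obj G I M\<^esub>"
  unfolding t_obj_simps tau_elt_def
  by (rule restrict_ext)
    (simp add: dual_X_zero left_module_l_zero[OF M ring.is_abelian_group[OF ring_hecke]] m)

lemma tau_elt_r_add:
  assumes x: "x \<in> X" and m: "m \<in> carrier M" "n \<in> carrier M"
  shows "tau_elt M x (m \<oplus>\<^bsub>M\<^esub> n) = tau_elt M x m \<oplus>\<^bsub>t_obj G I M\<^esub> tau_elt M x n"
  unfolding t_obj_simps tau_elt_def
  by (rule restrict_ext) (simp add: x left_module_r_distr[OF M dual_X_closed] m)

lemma tau_elt_hecke:
  assumes x: "x \<in> X" and h: "h \<in> carrier H" and m: "m \<in> carrier M"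
  shows "tau_elt M x (h \<odot>\<^bsub>M\<^esub> m) = tau_elt M (h x) m"
  unfolding tau_elt_def
  by (rule restrict_ext) (simp add: dual_X_smult x h left_module_assoc[OF M dual_X_closed] m)

lemma t_smult_distr:
  assumes "\<phi> \<in> carrier (t_obj G I M)" "\<psi> \<in> carrier (t_obj G I M)"
  shows "a \<odot>\<^bsub>t_obj G I M\<^esub> (\<phi> \<oplus>\<^bsub>t_obj G I M\<^esub> \<psi>) =
    a \<odot>\<^bsub>t_obj G I M\<^esub> \<phi> \<oplus>\<^bsub>t_obj G I M\<^esub> a \<odot>\<^bsub>t_obj G I M\<^esub> \<psi>"
  unfolding t_obj_simps
  by (rule restrict_ext)
    (simp add: left_module_r_distr[OF M hecke_scalar_mem] t_closed[OF M] assms)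

lemma t_smult_zero: "a \<odot>\<^bsub>t_obj G I M\<^esub> \<zero>\<^bsub>t_obj G I M\<^esub> = \<zero>\<^bsub>t_obj G I M\<^esub>"
  unfolding t_obj_simps by (rule restrict_ext) (simp add: left_module_r_zero[OF M hecke_scalar_mem])

lemma t_smult:
  "\<phi> \<in> carrier (t_obj G I M) \<Longrightarrow> a \<odot>\<^bsub>t_obj G I M\<^esub> \<phi> \<in> carrier (t_obj G I M)"
  by (induction rule: t_induct_tensor[OF M, consumes 1, case_names zero add elt])
    (simp_all add: t_smult_zero t_smult_distr t_zero[OF M] t_add[OF M] tau_elt_scale tau_elt_mem[OF M])

lemma t_gact_add:
  assumes "g \<in> carrier G"
  shows "gact (t_obj G I M) g (\<phi> \<oplus>\<^bsub>t_obj G I M\<^esub> \<psi>) =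
    gact (t_obj G I M) g \<phi> \<oplus>\<^bsub>t_obj G I M\<^esub> gact (t_obj G I M) g \<psi>"
  unfolding t_obj_simps by (rule restrict_ext) (simp add: dual_act_X_closed assms)

lemma t_gact_smult:
  assumes "g \<in> carrier G"
  shows "gact (t_obj G I M) g (a \<odot>\<^bsub>t_obj G I M\<^esub> \<phi>) = a \<odot>\<^bsub>t_obj G I M\<^esub> gact (t_obj G I M) g \<phi>"
  unfolding t_obj_simps by (rule restrict_ext) (simp add: dual_act_X_closed assms)

lemma t_gact_zero:
  assumes "g \<in> carrier G"
  shows "gact (t_obj G I M) g \<zero>\<^bsub>t_obj G I M\<^esub> = \<zero>\<^bsub>t_obj G I M\<^esub>"
  unfolding t_obj_simps by (rule restrict_ext) (simp add: dual_act_X_closed assms)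

lemma t_gact:
  assumes g: "g \<in> carrier G"
  shows "\<phi> \<in> carrier (t_obj G I M) \<Longrightarrow> gact (t_obj G I M) g \<phi> \<in> carrier (t_obj G I M)"
  by (induction rule: t_induct_tensor[OF M, consumes 1, case_names zero add elt])
    (simp_all add: t_gact_zero t_gact_add t_zero[OF M] t_add[OF M] tau_elt_gact tau_elt_mem[OF M] g)

lemma t_gact_mult:
  assumes "g \<in> carrier G" "h \<in> carrier G"
  shows "gact (t_obj G I M) (g \<otimes> h) \<phi> = gact (t_obj G I M) g (gact (t_obj G I M) h \<phi>)"
  unfolding t_obj_simps
proof (rule restrict_ext)
  fix l :: "('g, 'k) ifun \<Rightarrow> ('g, 'k) hecke" assume l: "l \<in> carrier (dual_X G I)"
  \<comment> \<open>Translation of functionals is a right action, so the product acts as g followed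
    by h; precomposition of \<phi> turns this into a left action on t(M).\<close>
  have "dual_act G X (g \<otimes> h) l = dual_act G X h (dual_act G X g l)"
    unfolding dual_act_def by (rule restrict_ext) (simp add: assms translate_mult)
  then show "\<phi> (dual_act G X (g \<otimes> h) l) =
      (\<lambda>l\<in>carrier (dual_X G I). \<phi> (dual_act G X h l)) (dual_act G X g l)"
    by (simp add: dual_act_X_closed l assms)
qed

lemma t_gact_one:
  assumes "\<phi> \<in> carrier (t_obj G I M)" shows "gact (t_obj G I M) \<one> \<phi> = \<phi>"
proof (rule t_eqI[OF M assms, symmetric])
  fix l :: "('g, 'k) ifun \<Rightarrow> ('g, 'k) hecke" assume l: "l \<in> carrier (dual_X G I)"
  have "dual_act G X \<one> l = l"
    by (rule extensionalityI[OF _ dual_X_extensional[OF l]])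
      (simp_all add: dual_act_def translate_one)
  then show "\<phi> l = gact (t_obj G I M) \<one> \<phi> l" by (simp add: t_obj_simps l)
qed (simp add: t_obj_simps)

text \<open>Two inductions in a row: over pure tensors, then over the first factor, which is spanned
  by translates of \<open>char_I\<close>. Thus the vectors \<tau>(char_I \<otimes> m) generate t(M)
  as a representation.\<close>

lemma t_induct [consumes 1, case_names zero add basis]:
  assumes \<phi>: "\<phi> \<in> carrier (t_obj G I M)" and zero: "P \<zero>\<^bsub>t_obj G I M\<^esub>"
    and add: "\<And>\<phi> \<psi>. \<lbrakk>\<phi> \<in> carrier (t_obj G I M); \<psi> \<in> carrier (t_obj G I M); P \<phi>; P \<psi>\<rbrakk>
      \<Longrightarrow> P (\<phi> \<oplus>\<^bsub>t_obj G I M\<^esub> \<psi>)"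
    and basis: "\<And>a g m. \<lbrakk>g \<in> carrier G; m \<in> carrier M\<rbrakk>
      \<Longrightarrow> P (a \<odot>\<^bsub>t_obj G I M\<^esub> gact (t_obj G I M) g (tau_elt M (char_I I) m))"
  shows "P \<phi>"
  using \<phi>
proof (induction rule: t_induct_tensor[OF M, consumes 1, case_names zero add elt])
  case (elt x m)
  from this(1) show ?case
  proof (induction rule: ind_space_induct)
    case zero
    then show ?case using assms(2) elt by (simp add: tau_elt_zero)
  next
    case (add x y)
    then show ?case using assms(3) elt by (simp add: tau_elt_add tau_elt_mem[OF M])
  next
    case (basis a g)
    then show ?case using assms(4)[of g m a] elt by (simp add: tau_elt_gact tau_elt_scale)
  qed
qed (use zero add in auto)

text \<open>The carrier of \<open>t_obj\<close> is an image under \<open>tau\<close>, so its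
  inclusion in the H-linear maps must be proved. For a pure tensor it holds because the operations
  of the dual are taken on values.\<close>

lemma t_hom: "\<phi> \<in> carrier (t_obj G I M) \<Longrightarrow> \<phi> \<in> lmod_hom H (dual_X G I) M"
proof (induction rule: t_induct_tensor[OF M, consumes 1, case_names zero add elt])
  case zero
  show ?case
    by (rule lmod_homI) (simp_all add: t_obj_simps left_module_r_zero[OF M]
        left_module_closed[OF left_module_dual_X] left_module_add_closed[OF left_module_dual_X])
next
  case (add \<phi> \<psi>)
  note cl = lmod_hom_closed[OF add(3)] lmod_hom_closed[OF add(4)]
  show ?case
    by (rule lmod_homI) (simp_all add: t_obj_simps cl lmod_hom_add[OF add(3)] lmod_hom_add[OF add(4)]
        lmod_hom_smult[OF add(3)] lmod_hom_smult[OF add(4)] left_module_r_distr[OF M] M.a_ac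
        left_module_closed[OF left_module_dual_X] left_module_add_closed[OF left_module_dual_X])
next
  case (elt x m)
  have ev: "(l \<oplus>\<^bsub>dual_X G I\<^esub> l') x = l x \<oplus>\<^bsub>H\<^esub> l' x" "(h \<odot>\<^bsub>dual_X G I\<^esub> l) x = h \<otimes>\<^bsub>H\<^esub> l x"
    for l l' :: "('g, 'k) ifun \<Rightarrow> ('g, 'k) hecke" and h
    using elt by (simp_all add: dual_X_simps)
  show ?case
    using elt
    by (intro lmod_homI) (simp_all add: tau_elt_def left_module_closed[OF M dual_X_closed]
        left_module_closed[OF left_module_dual_X] left_module_add_closed[OF left_module_dual_X]
        ev left_module_l_distr[OF M dual_X_closed dual_X_closed]
        left_module_assoc[OF M _ dual_X_closed])
qed

lemma t_module: "left_module type_ring (t_obj G I M)"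
proof -
  have neg: "(\<lambda>l\<in>carrier (dual_X G I). \<ominus>\<^bsub>M\<^esub> \<phi> l) \<in> carrier (t_obj G I M)"
    if "\<phi> \<in> carrier (t_obj G I M)" for \<phi>
  proof -
    \<comment> \<open>The negative of a vector is its multiple by -1, so stability under negation
      reduces to stability under scalars.\<close>
    have "hecke_scalar G I (- 1 :: 'k) = \<ominus>\<^bsub>H\<^esub> \<one>\<^bsub>H\<^esub>"
    proof -
      interpret H: ring "H :: ('g, 'k) hecke ring" by (rule ring_hecke)
      have "hecke_scalar G I (- 1) \<oplus>\<^bsub>H\<^esub> \<one>\<^bsub>H\<^esub> = (\<zero>\<^bsub>H\<^esub> :: ('g, 'k) hecke)"
        using hecke_scalar_add[of "- 1 :: 'k" 1]
        by (simp add: hecke_scalar_one) (simp add: hecke_scalar_def hecke_simps(3))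
      then show ?thesis by (intro H.minus_equality[symmetric]) simp_all
    qed
    moreover have "(\<ominus>\<^bsub>H\<^esub> \<one>\<^bsub>H\<^esub>) \<odot>\<^bsub>M\<^esub> m = \<ominus>\<^bsub>M\<^esub> m" if "m \<in> carrier M" for m
      using left_module_l_neg[OF M ring.is_abelian_group[OF ring_hecke]
          monoid.one_closed[OF ring.is_monoid[OF ring_hecke]] that]
      by (simp add: left_module_one[OF M that])
    ultimately have "(\<lambda>l\<in>carrier (dual_X G I). \<ominus>\<^bsub>M\<^esub> \<phi> l) = (- 1) \<odot>\<^bsub>t_obj G I M\<^esub> \<phi>"
      using that by (simp add: t_obj_simps t_closed[OF M] cong: restrict_cong)
    then show ?thesis using t_smult[OF that] by simp
  qed
  have "abelian_group (t_obj G I M)"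
  proof (rule abelian_group_extensional[OF M.abelian_group_axioms, of _ "carrier (dual_X G I)"])
    show "carrier (t_obj G I M) \<subseteq> carrier (dual_X G I) \<rightarrow>\<^sub>E carrier M"
      using t_closed[OF M] t_extensional[OF M] by (auto simp: PiE_def)
  qed (simp_all add: t_obj_simps(1,2) neg t_zero[OF M, unfolded t_obj_simps] t_add[OF M, unfolded t_obj_simps])
  moreover have "(a + b) \<odot>\<^bsub>t_obj G I M\<^esub> \<phi> = a \<odot>\<^bsub>t_obj G I M\<^esub> \<phi> \<oplus>\<^bsub>t_obj G I M\<^esub> b \<odot>\<^bsub>t_obj G I M\<^esub> \<phi>"
    if "\<phi> \<in> carrier (t_obj G I M)" for a b \<phi>
    unfolding t_obj_simps using that
    by (intro restrict_ext) (simp add: hecke_scalar_add left_module_l_distr[OF M] t_closed[OF M])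
  moreover have "(a * b) \<odot>\<^bsub>t_obj G I M\<^esub> \<phi> = a \<odot>\<^bsub>t_obj G I M\<^esub> (b \<odot>\<^bsub>t_obj G I M\<^esub> \<phi>)"
    if "\<phi> \<in> carrier (t_obj G I M)" for a b \<phi>
    unfolding t_obj_simps using that
    by (intro restrict_ext) (simp add: hecke_scalar_mult left_module_assoc[OF M] t_closed[OF M])
  moreover have "1 \<odot>\<^bsub>t_obj G I M\<^esub> \<phi> = \<phi>" if "\<phi> \<in> carrier (t_obj G I M)" for \<phi>
    using that
    by (intro t_eqI[OF M that, symmetric])
      (simp_all add: t_obj_simps hecke_scalar_one left_module_one[OF M] t_closed[OF M])
  ultimately show ?thesis
    by (simp add: left_module_def t_smult t_smult_distr)
qed

lemma tau_elt_inj: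
  assumes "hyp_sur G I TYPE('k)" "m \<in> carrier M" "n \<in> carrier M"
    and eq: "tau_elt M (char_I I) m = tau_elt M (char_I I) n"
  shows "m = n"
proof -
  obtain l where l: "l \<in> carrier (dual_X G I)" "l (char_I I) = \<one>\<^bsub>(H :: ('g, 'k) hecke ring)\<^esub>"
    using dual_one_on_char_I[OF assms(1)] by blast
  show ?thesis
    using fun_cong[OF eq, of l] l assms(2,3) by (simp add: tau_elt_def left_module_one[OF M])
qed

end
end

section \<open>Coinvariants and the modules $Z_m$\<close>

text \<open>The zeros of f form a subgroup, and invariance puts every generator a g x - x into it.
  This is applied to evaluation at an I-invariant function and to invariant maps into
  \<open>M\<close>.\<close>

lemma coinv_sub_kernel:
  assumes A: "abelian_group A" and N: "abelian_group N"
    and act: "\<And>g x. \<lbrakk>g \<in> U; x \<in> carrier A\<rbrakk> \<Longrightarrow> a g x \<in> carrier A"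
    and f: "\<And>x. x \<in> carrier A \<Longrightarrow> f x \<in> carrier N"
      "\<And>x y. \<lbrakk>x \<in> carrier A; y \<in> carrier A\<rbrakk> \<Longrightarrow> f (x \<oplus>\<^bsub>A\<^esub> y) = f x \<oplus>\<^bsub>N\<^esub> f y"
      "\<And>g x. \<lbrakk>g \<in> U; x \<in> carrier A\<rbrakk> \<Longrightarrow> f (a g x) = f x"
    and c: "c \<in> coinv_sub U a A"
  shows "f c = \<zero>\<^bsub>N\<^esub>"
proof -
  interpret A: abelian_group A by fact
  interpret N: abelian_group N by fact
  let ?K = "{x \<in> carrier A. f x = \<zero>\<^bsub>N\<^esub>}"
  have "subgroup ?K (add_monoid A)"
  proof (rule group.subgroupI[OF A.a_group])
    show "?K \<noteq> {}" using additive_map_zero[OF A N f(1,2)] by blast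
    show "inv\<^bsub>add_monoid A\<^esub> x \<in> ?K" if "x \<in> ?K" for x
      using that additive_map_neg[OF A N f(1,2), of x] by (simp flip: a_inv_def)
  qed (auto simp: f(2))
  moreover have "{a g x \<ominus>\<^bsub>A\<^esub> x | g x. g \<in> U \<and> x \<in> carrier A} \<subseteq> ?K"
    using act f additive_map_diff[OF A N f(1,2)] by (auto simp: a_minus_def N.r_neg)
  ultimately have "coinv_sub U a A \<subseteq> ?K"
    unfolding coinv_sub_def by (rule group.generate_subgroup_incl[OF A.a_group, rotated])
  with c show ?thesis by auto
qed

lemma coinv_sub_subgroup:
  assumes A: "abelian_group A"
    and act: "\<And>g x. \<lbrakk>g \<in> U; x \<in> carrier A\<rbrakk> \<Longrightarrow> a g x \<in> carrier A"
  shows "abelian_subgroup (coinv_sub U a A) A"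
proof -
  interpret A: abelian_group A by fact
  have "subgroup (coinv_sub U a A) (add_monoid A)"
    unfolding coinv_sub_def
    by (rule group.generate_is_subgroup[OF A.a_group]) (use act in auto)
  then show ?thesis
    by (intro abelian_subgroupI3 additive_subgroup.intro A)
qed

text \<open>Multiplication by r sends the generator for (g, x) to the generator for (g, r x), and
  the elements that r maps into the subgroup form a subgroup. This makes scalar multiplication on
  coinvariants well defined.\<close>

lemma coinv_sub_smult:
  assumes A: "left_module R A" and r: "r \<in> carrier R"
    and act: "\<And>g x. \<lbrakk>g \<in> U; x \<in> carrier A\<rbrakk> \<Longrightarrow> a g x \<in> carrier A"
      "\<And>g x. \<lbrakk>g \<in> U; x \<in> carrier A\<rbrakk> \<Longrightarrow> a g (r \<odot>\<^bsub>A\<^esub> x) = r \<odot>\<^bsub>A\<^esub> a g x"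
    and c: "c \<in> coinv_sub U a A"
  shows "r \<odot>\<^bsub>A\<^esub> c \<in> coinv_sub U a A"
proof -
  interpret A: abelian_group A by (rule left_module_group[OF A])
  let ?C = "coinv_sub U a A"
  interpret C: abelian_subgroup ?C A by (rule coinv_sub_subgroup[OF A.abelian_group_axioms act(1)])
  note cl = left_module_closed[OF A r]
  let ?K = "{x \<in> carrier A. r \<odot>\<^bsub>A\<^esub> x \<in> ?C}"
  have "subgroup ?K (add_monoid A)"
  proof (rule group.subgroupI[OF A.a_group])
    show "?K \<noteq> {}" using left_module_r_zero[OF A r] C.zero_closed by force
    show "inv\<^bsub>add_monoid A\<^esub> x \<in> ?K" if "x \<in> ?K" for x
      using that C.a_inv_closed by (simp add: left_module_r_neg[OF A r] flip: a_inv_def)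
    show "x \<otimes>\<^bsub>add_monoid A\<^esub> y \<in> ?K" if "x \<in> ?K" "y \<in> ?K" for x y
      using that by (simp add: left_module_r_distr[OF A r])
  qed auto
  moreover have "{a g x \<ominus>\<^bsub>A\<^esub> x | g x. g \<in> U \<and> x \<in> carrier A} \<subseteq> ?K"
  proof clarify
    fix g x assume gx: "g \<in> U" "x \<in> carrier A"
    have "r \<odot>\<^bsub>A\<^esub> (a g x \<ominus>\<^bsub>A\<^esub> x) = a g (r \<odot>\<^bsub>A\<^esub> x) \<ominus>\<^bsub>A\<^esub> r \<odot>\<^bsub>A\<^esub> x"
      using gx act by (simp add: a_minus_def left_module_r_distr[OF A r] left_module_r_neg[OF A r])
    also have "\<dots> \<in> ?C"
      unfolding coinv_sub_def by (rule generate.incl) (use gx cl in blast)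
    finally show "a g x \<ominus>\<^bsub>A\<^esub> x \<in> carrier A \<and> r \<odot>\<^bsub>A\<^esub> (a g x \<ominus>\<^bsub>A\<^esub> x) \<in> ?C"
      using gx act by simp
  qed
  ultimately have "?C \<subseteq> ?K"
    by (subst coinv_sub_def) (rule group.generate_subgroup_incl[OF A.a_group, rotated])
  with c show ?thesis by auto
qed

lemma the_elem_image:
  assumes "S \<noteq> {}" "\<And>x. x \<in> S \<Longrightarrow> f x = v" shows "the_elem (f ` S) = v"
proof -
  have "f ` S = {v}" using assms by auto
  then show ?thesis by simp
qed

lemma restrict_eq_iff: "restrict f A = restrict g A \<longleftrightarrow> (\<forall>x\<in>A. f x = g x)"
  by (auto simp: fun_eq_iff restrict_def)

text \<open>\<open>U\<close> stands for a single K_m. The conjugation condition makes X^U stable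
  under I, so that I acts on its dual and coinvariants can be formed.\<close>

locale hecke_pair_normalized = hecke_pair G I
  for G :: "('g, 'a) monoid_scheme" (structure) and I :: "'g set" +
  fixes U :: "'g set"
  assumes U_subset: "U \<subseteq> I"
    and U_normal: "\<lbrakk>g \<in> I; u \<in> U\<rbrakk> \<Longrightarrow> inv g \<otimes> u \<otimes> g \<in> U"
begin

lemma U_carrier: "U \<subseteq> carrier G"
  using U_subset I_subset by blast

lemma Y_stable:
  assumes "g \<in> I" "x \<in> Y U" shows "tr g x \<in> Y U"
proof -
  have "tr u (tr g x) = tr g x" if u: "u \<in> U" for u
  proof -
    have c: "g \<in> carrier G" "u \<in> carrier G" using assms u I_subset U_carrier by auto
    \<comment> \<open>Rewriting u g as g (g^-1 u g) moves the invariance under \<open>U\<close> past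
      g.\<close>
    then have "u \<otimes> g = g \<otimes> (inv g \<otimes> u \<otimes> g)"
      by (simp add: m_assoc) (simp flip: m_assoc)
    then have "tr u (tr g x) = tr g (tr (inv g \<otimes> u \<otimes> g) x)"
      using assms c by (simp flip: translate_mult)
    then show ?thesis using U_normal[OF assms(1) u] assms(2) by simp
  qed
  then show ?thesis using assms I_subset by auto
qed

lemma Y_mono: "x \<in> Y I \<Longrightarrow> x \<in> Y U"
  using U_subset by auto

abbreviation act :: "'g \<Rightarrow> (('g, 'k::field) ifun \<Rightarrow> ('g, 'k) hecke) \<Rightarrow> (('g, 'k) ifun \<Rightarrow> ('g, 'k) hecke)"
  where "act \<equiv> dual_act G (Y U)"

lemma act_closed:
  assumes "l \<in> carrier (dual_inv G I U)" "g \<in> I" shows "act g l \<in> carrier (dual_inv G I U)"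
  by (rule dual_act_closed[OF assms(1) _ U_carrier Y_stable[OF assms(2)]])
    (use assms(2) I_subset in auto)

text \<open>Since g fixes x, the functional does not notice the translation; evaluation at x
  therefore descends to I-coinvariants.\<close>

lemma act_eval: "x \<in> Y I \<Longrightarrow> g \<in> I \<Longrightarrow> act g l x = l x"
  using U_subset by (auto simp: dual_act_def)

lemma res_closed: "l \<in> carrier (dual_X G I) \<Longrightarrow> restrict l (Y U) \<in> carrier (dual_inv G I U)"
  using Y_hecke[OF U_carrier]
  by (auto simp: dual_inv_iff dual_X_closed dual_X_add dual_X_smult translate_add)

lemma res_add: "restrict (l \<oplus>\<^bsub>dual_X G I\<^esub> l') (Y U) =
    restrict l (Y U) \<oplus>\<^bsub>dual_inv G I U\<^esub> restrict l' (Y U)"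
  by (auto simp: dual_X_simps dual_inv_simps)

lemma res_smult: "restrict (h \<odot>\<^bsub>dual_X G I\<^esub> l) (Y U) = h \<odot>\<^bsub>dual_inv G I U\<^esub> restrict l (Y U)"
  by (auto simp: dual_X_simps dual_inv_simps)

lemma res_zero: "restrict \<zero>\<^bsub>dual_X G I\<^esub> (Y U) = \<zero>\<^bsub>dual_inv G I U\<^esub>"
  by (auto simp: dual_X_simps dual_inv_simps)

lemma res_act: "g \<in> I \<Longrightarrow> act g (restrict l (Y U)) = restrict (dual_act G X g l) (Y U)"
  using Y_stable[of g] unfolding dual_act_def by (intro ext) (auto simp: restrict_def)

lemma bold_Z_simps:
  "carrier (bold_Z G I U) = (\<lambda>l. restrict l (Y U)) ` carrier (dual_X G I)"
  "b \<oplus>\<^bsub>bold_Z G I U\<^esub> b' = b \<oplus>\<^bsub>dual_inv G I U\<^esub> b'"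
  "h \<odot>\<^bsub>bold_Z G I U\<^esub> b = h \<odot>\<^bsub>dual_inv G I U\<^esub> b"
  "\<zero>\<^bsub>bold_Z G I U\<^esub> = \<zero>\<^bsub>dual_inv G I U\<^esub>"
  by (simp_all add: bold_Z_def)

lemma bold_Z_subset: "carrier (bold_Z G I U) \<subseteq> carrier (dual_inv G I U)"
  using res_closed unfolding bold_Z_simps by blast

lemma left_module_bold_Z: "left_module H (bold_Z G I U)"
proof -
  note X = left_module_dual_X
  have "left_module H (dual_inv G I U\<lparr>carrier := carrier (bold_Z G I U)\<rparr>)"
  proof (rule left_module_restrict[OF left_module_dual_inv[OF U_carrier] ring_hecke bold_Z_subset])
    show "\<zero>\<^bsub>dual_inv G I U\<^esub> \<in> carrier (bold_Z G I U)"
      unfolding bold_Z_simps by (rule image_eqI[OF _ left_module_zero_closed[OF X]]) (simp add: res_zero)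
    show "b \<oplus>\<^bsub>dual_inv G I U\<^esub> b' \<in> carrier (bold_Z G I U)"
      if "b \<in> carrier (bold_Z G I U)" "b' \<in> carrier (bold_Z G I U)" for b b'
      using that unfolding bold_Z_simps
      by (auto simp flip: res_add intro!: imageI left_module_add_closed[OF X])
    show "h \<odot>\<^bsub>dual_inv G I U\<^esub> b \<in> carrier (bold_Z G I U)"
      if "h \<in> carrier H" "b \<in> carrier (bold_Z G I U)" for h b
      using that unfolding bold_Z_simps
      by (auto simp flip: res_smult intro!: imageI left_module_closed[OF X])
  qed
  then show ?thesis by (simp add: bold_Z_def)
qed

lemma bold_Z_act: "\<lbrakk>b \<in> carrier (bold_Z G I U); g \<in> I\<rbrakk> \<Longrightarrow> act g b \<in> carrier (bold_Z G I U)"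
  using I_subset unfolding bold_Z_simps by (auto simp: res_act intro!: imageI dual_act_X_closed)

text \<open>\<open>B\<close> is the image of the dual of \<open>X\<close> in the dual of X^U, and
  \<open>C\<close> is generated by the differences under I, so the coinvariants of \<open>B\<close>
  are the cosets of \<open>C\<close>.\<close>

context
  fixes B :: "(('g, 'k::field) hecke, ('g, 'k) ifun \<Rightarrow> ('g, 'k) hecke) module"
    and C :: "(('g, 'k) ifun \<Rightarrow> ('g, 'k) hecke) set"
  defines "B \<equiv> bold_Z G I U" and "C \<equiv> coinv_sub I act B"
begin

interpretation B: abelian_group B
  unfolding B_def by (rule left_module_group[OF left_module_bold_Z])

interpretation C: abelian_subgroup C B
  unfolding C_def by (rule coinv_sub_subgroup[OF B.abelian_group_axioms]) (simp add: B_def bold_Z_act)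

lemma dual_inv_eval_add:
  "x \<in> Y U \<Longrightarrow> (b \<oplus>\<^bsub>dual_inv G I U\<^esub> b') x = b x \<oplus>\<^bsub>H\<^esub> b' x"
  unfolding dual_inv_simps by simp

lemma dual_inv_eval_smult:
  "x \<in> Y U \<Longrightarrow> (h \<odot>\<^bsub>dual_inv G I U\<^esub> b) x = h \<otimes>\<^bsub>H\<^esub> b x"
  unfolding dual_inv_simps by simp

lemma coinv_sub_dual_eval:
  assumes "c \<in> coinv_sub I act (dual_inv G I U)" "x \<in> Y I"
  shows "c x = \<zero>\<^bsub>(H :: ('g, 'k) hecke ring)\<^esub>"
  by (rule coinv_sub_kernel[OF left_module_group[OF left_module_dual_inv[OF U_carrier]]
        ring.is_abelian_group[OF ring_hecke], where f = "\<lambda>c. c x", OF _ _ _ _ assms(1)])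
    (use assms(2) Y_mono[OF assms(2)] in
      \<open>simp_all only: act_closed dual_inv_closed dual_inv_eval_add act_eval\<close>)

text \<open>A second version is needed because the coinvariants of \<open>B\<close> and of the whole
  dual of X^U are formed with different subgroups: here only differences of elements of
  \<open>B\<close> generate.\<close>

lemma coinv_sub_bold_eval:
  assumes "c \<in> C" "x \<in> Y I"
  shows "c x = \<zero>\<^bsub>(H :: ('g, 'k) hecke ring)\<^esub>"
proof (rule coinv_sub_kernel[OF B.abelian_group_axioms
        ring.is_abelian_group[OF ring_hecke], where f = "\<lambda>c. c x", OF _ _ _ _ assms(1)[unfolded C_def]])
  show "b x \<in> carrier H" if "b \<in> carrier B" for b
    by (rule dual_inv_closed[OF subsetD[OF bold_Z_subset that[unfolded B_def]] Y_mono[OF assms(2)]])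
qed (use assms(2) Y_mono[OF assms(2)] in
      \<open>simp_all only: B_def bold_Z_act bold_Z_simps(2) dual_inv_eval_add act_eval\<close>)

lemma coset_eval:
  assumes "b \<in> carrier B" "b' \<in> C +>\<^bsub>B\<^esub> b" "x \<in> Y I"
  shows "b' x = b x"
proof -
  interpret H: ring "H :: ('g, 'k) hecke ring" by (rule ring_hecke)
  obtain c where c: "c \<in> C" "b' = c \<oplus>\<^bsub>B\<^esub> b" using assms(2) by (auto simp: a_r_coset_def')
  have "b x \<in> carrier H"
    by (rule dual_inv_closed[OF subsetD[OF bold_Z_subset assms(1)[unfolded B_def]] Y_mono[OF assms(3)]])
  then show ?thesis
    using coinv_sub_bold_eval[OF c(1) assms(3)]
    unfolding c(2) B_def bold_Z_simps dual_inv_eval_add[OF Y_mono[OF assms(3)]] by simp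
qed

text \<open>Passing to the larger module enlarges the coset by differences that vanish on X^I, so
  restriction to X^I is constant on it. The composite of the two maps is thus computed on a
  representative.\<close>

lemma coinv_restr_coset:
  assumes b: "b \<in> carrier B"
  shows "coinv_restr G I (coinv_incl G I U (C +>\<^bsub>B\<^esub> b)) = restrict b (Y I)"
proof -
  interpret H: ring "H :: ('g, 'k) hecke ring" by (rule ring_hecke)
  let ?CD = "coinv_sub I act (dual_inv G I U :: (('g, 'k) hecke, ('g, 'k) ifun \<Rightarrow> ('g, 'k) hecke) module)"
  have inc: "coinv_incl G I U (C +>\<^bsub>B\<^esub> b) = ?CD <+>\<^bsub>dual_inv G I U\<^esub> (C +>\<^bsub>B\<^esub> b)"
    by (simp add: coinv_incl_def coinv_I_def coinvariants_def)
  have "\<zero>\<^bsub>dual_inv G I U\<^esub> \<in> ?CD"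
    using generate.one[of "add_monoid (dual_inv G I U)"] by (simp add: coinv_sub_def)
  moreover have "b \<in> C +>\<^bsub>B\<^esub> b" using C.a_rcos_self[OF b] .
  ultimately have ne: "?CD <+>\<^bsub>dual_inv G I U\<^esub> (C +>\<^bsub>B\<^esub> b) \<noteq> {}"
    by (auto simp: set_add_def')
  have "restrict l (Y I) = restrict b (Y I)"
    if l: "l \<in> ?CD <+>\<^bsub>dual_inv G I U\<^esub> (C +>\<^bsub>B\<^esub> b)" for l
  proof (rule restrict_ext)
    fix x :: "('g, 'k) ifun" assume x: "x \<in> Y I"
    obtain d b' where d: "d \<in> ?CD" "b' \<in> C +>\<^bsub>B\<^esub> b" "l = d \<oplus>\<^bsub>dual_inv G I U\<^esub> b'"
      using l by (auto simp: set_add_def')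
    have "b x \<in> carrier H"
      by (rule dual_inv_closed[OF subsetD[OF bold_Z_subset b[unfolded B_def]] Y_mono[OF x]])
    then show "l x = b x"
      unfolding d(3) dual_inv_eval_add[OF Y_mono[OF x]]
      using coinv_sub_dual_eval[OF d(1) x] coset_eval[OF b d(2) x] by simp
  qed
  then show ?thesis
    unfolding inc coinv_restr_def inv_module_simps by (rule the_elem_image[OF ne])
qed

lemma Z_simps:
  "c \<oplus>\<^bsub>Z_module G I U\<^esub> d = c <+>\<^bsub>B\<^esub> d"
  "h \<odot>\<^bsub>Z_module G I U\<^esub> c = C <+>\<^bsub>B\<^esub> (smult B h ` c)"
  by (simp_all add: Z_module_def coinv_I_def coinvariants_def C_def B_def)

lemma Z_carrier:
  "carrier (Z_module G I U) = {C +>\<^bsub>B\<^esub> b | b. b \<in> carrier B \<and> (\<forall>x\<in>Y I. b x = \<zero>\<^bsub>H\<^esub>)}"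
proof -
  have "carrier (Z_module G I U) =
      {c. (\<exists>b\<in>carrier B. c = C +>\<^bsub>B\<^esub> b) \<and> coinv_restr G I (coinv_incl G I U c) = \<zero>\<^bsub>dual_inv G I I\<^esub>}"
    by (simp add: Z_module_def coinv_I_def coinvariants_def C_def B_def A_RCOSETS_def')
  moreover have "restrict b (Y I) = \<zero>\<^bsub>dual_inv G I I\<^esub> \<longleftrightarrow> (\<forall>x\<in>Y I. b x = \<zero>\<^bsub>H\<^esub>)"
    for b :: "('g, 'k) ifun \<Rightarrow> ('g, 'k) hecke"
    unfolding dual_inv_simps by (rule restrict_eq_iff)
  ultimately show ?thesis using coinv_restr_coset by auto
qed

lemma Z_add: "\<lbrakk>b \<in> carrier B; b' \<in> carrier B\<rbrakk> \<Longrightarrow>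
    (C +>\<^bsub>B\<^esub> b) \<oplus>\<^bsub>Z_module G I U\<^esub> (C +>\<^bsub>B\<^esub> b') = C +>\<^bsub>B\<^esub> (b \<oplus>\<^bsub>B\<^esub> b')"
  unfolding Z_simps by (rule C.a_rcos_sum)

text \<open>Multiplying a coset elementwise may give only a part of a coset, as h maps
  \<open>C\<close> into but not necessarily onto \<open>C\<close>; adding \<open>C\<close> again, as
  the definition does, fills it.\<close>

lemma Z_smult:
  assumes h: "h \<in> carrier H" and b: "b \<in> carrier B"
  shows "h \<odot>\<^bsub>Z_module G I U\<^esub> (C +>\<^bsub>B\<^esub> b) = C +>\<^bsub>B\<^esub> (h \<odot>\<^bsub>B\<^esub> b)"
proof -
  have B: "left_module H B" unfolding B_def by (rule left_module_bold_Z)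
  have hC: "h \<odot>\<^bsub>B\<^esub> c \<in> C" if "c \<in> C" for c
    unfolding C_def
  proof (rule coinv_sub_smult[OF B h])
    show "act g (h \<odot>\<^bsub>B\<^esub> x) = h \<odot>\<^bsub>B\<^esub> act g x" if "g \<in> I" for g x
      unfolding B_def bold_Z_simps by (rule dual_act_smult[OF Y_stable[OF that]])
  qed (use that in \<open>simp_all add: C_def\<close>, simp add: B_def bold_Z_act)
  have *: "c \<oplus>\<^bsub>B\<^esub> h \<odot>\<^bsub>B\<^esub> (d \<oplus>\<^bsub>B\<^esub> b) = (c \<oplus>\<^bsub>B\<^esub> h \<odot>\<^bsub>B\<^esub> d) \<oplus>\<^bsub>B\<^esub> h \<odot>\<^bsub>B\<^esub> b"
    if "c \<in> C" "d \<in> C" for c d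
    using that h b C.a_Hcarr by (simp add: left_module_r_distr[OF B] left_module_closed[OF B] B.a_assoc)
  show ?thesis
  proof
    show "h \<odot>\<^bsub>Z_module G I U\<^esub> (C +>\<^bsub>B\<^esub> b) \<subseteq> C +>\<^bsub>B\<^esub> (h \<odot>\<^bsub>B\<^esub> b)"
      using hC by (auto simp: Z_simps set_add_def' a_r_coset_def' *)
    \<comment> \<open>With b itself as representative, the summand from \<open>C\<close> is free,
      and every element of the coset is reached.\<close>
    show "C +>\<^bsub>B\<^esub> (h \<odot>\<^bsub>B\<^esub> b) \<subseteq> h \<odot>\<^bsub>Z_module G I U\<^esub> (C +>\<^bsub>B\<^esub> b)"
    proof
      fix y assume "y \<in> C +>\<^bsub>B\<^esub> (h \<odot>\<^bsub>B\<^esub> b)"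
      then obtain c where "c \<in> C" "y = c \<oplus>\<^bsub>B\<^esub> h \<odot>\<^bsub>B\<^esub> b" by (auto simp: a_r_coset_def')
      moreover have "h \<odot>\<^bsub>B\<^esub> b \<in> smult B h ` (C +>\<^bsub>B\<^esub> b)"
        by (rule imageI[OF C.a_rcos_self[OF b]])
      ultimately show "y \<in> h \<odot>\<^bsub>Z_module G I U\<^esub> (C +>\<^bsub>B\<^esub> b)"
        unfolding Z_simps set_add_def' by (intro UN_I) simp_all
    qed
  qed
qed

text \<open>f kills \<open>C\<close> and so is constant on cosets, where \<open>the_elem\<close>
  reads off its value. The induced map is then restricted to the cosets that make up Z_m.\<close>

lemma Z_hom:
  assumes M: "left_module H M" and f: "f \<in> lmod_hom H B M"
    and inv: "\<And>g b. \<lbrakk>g \<in> I; b \<in> carrier B\<rbrakk> \<Longrightarrow> f (act g b) = f b"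
  shows "(\<lambda>c\<in>carrier (Z_module G I U). the_elem (f ` c)) \<in> lmod_hom H (Z_module G I U) M"
    and "b \<in> carrier B \<Longrightarrow> the_elem (f ` (C +>\<^bsub>B\<^esub> b)) = f b"
proof -
  have B: "left_module H B" unfolding B_def by (rule left_module_bold_Z)
  interpret M: abelian_group M by (rule left_module_group[OF M])
  interpret H: ring "H :: ('g, 'k) hecke ring" by (rule ring_hecke)
  have ker: "f c = \<zero>\<^bsub>M\<^esub>" if "c \<in> C" for c
  proof (rule coinv_sub_kernel[where f = f and A = B and N = M and U = I and a = act])
    show "act g x \<in> carrier B" if "g \<in> I" "x \<in> carrier B" for g x
      using that by (simp add: B_def bold_Z_act)
  qed (use that in \<open>simp_all only: C_def B.abelian_group_axioms M.abelian_group_axioms inv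
      lmod_hom_closed[OF f] lmod_hom_add[OF f]\<close>)
  show val: "the_elem (f ` (C +>\<^bsub>B\<^esub> b)) = f b" if b: "b \<in> carrier B" for b
  proof (rule the_elem_image)
    show "C +>\<^bsub>B\<^esub> b \<noteq> {}" using C.a_rcos_self[OF b] by auto
    show "f b' = f b" if "b' \<in> C +>\<^bsub>B\<^esub> b" for b'
      using that b ker C.a_Hcarr by (auto simp: a_r_coset_def' lmod_hom_add[OF f] lmod_hom_closed[OF f])
  qed
  \<comment> \<open>Sums, and below multiples, of representatives vanishing on X^I vanish there too;
    this keeps the argument of the extensional function on Z_m inside its domain.\<close>
  have add: "b \<oplus>\<^bsub>B\<^esub> b' \<in> carrier B \<and> (\<forall>x\<in>Y I. (b \<oplus>\<^bsub>B\<^esub> b') x = \<zero>\<^bsub>H\<^esub>)"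
    if "b \<in> carrier B" "\<forall>x\<in>Y I. b x = \<zero>\<^bsub>H\<^esub>" "b' \<in> carrier B" "\<forall>x\<in>Y I. b' x = \<zero>\<^bsub>H\<^esub>" for b b'
  proof (intro conjI ballI)
    show "b \<oplus>\<^bsub>B\<^esub> b' \<in> carrier B" using that by simp
    show "(b \<oplus>\<^bsub>B\<^esub> b') x = \<zero>\<^bsub>H\<^esub>" if "x \<in> Y I" for x
      unfolding B_def bold_Z_simps dual_inv_eval_add[OF Y_mono[OF \<open>x \<in> Y I\<close>]]
      using \<open>\<forall>x\<in>Y I. b x = \<zero>\<^bsub>H\<^esub>\<close> \<open>\<forall>x\<in>Y I. b' x = \<zero>\<^bsub>H\<^esub>\<close> that by (simp only: H.l_zero H.zero_closed)
  qed
  have smult: "h \<odot>\<^bsub>B\<^esub> b \<in> carrier B \<and> (\<forall>x\<in>Y I. (h \<odot>\<^bsub>B\<^esub> b) x = \<zero>\<^bsub>H\<^esub>)"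
    if "h \<in> carrier H" "b \<in> carrier B" "\<forall>x\<in>Y I. b x = \<zero>\<^bsub>H\<^esub>" for h b
  proof (intro conjI ballI)
    show "h \<odot>\<^bsub>B\<^esub> b \<in> carrier B" using left_module_closed[OF B] that by simp
    show "(h \<odot>\<^bsub>B\<^esub> b) x = \<zero>\<^bsub>H\<^esub>" if "x \<in> Y I" for x
      unfolding B_def bold_Z_simps dual_inv_eval_smult[OF Y_mono[OF \<open>x \<in> Y I\<close>]]
      using \<open>\<forall>x\<in>Y I. b x = \<zero>\<^bsub>H\<^esub>\<close> \<open>h \<in> carrier H\<close> that by (simp only: H.r_null)
  qed
  show "(\<lambda>c\<in>carrier (Z_module G I U). the_elem (f ` c)) \<in> lmod_hom H (Z_module G I U) M"
  proof (rule lmod_homI)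
    fix c d :: "(('g, 'k) ifun \<Rightarrow> ('g, 'k) hecke) set" assume "c \<in> carrier (Z_module G I U)" "d \<in> carrier (Z_module G I U)"
    then obtain b b' where b: "c = C +>\<^bsub>B\<^esub> b" "b \<in> carrier B" "\<forall>x\<in>Y I. b x = \<zero>\<^bsub>H\<^esub>"
      and b': "d = C +>\<^bsub>B\<^esub> b'" "b' \<in> carrier B" "\<forall>x\<in>Y I. b' x = \<zero>\<^bsub>H\<^esub>"
      unfolding Z_carrier by auto
    have "c \<in> carrier (Z_module G I U)" "d \<in> carrier (Z_module G I U)"
      "C +>\<^bsub>B\<^esub> (b \<oplus>\<^bsub>B\<^esub> b') \<in> carrier (Z_module G I U)"
      unfolding Z_carrier using b b' add[OF b(2,3) b'(2,3)] by blast+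
    then show "(\<lambda>c\<in>carrier (Z_module G I U). the_elem (f ` c)) (c \<oplus>\<^bsub>Z_module G I U\<^esub> d) =
        (\<lambda>c\<in>carrier (Z_module G I U). the_elem (f ` c)) c \<oplus>\<^bsub>M\<^esub>
        (\<lambda>c\<in>carrier (Z_module G I U). the_elem (f ` c)) d"
      using b b' by (simp add: Z_add val lmod_hom_add[OF f])
  next
    fix h :: "('g, 'k) hecke" and c :: "(('g, 'k) ifun \<Rightarrow> ('g, 'k) hecke) set" assume h: "h \<in> carrier H" and "c \<in> carrier (Z_module G I U)"
    then obtain b where b: "c = C +>\<^bsub>B\<^esub> b" "b \<in> carrier B" "\<forall>x\<in>Y I. b x = \<zero>\<^bsub>H\<^esub>"
      unfolding Z_carrier by auto
    have "c \<in> carrier (Z_module G I U)" "C +>\<^bsub>B\<^esub> (h \<odot>\<^bsub>B\<^esub> b) \<in> carrier (Z_module G I U)"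
      unfolding Z_carrier using b smult[OF h b(2,3)] by blast+
    then show "(\<lambda>c\<in>carrier (Z_module G I U). the_elem (f ` c)) (h \<odot>\<^bsub>Z_module G I U\<^esub> c) =
        h \<odot>\<^bsub>M\<^esub> (\<lambda>c\<in>carrier (Z_module G I U). the_elem (f ` c)) c"
      using b h by (simp add: Z_smult val lmod_hom_smult[OF f] left_module_closed[OF B])
  qed (auto simp: Z_carrier val lmod_hom_closed[OF f])
qed

text \<open>Vanishing of b on X^I is what places its class in Z_m, where the induced homomorphism
  has to be zero.\<close>

lemma Z_torsionfree:
  assumes M: "left_module H M" and f: "f \<in> lmod_hom H B M"
    and inv: "\<And>g b. \<lbrakk>g \<in> I; b \<in> carrier B\<rbrakk> \<Longrightarrow> f (act g b) = f b"
    and tf: "lmod_hom H (Z_module G I U) M = {\<lambda>z\<in>carrier (Z_module G I U). \<zero>\<^bsub>M\<^esub>}"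
    and b: "b \<in> carrier B" "\<And>x. x \<in> Y I \<Longrightarrow> b x = \<zero>\<^bsub>H\<^esub>"
  shows "f b = \<zero>\<^bsub>M\<^esub>"
proof -
  have eq: "(\<lambda>c\<in>carrier (Z_module G I U). the_elem (f ` c)) =
      (\<lambda>z\<in>carrier (Z_module G I U). \<zero>\<^bsub>M\<^esub>)"
    using Z_hom(1)[where f = f and M = M, OF M f inv] unfolding tf by (rule singletonD)
  have "C +>\<^bsub>B\<^esub> b \<in> carrier (Z_module G I U)" unfolding Z_carrier using b by blast
  with fun_cong[OF eq, of "C +>\<^bsub>B\<^esub> b"] show ?thesis
    using Z_hom(2)[where f = f and M = M, OF M f inv b(1)] by simp
qed

end
end

section \<open>Torsionfree modules\<close>

lemma left_module_type_ring: "left_module type_ring V \<Longrightarrow> Module.module type_ring V"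
  unfolding left_module_def by (intro moduleI cring_type_ring) (auto simp del: type_ring_simps(1))

text \<open>\<open>K_small\<close> makes \<open>X\<close> smooth, \<open>K_subset\<close> and
  \<open>K_normal\<close> let I act on the dual of X^(K m) and place X^I inside X^(K m),
  \<open>K_antimono\<close> replaces two levels by a common deeper one, and \<open>K_open\<close>
  turns stability under some K m into openness.\<close>

locale hecke_tower = hecke_pair G I
  for G :: "('g, 'a) monoid_scheme" (structure) and I :: "'g set" +
  fixes K :: "nat \<Rightarrow> 'g set" and T :: "'g topology"
  assumes K_subset: "1 \<le> m \<Longrightarrow> K m \<subseteq> I"
    and K_antimono: "m \<le> n \<Longrightarrow> K n \<subseteq> K m"
    and K_normal: "\<lbrakk>1 \<le> m; g \<in> I; k \<in> K m\<rbrakk> \<Longrightarrow> inv g \<otimes> k \<otimes> g \<in> K m"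
    and K_small: "g \<in> carrier G \<Longrightarrow> \<exists>m\<ge>1. \<forall>k\<in>K m. inv g \<otimes> k \<otimes> g \<in> I"
    and K_open: "\<lbrakk>S \<subseteq> carrier G; 1 \<le> m; \<And>g k. \<lbrakk>g \<in> S; k \<in> K m\<rbrakk> \<Longrightarrow> g \<otimes> k \<in> S\<rbrakk> \<Longrightarrow> openin T S"
begin

lemma K_carrier: "1 \<le> m \<Longrightarrow> k \<in> K m \<Longrightarrow> k \<in> carrier G"
  using K_subset I_subset by blast

lemma K_max:
  assumes "1 \<le> m" "1 \<le> n"
  obtains p where "1 \<le> p" "K p \<subseteq> K m" "K p \<subseteq> K n"
  by (rule that[of "max m n"]) (use assms in \<open>auto intro: K_antimono[THEN subsetD, rotated]\<close>)

text \<open>The translate of \<open>char_I\<close> by g is fixed by g I g^-1, which contains K m for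
  some m by \<open>K_small\<close>; a function in \<open>X\<close> involves finitely many
  translates.\<close>

lemma ind_space_fixed:
  assumes "x \<in> X" shows "\<exists>m\<ge>1. \<forall>k\<in>K m. tr k x = x"
  using assms
proof (induction rule: ind_space_induct)
  case zero
  show ?case by (intro exI[of _ 1]) (simp add: translate_zero)
next
  case (add x y)
  obtain m n where mn: "1 \<le> m" "\<forall>k\<in>K m. tr k x = x" "1 \<le> n" "\<forall>k\<in>K n. tr k y = y"
    using add by blast
  obtain p where "1 \<le> p" "K p \<subseteq> K m" "K p \<subseteq> K n" by (rule K_max[OF mn(1,3)])
  with mn show ?case by (intro exI[of _ p]) (auto simp: translate_add subset_iff)
next
  case (basis a g)
  obtain m where m: "1 \<le> m" "\<And>k. k \<in> K m \<Longrightarrow> inv g \<otimes> k \<otimes> g \<in> I" using K_small[OF basis] by blast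
  have "tr k (tr g (char_I I)) = tr g (char_I I :: ('g, 'b) ifun)" if k: "k \<in> K m" for k
  proof -
    have c: "k \<in> carrier G" using K_carrier[OF m(1) k] .
    then have "k \<otimes> g = g \<otimes> (inv g \<otimes> k \<otimes> g)"
      using basis by (simp add: m_assoc) (simp flip: m_assoc)
    then have "tr k (tr g (char_I I)) = tr g (tr (inv g \<otimes> k \<otimes> g) (char_I I :: ('g, 'b) ifun))"
      using basis c by (simp flip: translate_mult)
    then show ?thesis using m(2)[OF k] by simp
  qed
  then show ?case using m(1) by (intro exI[of _ m]) (simp add: translate_scale)
qed

context
  fixes M :: "(('g, 'k::field) hecke, 'm) module"
  assumes M: "left_module H M"
begin

lemma t_fixed: "\<phi> \<in> carrier (t_obj G I M) \<Longrightarrow> \<exists>m\<ge>1. \<forall>k\<in>K m. gact (t_obj G I M) k \<phi> = \<phi>"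
proof (induction rule: t_induct_tensor[OF M, consumes 1, case_names zero add elt])
  case zero
  show ?case by (intro exI[of _ 1]) (use K_carrier[of 1] in \<open>simp add: t_gact_zero[OF M]\<close>)
next
  case (add \<phi> \<psi>)
  obtain m n where mn: "1 \<le> m" "\<forall>k\<in>K m. gact (t_obj G I M) k \<phi> = \<phi>"
    "1 \<le> n" "\<forall>k\<in>K n. gact (t_obj G I M) k \<psi> = \<psi>"
    using add by blast
  obtain p where p: "1 \<le> p" "K p \<subseteq> K m" "K p \<subseteq> K n" by (rule K_max[OF mn(1,3)])
  show ?case
  proof (intro exI[of _ p] conjI p(1) ballI)
    fix k assume "k \<in> K p"
    then show "gact (t_obj G I M) k (\<phi> \<oplus>\<^bsub>t_obj G I M\<^esub> \<psi>) = \<phi> \<oplus>\<^bsub>t_obj G I M\<^esub> \<psi>"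
      using mn p K_carrier[OF p(1)] by (simp add: t_gact_add[OF M] subset_iff)
  qed
next
  case (elt x m)
  obtain n where "1 \<le> n" "\<forall>k\<in>K n. tr k x = x" using ind_space_fixed[OF elt(1)] by blast
  then show ?case
    using elt K_carrier[of n] by (intro exI[of _ n]) (simp add: tau_elt_gact[OF M])
qed

text \<open>For a pure tensor with first factor x the value at l depends on l(x) alone, so any level
  fixing x will do. A sum takes a common deeper level, since a smaller K m has more
  invariants.\<close>

lemma t_factors: "\<phi> \<in> carrier (t_obj G I M) \<Longrightarrow> \<exists>m\<ge>1. \<forall>l\<in>carrier (dual_X G I).
    \<forall>l'\<in>carrier (dual_X G I). (\<forall>x\<in>Y (K m). l x = l' x) \<longrightarrow> \<phi> l = \<phi> l'"
proof (induction rule: t_induct_tensor[OF M, consumes 1, case_names zero add elt])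
  case zero
  show ?case by (intro exI[of _ 1]) (simp add: t_obj_simps)
next
  case (add \<phi> \<psi>)
  obtain m where m: "1 \<le> m" "\<forall>l\<in>carrier (dual_X G I). \<forall>l'\<in>carrier (dual_X G I).
    (\<forall>x\<in>Y (K m). l x = l' x) \<longrightarrow> \<phi> l = \<phi> l'" using add by blast
  obtain n where n: "1 \<le> n" "\<forall>l\<in>carrier (dual_X G I). \<forall>l'\<in>carrier (dual_X G I).
    (\<forall>x\<in>Y (K n). l x = l' x) \<longrightarrow> \<psi> l = \<psi> l'" using add by blast
  obtain p where p: "1 \<le> p" "K p \<subseteq> K m" "K p \<subseteq> K n" by (rule K_max[OF m(1) n(1)])
  have Y: "x \<in> Y (K p)" if "x \<in> Y (K m) \<or> x \<in> Y (K n)" for x :: "('g, 'k) ifun"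
    using that p by auto
  show ?case
  proof (intro exI[of _ p] conjI p(1) ballI impI)
    fix l l' :: "('g, 'k) ifun \<Rightarrow> ('g, 'k) hecke"
    assume l: "l \<in> carrier (dual_X G I)" "l' \<in> carrier (dual_X G I)"
      and eq: "\<forall>x\<in>Y (K p). l x = l' x"
    have "\<phi> l = \<phi> l'"
    proof (rule m(2)[rule_format, OF l])
      show "l x = l' x" if "x \<in> Y (K m)" for x by (rule bspec[OF eq Y]) (use that in blast)
    qed
    moreover have "\<psi> l = \<psi> l'"
    proof (rule n(2)[rule_format, OF l])
      show "l x = l' x" if "x \<in> Y (K n)" for x by (rule bspec[OF eq Y]) (use that in blast)
    qed
    ultimately show "(\<phi> \<oplus>\<^bsub>t_obj G I M\<^esub> \<psi>) l = (\<phi> \<oplus>\<^bsub>t_obj G I M\<^esub> \<psi>) l'"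
      using l by (simp add: t_obj_simps)
  qed
next
  case (elt x m)
  obtain n where "1 \<le> n" "\<forall>k\<in>K n. tr k x = x" using ind_space_fixed[OF elt(1)] by blast
  then show ?case
    using elt by (intro exI[of _ n]) (auto simp: tau_elt_def)
qed

text \<open>If K m fixes \<phi>, the stabiliser of \<phi> is stable under right multiplication by K
  m, hence open.\<close>

lemma t_smooth: "smooth_rep G T (t_obj G I M)"
proof -
  have "openin T {g \<in> carrier G. gact (t_obj G I M) g \<phi> = \<phi>}" if \<phi>: "\<phi> \<in> carrier (t_obj G I M)" for \<phi>
  proof -
    obtain m where m: "1 \<le> m" "\<forall>k\<in>K m. gact (t_obj G I M) k \<phi> = \<phi>" using t_fixed[OF \<phi>] by blast
    show ?thesis
      by (rule K_open[OF _ m(1)]) (use m K_carrier[OF m(1)] in \<open>auto simp: t_gact_mult[OF M]\<close>)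
  qed
  then show ?thesis
    unfolding smooth_rep_def
    by (auto simp: left_module_type_ring t_module[OF M] t_gact[OF M] t_gact_add[OF M]
        t_gact_smult[OF M] t_gact_one[OF M] t_gact_mult[OF M])
qed

lemma t_generated: "generated_by_invariants G I (t_obj G I M)"
  unfolding generated_by_invariants_def
proof (intro allI impI, elim conjE)
  fix W
  assume W: "submodule W type_ring (t_obj G I M)"
    and act: "\<forall>g\<in>carrier G. \<forall>w\<in>W. gact (t_obj G I M) g w \<in> W"
    and inv: "{v \<in> carrier (t_obj G I M). \<forall>g\<in>I. gact (t_obj G I M) g v = v} \<subseteq> W"
  have sub: "W \<subseteq> carrier (t_obj G I M)" "\<zero>\<^bsub>t_obj G I M\<^esub> \<in> W"
    "\<And>v w. \<lbrakk>v \<in> W; w \<in> W\<rbrakk> \<Longrightarrow> v \<oplus>\<^bsub>t_obj G I M\<^esub> w \<in> W"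
    "\<And>a w. w \<in> W \<Longrightarrow> a \<odot>\<^bsub>t_obj G I M\<^esub> w \<in> W"
    using submodule.axioms(1)[OF W] submodule.smult_closed[OF W]
      subgroup.subset subgroup.one_closed subgroup.m_closed by force+
  \<comment> \<open>Such a vector is I-invariant because I fixes \<open>char_I\<close>.\<close>
  have gen: "tau_elt M (char_I I) m \<in> W" if m: "m \<in> carrier M" for m
    using inv tau_elt_mem[OF M char_I_mem m] I_subset
    by (auto simp: tau_elt_gact[OF M char_I_mem] subset_iff)
  have "\<phi> \<in> W" if "\<phi> \<in> carrier (t_obj G I M)" for \<phi>
    by (rule t_induct[OF M that]) (use sub act gen in auto)
  with sub show "W = carrier (t_obj G I M)" by blast
qed

lemma t_invariants:
  assumes tf: "torsionfree G I K M" and sur: "hyp_sur G I TYPE('k)"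
    and \<phi>: "\<phi> \<in> carrier (t_obj G I M)" and inv: "\<And>g. g \<in> I \<Longrightarrow> gact (t_obj G I M) g \<phi> = \<phi>"
  obtains m where "m \<in> carrier M" "\<phi> = tau_elt M (char_I I) m"
proof -
  let ?X = "dual_X G I :: (('g, 'k) hecke, ('g, 'k) ifun \<Rightarrow> ('g, 'k) hecke) module"
  interpret M: abelian_group M by (rule left_module_group[OF M])
  interpret H: ring "H :: ('g, 'k) hecke ring" by (rule ring_hecke)
  interpret D: abelian_group ?X by (rule left_module_group[OF left_module_dual_X])
  note hom = t_hom[OF M \<phi>]
  obtain m where m: "1 \<le> m" and dep: "\<And>l l'. \<lbrakk>l \<in> carrier ?X; l' \<in> carrier ?X;
      \<forall>x\<in>Y (K m). l x = l' x\<rbrakk> \<Longrightarrow> \<phi> l = \<phi> l'"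
    using t_factors[OF \<phi>] by blast
  interpret P: hecke_pair_normalized G I "K m"
    by unfold_locales (use K_subset[OF m] K_normal[OF m] in auto)
  let ?B = "bold_Z G I (K m) :: (('g, 'k) hecke, ('g, 'k) ifun \<Rightarrow> ('g, 'k) hecke) module"
  \<comment> \<open>A map on the image of restriction is defined by choosing a lift of each b;
    \<open>dep\<close> says that \<phi> does not see the choice.\<close>
  define f where "f = (\<lambda>b\<in>carrier ?B. \<phi> (SOME l. l \<in> carrier ?X \<and> restrict l (Y (K m)) = b))"
  have resB: "restrict l (Y (K m)) \<in> carrier ?B" if "l \<in> carrier ?X" for l
    unfolding P.bold_Z_simps using that by blast
  have B_cases: "\<exists>l\<in>carrier ?X. b = restrict l (Y (K m))" if "b \<in> carrier ?B" for b
    using that unfolding P.bold_Z_simps by blast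
  have f_res: "f (restrict l (Y (K m))) = \<phi> l" if l: "l \<in> carrier ?X" for l
  proof -
    let ?l = "SOME l'. l' \<in> carrier ?X \<and> restrict l' (Y (K m)) = restrict l (Y (K m))"
    have s: "?l \<in> carrier ?X \<and> restrict ?l (Y (K m)) = restrict l (Y (K m))"
      by (rule someI[of _ l]) (use l in simp)
    have "\<phi> ?l = \<phi> l"
      by (rule dep[OF conjunct1[OF s] l restrict_eq_iff[THEN iffD1, OF conjunct2[OF s]]])
    then show ?thesis using resB[OF l] by (simp only: f_def restrict_apply')
  qed
  have f_hom: "f \<in> lmod_hom H ?B M"
  proof (rule lmod_homI)
    fix b assume "b \<in> carrier ?B"
    then show "f b \<in> carrier M" using B_cases f_res lmod_hom_closed[OF hom] by force
  next
    fix b b' assume "b \<in> carrier ?B" "b' \<in> carrier ?B"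
    then obtain l l' where l: "l \<in> carrier ?X" "b = restrict l (Y (K m))"
      "l' \<in> carrier ?X" "b' = restrict l' (Y (K m))" using B_cases by blast
    have "f (restrict (l \<oplus>\<^bsub>?X\<^esub> l') (Y (K m))) = \<phi> l \<oplus>\<^bsub>M\<^esub> \<phi> l'"
      using f_res[of "l \<oplus>\<^bsub>?X\<^esub> l'"] l by (simp add: lmod_hom_add[OF hom])
    then show "f (b \<oplus>\<^bsub>?B\<^esub> b') = f b \<oplus>\<^bsub>M\<^esub> f b'"
      unfolding l(2,4) P.bold_Z_simps P.res_add f_res[OF l(1)] f_res[OF l(3)] .
  next
    fix h :: "('g, 'k) hecke" and b assume h: "h \<in> carrier H" and "b \<in> carrier ?B"
    then obtain l where l: "l \<in> carrier ?X" "b = restrict l (Y (K m))" using B_cases by blast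
    have "f (restrict (h \<odot>\<^bsub>?X\<^esub> l) (Y (K m))) = h \<odot>\<^bsub>M\<^esub> \<phi> l"
      using f_res[OF left_module_closed[OF left_module_dual_X h l(1)]]
      by (simp add: lmod_hom_smult[OF hom h l(1)])
    then show "f (h \<odot>\<^bsub>?B\<^esub> b) = h \<odot>\<^bsub>M\<^esub> f b"
      unfolding l(2) P.bold_Z_simps P.res_smult f_res[OF l(1)] .
  qed (simp add: f_def)
  have f_inv: "f (P.act g b) = f b" if g: "g \<in> I" and b: "b \<in> carrier ?B" for g b
  proof -
    obtain l where l: "l \<in> carrier ?X" "b = restrict l (Y (K m))" using B_cases[OF b] by blast
    have gl: "dual_act G X g l \<in> carrier ?X"
      by (rule dual_act_X_closed[OF l(1)]) (use g I_subset in blast)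
    \<comment> \<open>Invariance of \<phi> under g, evaluated at l, is invariance of \<phi> under
      the action on its argument.\<close>
    have "\<phi> (dual_act G X g l) = \<phi> l"
      using fun_cong[OF inv[OF g], of l] l(1) by (simp add: t_obj_simps)
    then show ?thesis unfolding l(2) P.res_act[OF g] f_res[OF gl] f_res[OF l(1)] .
  qed
  have Zm: "lmod_hom H (Z_module G I (K m)) M = {\<lambda>z\<in>carrier (Z_module G I (K m)). \<zero>\<^bsub>M\<^esub>}"
    using tf m unfolding torsionfree_def by blast
  have vanish: "\<phi> l = \<zero>\<^bsub>M\<^esub>" if l: "l \<in> carrier ?X" and l0: "l (char_I I) = \<zero>\<^bsub>H\<^esub>" for l
  proof -
    \<comment> \<open>Vanishing at \<open>char_I\<close> spreads to X^I because
      \<open>char_I\<close> generates X^I over \<open>H\<close>.\<close>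
    have res0: "restrict l (Y (K m)) x = \<zero>\<^bsub>H\<^esub>" if x: "x \<in> Y I" for x
    proof -
      have "hecke_of x \<in> carrier H" by (rule hecke_of_mem) (use x in auto)
      then show ?thesis
        using dual_X_on_invariants[OF l x] P.Y_mono[OF x] l0 by simp
    qed
    have "f (restrict l (Y (K m))) = \<zero>\<^bsub>M\<^esub>"
      by (rule P.Z_torsionfree[where f = f and M = M, OF M f_hom _ Zm resB[OF l]])
        (fact f_inv res0)+
    then show ?thesis unfolding f_res[OF l] .
  qed
  obtain l0 where l0: "l0 \<in> carrier ?X" "l0 (char_I I) = \<one>\<^bsub>(H :: ('g, 'k) hecke ring)\<^esub>"
    using dual_one_on_char_I[OF sur] by blast
  have "\<phi> l = l (char_I I) \<odot>\<^bsub>M\<^esub> \<phi> l0" if l: "l \<in> carrier ?X" for l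
  proof -
    let ?h = "l (char_I I)"
    have h: "?h \<in> carrier H" by (rule dual_X_closed[OF l char_I_mem])
    have hl0: "?h \<odot>\<^bsub>?X\<^esub> l0 \<in> carrier ?X"
      by (rule left_module_closed[OF left_module_dual_X h l0(1)])
    have "(l \<ominus>\<^bsub>?X\<^esub> ?h \<odot>\<^bsub>?X\<^esub> l0) (char_I I) = ?h \<ominus>\<^bsub>H\<^esub> (?h \<odot>\<^bsub>?X\<^esub> l0) (char_I I)"
      by (rule additive_map_diff[OF D.abelian_group_axioms H.is_abelian_group,
            where f = "\<lambda>l. l (char_I I)"])
        (use l hl0 in \<open>auto simp: dual_X_closed[OF _ char_I_mem] dual_X_simps\<close>)
    also have "\<dots> = \<zero>\<^bsub>H\<^esub>" using h l0(2) by (simp add: dual_X_simps a_minus_def H.r_neg)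
    finally have "\<phi> (l \<ominus>\<^bsub>?X\<^esub> ?h \<odot>\<^bsub>?X\<^esub> l0) = \<zero>\<^bsub>M\<^esub>" by (intro vanish) (use l hl0 in simp_all)
    moreover have "\<phi> (l \<ominus>\<^bsub>?X\<^esub> ?h \<odot>\<^bsub>?X\<^esub> l0) = \<phi> l \<ominus>\<^bsub>M\<^esub> \<phi> (?h \<odot>\<^bsub>?X\<^esub> l0)"
      by (rule additive_map_diff[OF D.abelian_group_axioms M.abelian_group_axioms, where f = \<phi>])
        (simp_all only: lmod_hom_closed[OF hom] lmod_hom_add[OF hom] l hl0)
    ultimately have "\<phi> l = \<phi> (?h \<odot>\<^bsub>?X\<^esub> l0)"
      using lmod_hom_closed[OF hom l] lmod_hom_closed[OF hom hl0]
        M.minus_equality[of "\<phi> l" "\<ominus>\<^bsub>M\<^esub> \<phi> (?h \<odot>\<^bsub>?X\<^esub> l0)"]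
      by (simp add: a_minus_def)
    then show ?thesis by (simp add: lmod_hom_smult[OF hom h l0(1)])
  qed
  then have "\<phi> = tau_elt M (char_I I) (\<phi> l0)"
    by (intro t_eqI[OF M \<phi>]) (simp_all add: tau_elt_def)
  with that lmod_hom_closed[OF hom l0(1)] show thesis by blast
qed

end
end

section \<open>Morphisms and full faithfulness\<close>

context hecke_tower begin

lemma rep_hom_lmod_hom: "F \<in> rep_hom G V W \<Longrightarrow> F \<in> lmod_hom type_ring V W"
  by (simp add: rep_hom_def)

lemma rep_hom_t_add:
  assumes "F \<in> rep_hom G (t_obj G I M) W" "\<phi> \<in> carrier (t_obj G I M)" "\<psi> \<in> carrier (t_obj G I M)"
  shows "F (\<phi> \<oplus>\<^bsub>t_obj G I M\<^esub> \<psi>) = F \<phi> \<oplus>\<^bsub>W\<^esub> F \<psi>"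
  by (rule lmod_hom_add[OF rep_hom_lmod_hom[OF assms(1)] assms(2,3)])

lemma rep_hom_t_smult:
  assumes "F \<in> rep_hom G (t_obj G I M) W" "\<phi> \<in> carrier (t_obj G I M)"
  shows "F (a \<odot>\<^bsub>t_obj G I M\<^esub> \<phi>) = a \<odot>\<^bsub>W\<^esub> F \<phi>"
  by (rule lmod_hom_smult[OF rep_hom_lmod_hom[OF assms(1)] _ assms(2)]) simp

lemma rep_hom_t_gact:
  assumes "F \<in> rep_hom G (t_obj G I M) W" "\<phi> \<in> carrier (t_obj G I M)" "g \<in> carrier G"
  shows "F (gact (t_obj G I M) g \<phi>) = gact W g (F \<phi>)"
  using assms by (simp add: rep_hom_def)

lemma rep_hom_t_closed:
  assumes "F \<in> rep_hom G (t_obj G I M) W" "\<phi> \<in> carrier (t_obj G I M)"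
  shows "F \<phi> \<in> carrier W"
  by (rule lmod_hom_closed[OF rep_hom_lmod_hom[OF assms(1)] assms(2)])

context
  fixes M M' :: "(('g, 'k::field) hecke, 'm) module"
  assumes M: "left_module H M" and M': "left_module H M'"
begin

text \<open>Naturality of \<tau>: f carries l(x) m to l(x) f(m) by H-linearity. Induction over pure
  tensors then shows that composing with f maps t(M) into t(M').\<close>

lemma compose_tau_elt:
  assumes f: "f \<in> lmod_hom H M M'" and x: "x \<in> X" and m: "m \<in> carrier M"
  shows "compose (carrier (dual_X G I)) f (tau_elt M x m) = tau_elt M' x (f m)"
  unfolding compose_def tau_elt_def
  by (rule restrict_ext) (simp add: lmod_hom_smult[OF f dual_X_closed] x m)

lemma compose_t_zero:
  assumes f: "f \<in> lmod_hom H M M'"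
  shows "compose (carrier (dual_X G I)) f \<zero>\<^bsub>t_obj G I M\<^esub> = \<zero>\<^bsub>t_obj G I M'\<^esub>"
proof -
  have "f \<zero>\<^bsub>M\<^esub> = \<zero>\<^bsub>M'\<^esub>"
    by (rule additive_map_zero[OF left_module_group[OF M] left_module_group[OF M']])
      (simp_all add: lmod_hom_closed[OF f] lmod_hom_add[OF f])
  then show ?thesis unfolding compose_def t_obj_simps by (intro restrict_ext) simp
qed

lemma compose_t_add:
  assumes f: "f \<in> lmod_hom H M M'"
    and "\<phi> \<in> carrier (t_obj G I M)" "\<psi> \<in> carrier (t_obj G I M)"
  shows "compose (carrier (dual_X G I)) f (\<phi> \<oplus>\<^bsub>t_obj G I M\<^esub> \<psi>) =
    compose (carrier (dual_X G I)) f \<phi> \<oplus>\<^bsub>t_obj G I M'\<^esub> compose (carrier (dual_X G I)) f \<psi>"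
  unfolding compose_def t_obj_simps
  by (rule restrict_ext) (simp add: lmod_hom_add[OF f] t_closed[OF M] assms)

lemma compose_t_closed:
  assumes f: "f \<in> lmod_hom H M M'" and \<phi>: "\<phi> \<in> carrier (t_obj G I M)"
  shows "compose (carrier (dual_X G I)) f \<phi> \<in> carrier (t_obj G I M')"
  using \<phi>
  by (induction rule: t_induct_tensor[OF M, consumes 1, case_names zero add elt])
    (simp_all add: compose_t_zero[OF f] compose_t_add[OF f] compose_tau_elt[OF f]
      t_zero[OF M'] t_add[OF M'] tau_elt_mem[OF M'] lmod_hom_closed[OF f])

lemma t_mor_hom:
  assumes f: "f \<in> lmod_hom H M M'"
  shows "t_mor G I M M' f \<in> rep_hom G (t_obj G I M) (t_obj G I M')"
proof -
  have smult: "compose (carrier (dual_X G I)) f (a \<odot>\<^bsub>t_obj G I M\<^esub> \<phi>) =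
      a \<odot>\<^bsub>t_obj G I M'\<^esub> compose (carrier (dual_X G I)) f \<phi>" if "\<phi> \<in> carrier (t_obj G I M)" for a \<phi>
    unfolding compose_def t_obj_simps
    by (rule restrict_ext) (simp add: lmod_hom_smult[OF f hecke_scalar_mem] t_closed[OF M] that)
  have gact: "compose (carrier (dual_X G I)) f (gact (t_obj G I M) g \<phi>) =
      gact (t_obj G I M') g (compose (carrier (dual_X G I)) f \<phi>)" if "g \<in> carrier G" for g \<phi>
    unfolding compose_def t_obj_simps
    by (rule restrict_ext) (simp add: dual_act_X_closed that)
  have "t_mor G I M M' f \<in> lmod_hom type_ring (t_obj G I M) (t_obj G I M')"
    by (rule lmod_homI) (simp_all add: t_mor_def compose_t_closed[OF f] compose_t_add[OF f]
        t_add[OF M] t_smult[OF M] smult)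
  then show ?thesis
    by (simp add: rep_hom_def t_mor_def t_gact[OF M] gact)
qed

lemma t_mor_tau_elt:
  "\<lbrakk>f \<in> lmod_hom H M M'; x \<in> X; m \<in> carrier M\<rbrakk> \<Longrightarrow> t_mor G I M M' f (tau_elt M x m) = tau_elt M' x (f m)"
  by (simp add: t_mor_def tau_elt_mem[OF M] compose_tau_elt)

lemma t_mor_inj:
  assumes "hyp_sur G I TYPE('k)"
  shows "inj_on (t_mor G I M M') (lmod_hom H M M')"
proof (rule inj_onI)
  fix f f' assume f: "f \<in> lmod_hom H M M'" "f' \<in> lmod_hom H M M'"
    and eq: "t_mor G I M M' f = t_mor G I M M' f'"
  show "f = f'"
  proof (rule extensionalityI[OF lmod_hom_extensional[OF f(1)] lmod_hom_extensional[OF f(2)]])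
    fix m assume m: "m \<in> carrier M"
    show "f m = f' m"
      by (rule tau_elt_inj[OF M' assms lmod_hom_closed[OF f(1) m] lmod_hom_closed[OF f(2) m]])
        (use t_mor_tau_elt[OF f(1) char_I_mem m] t_mor_tau_elt[OF f(2) char_I_mem m] eq in simp)
  qed
qed

lemma t_mor_surj:
  assumes tf: "torsionfree G I K M'" and sur: "hyp_sur G I TYPE('k)"
    and F: "F \<in> rep_hom G (t_obj G I M) (t_obj G I M')"
  shows "F \<in> t_mor G I M M' ` lmod_hom H M M'"
proof -
  interpret M: abelian_group M by (rule left_module_group[OF M])
  interpret M': abelian_group M' by (rule left_module_group[OF M'])
  note Fadd = rep_hom_t_add[OF F] and Fsmult = rep_hom_t_smult[OF F] and Fgact = rep_hom_t_gact[OF F]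
    and Fcl = rep_hom_t_closed[OF F]
  have Fzero: "F \<zero>\<^bsub>t_obj G I M\<^esub> = \<zero>\<^bsub>t_obj G I M'\<^esub>"
    by (rule additive_map_zero[OF left_module_group[OF t_module[OF M]] left_module_group[OF t_module[OF M']]])
      (simp_all add: Fcl Fadd)
  have "\<exists>n. n \<in> carrier M' \<and> F (tau_elt M (char_I I) m) = tau_elt M' (char_I I) n"
    if m: "m \<in> carrier M" for m
  proof (rule t_invariants[OF M' tf sur])
    note e = tau_elt_mem[OF M char_I_mem m]
    show "F (tau_elt M (char_I I) m) \<in> carrier (t_obj G I M')" by (rule Fcl[OF e])
    show "gact (t_obj G I M') g (F (tau_elt M (char_I I) m)) = F (tau_elt M (char_I I) m)"
      if "g \<in> I" for g
    proof -
      have g: "g \<in> carrier G" using that I_subset by blast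
      show ?thesis
        using Fgact[OF e g] that by (simp add: tau_elt_gact[OF M char_I_mem g])
    qed
  qed blast
  then obtain f0 where f0: "\<And>m. m \<in> carrier M \<Longrightarrow>
      f0 m \<in> carrier M' \<and> F (tau_elt M (char_I I) m) = tau_elt M' (char_I I) (f0 m)"
    by metis
  define f where "f = restrict f0 (carrier M)"
  have f_cl: "f m \<in> carrier M'" and f_char: "F (tau_elt M (char_I I) m) = tau_elt M' (char_I I) (f m)"
    if "m \<in> carrier M" for m
    using f0[OF that] that by (simp_all add: f_def)
  \<comment> \<open>The formula passes from \<open>char_I\<close> to every x by linearity and
    equivariance of \<open>F\<close>, while f is still only a map of sets; it is then the means to
    prove H-linearity of f.\<close>
  have f_elt: "F (tau_elt M x m) = tau_elt M' x (f m)" if x: "x \<in> X" and m: "m \<in> carrier M" for x m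
    using x
  proof (induction rule: ind_space_induct)
    case zero
    show ?case by (simp add: tau_elt_zero[OF M m] tau_elt_zero[OF M' f_cl[OF m]] Fzero)
  next
    case (add x y)
    then show ?case
      by (simp add: tau_elt_add[OF M _ _ m] tau_elt_add[OF M' _ _ f_cl[OF m]] Fadd tau_elt_mem[OF M _ m])
  next
    case (basis a g)
    have "tau_elt N (\<lambda>c. a * tr g (char_I I) c) n =
        a \<odot>\<^bsub>t_obj G I N\<^esub> gact (t_obj G I N) g (tau_elt N (char_I I) n)"
      if "left_module H N" "n \<in> carrier N" for N :: "(('g, 'k) hecke, 'm) module" and n
      using that basis by (simp add: tau_elt_scale tau_elt_gact)
    with basis m f_cl[OF m] M M' show ?case
      by (simp add: Fsmult Fgact t_gact[OF M] tau_elt_mem[OF M] f_char)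
  qed
  have f: "f \<in> lmod_hom H M M'"
  proof (rule lmod_homI)
    fix m n assume mn: "m \<in> carrier M" "n \<in> carrier M"
    show "f (m \<oplus>\<^bsub>M\<^esub> n) = f m \<oplus>\<^bsub>M'\<^esub> f n"
    proof (rule tau_elt_inj[OF M' sur])
      have "tau_elt M' (char_I I) (f (m \<oplus>\<^bsub>M\<^esub> n)) = F (tau_elt M (char_I I) (m \<oplus>\<^bsub>M\<^esub> n))"
        using mn by (simp add: f_char)
      also have "\<dots> = tau_elt M' (char_I I) (f m \<oplus>\<^bsub>M'\<^esub> f n)"
        using mn by (simp add: tau_elt_r_add[OF M char_I_mem] tau_elt_r_add[OF M' char_I_mem] Fadd
            tau_elt_mem[OF M char_I_mem] f_char f_cl)
      finally show "tau_elt M' (char_I I) (f (m \<oplus>\<^bsub>M\<^esub> n)) = tau_elt M' (char_I I) (f m \<oplus>\<^bsub>M'\<^esub> f n)" .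
    qed (use mn f_cl in auto)
  next
    fix h :: "('g, 'k) hecke" and m assume h: "h \<in> carrier H" and m: "m \<in> carrier M"
    note hm = left_module_closed[OF M h m]
    show "f (h \<odot>\<^bsub>M\<^esub> m) = h \<odot>\<^bsub>M'\<^esub> f m"
    proof (rule tau_elt_inj[OF M' sur f_cl[OF hm] left_module_closed[OF M' h f_cl[OF m]]])
      \<comment> \<open>Here h crosses the tensor sign twice: char_I \<otimes> h m = char_I h
        \<otimes> m is sent to char_I h \<otimes> f(m) = char_I \<otimes> h f(m).\<close>
      show "tau_elt M' (char_I I) (f (h \<odot>\<^bsub>M\<^esub> m)) = tau_elt M' (char_I I) (h \<odot>\<^bsub>M'\<^esub> f m)"
        using f_elt[OF hecke_closed[OF h char_I_mem] m]
        by (simp add: tau_elt_hecke[OF M' char_I_mem h f_cl[OF m]]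
            tau_elt_hecke[OF M char_I_mem h m] flip: f_char[OF hm])
    qed
  qed (simp_all add: f_cl, simp add: f_def)
  have "F = t_mor G I M M' f"
  proof (rule extensionalityI[of _ "carrier (t_obj G I M)"])
    show "F \<in> extensional (carrier (t_obj G I M))"
      by (rule lmod_hom_extensional[OF rep_hom_lmod_hom[OF F]])
    show "t_mor G I M M' f \<in> extensional (carrier (t_obj G I M))" by (simp add: t_mor_def)
    show "F \<phi> = t_mor G I M M' f \<phi>" if "\<phi> \<in> carrier (t_obj G I M)" for \<phi>
    proof -
      have "F \<phi> = compose (carrier (dual_X G I)) f \<phi>"
        using that
        by (induction rule: t_induct_tensor[OF M, consumes 1, case_names zero add elt])
          (simp_all add: Fzero Fadd f_elt compose_t_zero[OF f] compose_t_add[OF f]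
            compose_tau_elt[OF f])
      then show ?thesis using that by (simp add: t_mor_def)
    qed
  qed
  with f show ?thesis by blast
qed

end

theorem t_fully_faithful:
  assumes sur: "hyp_sur G I TYPE('k::field)"
  shows "fully_faithful_functor
    (torsionfree_category G I K :: ((('g, 'k) hecke, 'm) module, 'm \<Rightarrow> 'm) category)
    (Mod_I_category G T I) (t_obj G I) (t_mor G I)"
proof -
  have lm: "left_module H M" if "torsionfree G I K M" for M :: "(('g, 'k) hecke, 'm) module"
    using that by (simp add: torsionfree_def)
  have id: "t_mor G I M M (\<lambda>x\<in>carrier M. x) = (\<lambda>v\<in>carrier (t_obj G I M). v)"
    if M: "left_module H M" for M :: "(('g, 'k) hecke, 'm) module"
    unfolding t_mor_def
  proof (rule restrict_ext)
    fix \<phi> assume \<phi>: "\<phi> \<in> carrier (t_obj G I M)"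
    show "compose (carrier (dual_X G I)) (\<lambda>x\<in>carrier M. x) \<phi> = \<phi>"
      by (rule t_eqI[OF M \<phi>, symmetric]) (simp_all add: compose_def t_closed[OF M \<phi>])
  qed
  have comp: "t_mor G I M M'' (compose (carrier M) g f) =
      compose (carrier (t_obj G I M)) (t_mor G I M' M'' g) (t_mor G I M M' f)"
    if M: "left_module H M" "left_module H M'" and f: "f \<in> lmod_hom H M M'"
    for M M' M'' :: "(('g, 'k) hecke, 'm) module" and f g
    unfolding compose_def[of "carrier (t_obj G I M)"] t_mor_def
  proof (rule restrict_ext)
    fix \<phi> assume \<phi>: "\<phi> \<in> carrier (t_obj G I M)"
    have "compose (carrier (dual_X G I)) (compose (carrier M) g f) \<phi> =
        compose (carrier (dual_X G I)) g (compose (carrier (dual_X G I)) f \<phi>)"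
      unfolding compose_def by (rule restrict_ext) (simp add: t_closed[OF M(1) \<phi>])
    then show "compose (carrier (dual_X G I)) (compose (carrier M) g f) \<phi> =
        (\<lambda>\<phi>\<in>carrier (t_obj G I M'). compose (carrier (dual_X G I)) g \<phi>)
          ((\<lambda>\<phi>\<in>carrier (t_obj G I M). compose (carrier (dual_X G I)) f \<phi>) \<phi>)"
      using \<phi> compose_t_closed[OF M f \<phi>] by simp
  qed
  have bij: "bij_betw (t_mor G I M M') (lmod_hom H M M') (rep_hom G (t_obj G I M) (t_obj G I M'))"
    if "torsionfree G I K M" "torsionfree G I K M'" for M M' :: "(('g, 'k) hecke, 'm) module"
    unfolding bij_betw_def
    using t_mor_inj[OF lm[OF that(1)] lm[OF that(2)] sur] t_mor_hom[OF lm[OF that(1)] lm[OF that(2)]]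
      t_mor_surj[OF lm[OF that(1)] lm[OF that(2)] that(2) sur] by blast
  show ?thesis
    unfolding fully_faithful_functor_def is_functor_def torsionfree_category_def Mod_I_category_def
    by (auto simp: t_smooth t_generated lm id t_mor_hom bij intro!: comp)
qed

end

section \<open>Integral matrices and integral models\<close>

definition monom_eval :: "('n \<times> 'n \<Rightarrow>\<^sub>0 nat) \<Rightarrow> 'a::comm_ring_1^'n::finite^'n \<Rightarrow> 'a" where
  "monom_eval m g = (\<Prod>v\<in>UNIV. (g $ fst v $ snd v) ^ Poly_Mapping.lookup m v)"

text \<open>The products run over all matrix entries and the sum over any finite superset of the
  support, so that polynomials with different supports can be compared term by term.\<close>

lemma mpeval_eq:
  assumes "finite A" "Poly_Mapping.keys p \<subseteq> A"
  shows "mpeval p g = (\<Sum>m\<in>A. Poly_Mapping.lookup p m * monom_eval m g)"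
proof -
  have "(\<Prod>v\<in>Poly_Mapping.keys m. (g $ fst v $ snd v) ^ Poly_Mapping.lookup m v) = monom_eval m g" for m
    unfolding monom_eval_def by (rule prod.mono_neutral_left) (auto simp: in_keys_iff)
  then have "mpeval p g = (\<Sum>m\<in>Poly_Mapping.keys p. Poly_Mapping.lookup p m * monom_eval m g)"
    by (simp add: mpeval_def)
  also have "\<dots> = (\<Sum>m\<in>A. Poly_Mapping.lookup p m * monom_eval m g)"
    by (rule sum.mono_neutral_left) (use assms in \<open>auto simp: in_keys_iff\<close>)
  finally show ?thesis .
qed

lemma mpeval_zero [simp]: "mpeval 0 g = 0"
  by (simp add: mpeval_def)

lemma mpeval_add: "mpeval (p + q) g = mpeval p g + mpeval q g"
proof -
  let ?A = "Poly_Mapping.keys p \<union> Poly_Mapping.keys q"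
  have "Poly_Mapping.keys (p + q) \<subseteq> ?A" by (rule Poly_Mapping.keys_add)
  then show ?thesis
    by (simp add: mpeval_eq[of ?A] lookup_add distrib_right sum.distrib)
qed

lemma mpeval_sum: "mpeval (sum f A) g = (\<Sum>x\<in>A. mpeval (f x) g)"
  by (induction A rule: infinite_finite_induct) (auto simp: mpeval_add)

lemma mpeval_single: "mpeval (Poly_Mapping.single m a) g = a * monom_eval m g"
  using mpeval_eq[of "{m}" "Poly_Mapping.single m a" g] by simp

lemma poly_mapping_single_induct [case_names zero add]:
  assumes "P 0" "\<And>f m a. P f \<Longrightarrow> P (f + Poly_Mapping.single m (a :: 'b::comm_monoid_add))"
  shows "P f"
proof (induction f rule: update_induct)
  case (update f a b)
  then have "Poly_Mapping.update a b f = f + Poly_Mapping.single a b"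
    by (intro poly_mapping_eqI) (auto simp: lookup_add lookup_update lookup_single in_keys_iff when_def)
  with assms(2)[OF update(3)] show ?case by simp
qed (rule assms(1))

text \<open>Both factors are built up monomial by monomial; for monomials, adding exponents
  multiplies the values.\<close>

lemma mpeval_mult: "mpeval (p * q) g = mpeval p g * mpeval q g"
proof (induction p rule: poly_mapping_single_induct)
  case (add p m a)
  have "mpeval (Poly_Mapping.single m a * q) g = a * monom_eval m g * mpeval q g"
  proof (induction q rule: poly_mapping_single_induct)
    case (add q n b)
    have "monom_eval (m + n) g = monom_eval m g * monom_eval n g"
      by (simp add: monom_eval_def lookup_add power_add prod.distrib)
    with add show ?case
      by (simp add: distrib_left mpeval_add mult_single mpeval_single algebra_simps)
  qed simp
  with add show ?case by (simp add: mpeval_add mpeval_single algebra_simps)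
qed simp

lemma mpeval_ideal_gen:
  assumes "p \<in> ideal_gen S" "\<And>s. s \<in> S \<Longrightarrow> mpeval s g = 0" shows "mpeval p g = 0"
proof -
  obtain T q where "p = (\<Sum>s\<in>T. q s * s)" "T \<subseteq> S" using assms(1) by (auto simp: ideal_gen_def)
  then show ?thesis
    using assms(2) by (auto simp: mpeval_sum mpeval_mult intro!: sum.neutral)
qed

lemma mpeval_to_ac: "mpeval (Poly_Mapping.map to_ac p) (mat_map to_ac g) = to_ac (mpeval p g)"
proof -
  have lookup: "Poly_Mapping.lookup (Poly_Mapping.map to_ac p) m = to_ac (Poly_Mapping.lookup p m)" for m
    by (simp add: Poly_Mapping.map.rep_eq when_def)
  have "Poly_Mapping.keys (Poly_Mapping.map to_ac p) \<subseteq> Poly_Mapping.keys p"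
    by (auto simp: in_keys_iff lookup)
  moreover have "monom_eval m (mat_map to_ac g) = to_ac (monom_eval m g)" for m
    by (simp add: monom_eval_def mat_map_def to_ac_prod)
  ultimately show ?thesis
    by (simp add: mpeval_eq[of "Poly_Mapping.keys p"] lookup to_ac_sum)
qed

section \<open>Rational points of a group of matrices\<close>

lemma mat_map_to_ac_mult: "mat_map to_ac (A ** B) = mat_map to_ac A ** mat_map to_ac B"
  by (simp add: mat_map_def matrix_matrix_mult_def vec_eq_iff to_ac_sum)

lemma mat_map_to_ac_one: "mat_map to_ac (mat 1) = mat 1"
  by (simp add: mat_map_def mat_def vec_eq_iff)

lemma det_to_ac: "det (mat_map to_ac g) = to_ac (det g)"
  by (simp add: det_def mat_map_def to_ac_sum to_ac_prod)

lemma GL_simps [simp]: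
  "carrier GL = {g. invertible g}" "g \<otimes>\<^bsub>GL\<^esub> h = g ** h" "\<one>\<^bsub>GL\<^esub> = mat 1"
  by (simp_all add: GL_def)

lemma group_GL: "group (GL :: ('a::field^'n::finite^'n) monoid)"
proof (rule groupI)
  show "\<exists>h\<in>carrier GL. h \<otimes>\<^bsub>GL\<^esub> g = \<one>\<^bsub>GL\<^esub>" if "g \<in> carrier GL" for g :: "'a^'n^'n"
  proof -
    obtain h where "g ** h = mat 1" "h ** g = mat 1" using \<open>g \<in> carrier GL\<close> by (auto simp: invertible_def)
    then show ?thesis by (auto simp: invertible_def)
  qed
qed (auto simp: invertible_mult matrix_mul_assoc intro: exI[of _ "mat 1"] simp: invertible_def[of "mat 1"])

lemma F_points_simps [simp]:
  "carrier (F_points G) = {g. mat_map to_ac g \<in> G}" "g \<otimes>\<^bsub>F_points G\<^esub> h = g ** h"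
  "\<one>\<^bsub>F_points G\<^esub> = mat 1"
  by (simp_all add: F_points_def GL_def)

text \<open>The determinant commutes with the embedding into the algebraic closure, so invertibility
  descends; the inverse over the base field maps to a left inverse of the image, hence to its
  inverse in \<open>G\<close>.\<close>

lemma subgroup_F_points:
  assumes G: "subgroup G (GL :: ('f::field alg_closure^'n::finite^'n) monoid)"
  shows "subgroup {g. mat_map to_ac g \<in> G} GL"
proof -
  interpret L: group "GL :: ('f alg_closure^'n^'n) monoid" by (rule group_GL)
  interpret F: group "GL :: ('f^'n^'n) monoid" by (rule group_GL)
  interpret G: subgroup G GL by (rule G)
  have inv: "invertible g" if "mat_map to_ac g \<in> G" for g :: "'f^'n^'n"
  proof -
    have "det (mat_map to_ac g) = to_ac (det g)"
      by (rule det_to_ac)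
    moreover have "det (mat_map to_ac g) \<noteq> 0"
      using G.subset that by (auto simp: invertible_det_nz)
    ultimately show ?thesis by (simp add: invertible_det_nz)
  qed
  show ?thesis
  proof (rule F.subgroupI)
    show "inv\<^bsub>GL\<^esub> g \<in> {g. mat_map to_ac g \<in> G}" if g: "g \<in> {g. mat_map to_ac g \<in> G}" for g
    proof -
      have "inv\<^bsub>GL\<^esub> g ** g = mat 1"
        using F.l_inv[of g] inv[of g] g by simp
      then have eq: "mat_map to_ac (inv\<^bsub>GL\<^esub> g) ** mat_map to_ac g = mat 1"
        by (simp add: mat_map_to_ac_one flip: mat_map_to_ac_mult)
      then have "invertible (mat_map to_ac (inv\<^bsub>GL\<^esub> g))"
        using invertible_right_inverse by blast
      with eq have "inv\<^bsub>GL\<^esub> (mat_map to_ac g) = mat_map to_ac (inv\<^bsub>GL\<^esub> g)"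
        using L.inv_equality[of "mat_map to_ac (inv\<^bsub>GL\<^esub> g)" "mat_map to_ac g"] G.subset g by auto
      then show ?thesis using G.m_inv_closed[of "mat_map to_ac g"] g by simp
    qed
    have "mat 1 \<in> {g. mat_map to_ac g \<in> G}"
      using G.one_closed by (simp add: mat_map_to_ac_one)
    then show "{g. mat_map to_ac g \<in> G} \<noteq> {}" by blast
  qed (use inv G.m_closed in \<open>auto simp: mat_map_to_ac_mult\<close>)
qed

lemma group_F_points:
  assumes "subgroup G (GL :: ('f::field alg_closure^'n::finite^'n) monoid)"
  shows "group (F_points G)"
  unfolding F_points_def
  by (rule subgroup.subgroup_is_group[OF subgroup_F_points[OF assms] group_GL])

section \<open>Norm estimates for integral matrices\<close>

context nonarch_local_field begin

lemma nrm_one: "nrm 1 = 1"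
  using nrm_mult[of 1 1] nrm_zero[of 1] by simp

lemma nrm_0 [simp]: "nrm 0 = 0"
  using nrm_zero by simp

lemma nrm_uminus: "nrm (- x) = nrm x"
proof -
  have "nrm (- 1) * nrm (- 1) = 1" using nrm_mult[of "- 1" "- 1"] nrm_one by simp
  then have "nrm (- 1) = 1" using nrm_nonneg[of "- 1"] by (simp add: square_eq_1_iff)
  then show ?thesis using nrm_mult[of "- 1" x] by simp
qed

lemma nrm_diff_comm: "nrm (x - y) = nrm (y - x)"
  using nrm_uminus[of "x - y"] by simp

lemma nrm_add_le: "\<lbrakk>nrm x \<le> c; nrm y \<le> c\<rbrakk> \<Longrightarrow> nrm (x + y) \<le> c"
  using nrm_ultra[of x y] by linarith

lemma nrm_sum_le: "\<lbrakk>0 \<le> c; \<And>x. x \<in> A \<Longrightarrow> nrm (f x) \<le> c\<rbrakk> \<Longrightarrow> nrm (sum f A) \<le> c"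
  by (induction A rule: infinite_finite_induct) (auto intro: nrm_add_le)

lemma nrm_mult_le: "\<lbrakk>nrm x \<le> b; nrm y \<le> c\<rbrakk> \<Longrightarrow> nrm (x * y) \<le> b * c"
  unfolding nrm_mult by (rule mult_mono') (auto simp: nrm_nonneg)

lemma nrm_prod: "nrm (prod f A) = (\<Prod>x\<in>A. nrm (f x))"
  by (induction A rule: infinite_finite_induct) (auto simp: nrm_one nrm_mult)

lemma nrm_power: "nrm (x ^ m) = nrm x ^ m"
  by (induction m) (auto simp: nrm_one nrm_mult)

lemma nrm_inverse: "x \<noteq> 0 \<Longrightarrow> nrm (inverse x) = inverse (nrm x)"
  using nrm_mult[of x "inverse x"] nrm_one by (simp add: inverse_unique)

text \<open>Nontriviality yields an element of norm strictly between 0 and 1, namely x or its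
  inverse, and the prime element has at least that norm.\<close>

lemma nrm_pr_pos: "0 < nrm pr"
proof -
  obtain x where x: "x \<noteq> 0" "nrm x \<noteq> 1" using nrm_nontrivial by blast
  then have pos: "0 < nrm x" using nrm_nonneg[of x] nrm_zero[of x] by linarith
  have "\<exists>y. 0 < nrm y \<and> nrm y < 1"
  proof (cases "nrm x < 1")
    case False
    then have "nrm (inverse x) < 1" "0 < nrm (inverse x)"
      using x pos by (auto simp: nrm_inverse inverse_less_1_iff)
    then show ?thesis by blast
  qed (use pos in blast)
  then show ?thesis using prime_element(2) by force
qed

lemma finite_denominator:
  assumes "finite A" shows "\<exists>c. c \<noteq> 0 \<and> nrm c \<le> 1 \<and> (\<forall>x\<in>A. nrm (c * x) \<le> 1)"
  using assms
proof induction
  case empty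
  then show ?case by (intro exI[of _ 1]) (simp add: nrm_one)
next
  case (insert x A)
  then obtain c where c: "c \<noteq> 0" "nrm c \<le> 1" "\<forall>x\<in>A. nrm (c * x) \<le> 1" by blast
  \<comment> \<open>An element of norm above 1 is cleared by its own inverse; keeping all
    multipliers of norm at most 1 ensures that products already integral stay so.\<close>
  define d where "d = (if nrm x \<le> 1 then 1 else inverse x)"
  have "d \<noteq> 0 \<and> nrm d \<le> 1 \<and> nrm (d * x) \<le> 1"
  proof (cases "nrm x \<le> 1")
    case False
    then have "x \<noteq> 0" by auto
    with False show ?thesis by (auto simp: d_def nrm_one nrm_inverse inverse_le_1_iff)
  qed (simp add: d_def nrm_one)
  then have "c * d \<noteq> 0 \<and> nrm (c * d) \<le> 1 \<and> (\<forall>x\<in>insert x A. nrm (c * d * x) \<le> 1)"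
    using c nrm_mult_le[of c 1 "d * x" 1] nrm_mult_le[of c 1 d 1] nrm_mult_le[of d 1 "c * y" 1 for y]
    by (simp add: ac_simps)
  then show ?case by blast
qed

lemma rs_zero: "rs 0 = 0"
  using rs_kernel[of 0] by simp

lemma rs_sum:
  "(\<And>x. x \<in> A \<Longrightarrow> nrm (f x) \<le> 1) \<Longrightarrow> rs (sum f A) = (\<Sum>x\<in>A. rs (f x))"
  by (induction A rule: infinite_finite_induct) (auto simp: rs_zero rs_add nrm_sum_le)

lemma nrm_prod_le: "(\<And>x. x \<in> A \<Longrightarrow> nrm (f x) \<le> 1) \<Longrightarrow> nrm (prod f A) \<le> 1"
  unfolding nrm_prod by (rule prod_le_1) (auto simp: nrm_nonneg)

lemma rs_prod:
  "(\<And>x. x \<in> A \<Longrightarrow> nrm (f x) \<le> 1) \<Longrightarrow> rs (prod f A) = (\<Prod>x\<in>A. rs (f x))"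
  by (induction A rule: infinite_finite_induct) (auto simp: rs_one rs_mult nrm_prod_le)

definition integral_mat :: "'f^'n^'n \<Rightarrow> bool" where
  "integral_mat A \<longleftrightarrow> (\<forall>i j. nrm (A $ i $ j) \<le> 1)"

lemma nrm_sign: "nrm (of_int (sign p)) = 1"
  by (simp add: sign_def nrm_uminus nrm_one)

lemma integral_mat_term:
  "integral_mat A \<Longrightarrow> nrm (of_int (sign p) * (\<Prod>i\<in>UNIV. A $ i $ p i)) \<le> 1"
  unfolding nrm_mult nrm_sign integral_mat_def by (simp add: nrm_prod_le)

lemma integral_mat_det: "integral_mat A \<Longrightarrow> nrm (det A) \<le> 1"
  unfolding det_def by (rule nrm_sum_le) (auto simp: integral_mat_term)

lemma rs_det:
  fixes A :: "'f^'n::finite^'n"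
  assumes A: "integral_mat A" shows "rs (det A) = det (mat_map rs A)"
proof -
  \<comment> \<open>The value at -1, needed for the signs of permutations, follows from 1 + (-1) = 0
    by additivity on integers.\<close>
  have "rs (- 1) = - 1"
    using rs_add[of 1 "- 1"] by (simp add: nrm_uminus nrm_one rs_zero rs_one add_eq_0_iff)
  then have "rs (of_int (sign p)) = of_int (sign p)" for p :: "'n \<Rightarrow> 'n"
    by (simp add: sign_def rs_one)
  then show ?thesis
    using A unfolding det_def
    by (simp add: rs_sum integral_mat_term)
      (simp add: rs_mult nrm_sign nrm_prod_le rs_prod integral_mat_def mat_map_def)
qed

lemma integral_mat_mult: "\<lbrakk>integral_mat A; integral_mat B\<rbrakk> \<Longrightarrow> integral_mat (A ** B)"
  unfolding integral_mat_def matrix_matrix_mult_def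
  using nrm_mult_le[where b = 1 and c = 1] by (auto intro!: nrm_sum_le)

text \<open>Cramer's rule: each entry of the inverse is the determinant of an integral matrix
  divided by a determinant of norm 1.\<close>

lemma integral_mat_inverse:
  fixes A A' :: "'f^'n::finite^'n"
  assumes A: "integral_mat A" and det: "nrm (det A) = 1" and inv: "A' ** A = mat 1"
  shows "integral_mat A'"
  unfolding integral_mat_def
proof (intro allI)
  fix i j
  have nz: "det A \<noteq> 0" using det nrm_zero by force
  have "A *v column j A' = axis j 1"
  proof -
    have "(A ** A') $ k $ j = mat 1 $ k $ j" for k
      using inv matrix_left_right_inverse[of A A'] by simp
    then show ?thesis
      by (simp add: vec_eq_iff matrix_vector_mult_def matrix_matrix_mult_def column_def axis_def mat_def)
  qed
  then have "A' $ i $ j = det (\<chi> k l. if l = i then axis j 1 $ k else A $ k $ l) / det A"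
    using cramer[OF nz, of "column j A'" "axis j 1"] by (auto simp: column_def vec_eq_iff)
  moreover have "integral_mat (\<chi> k l. if l = i then axis j 1 $ k else A $ k $ l)"
    using A by (auto simp: integral_mat_def axis_def nrm_one)
  ultimately show "nrm (A' $ i $ j) \<le> 1"
    using integral_mat_det det nz by (simp add: divide_inverse nrm_mult nrm_inverse)
qed

lemma mat_map_rs_mult:
  assumes "integral_mat A" "integral_mat B"
  shows "mat_map (to_ac \<circ> rs) (A ** B) = mat_map (to_ac \<circ> rs) A ** mat_map (to_ac \<circ> rs) B"
  using assms nrm_mult_le[where b = 1 and c = 1] unfolding integral_mat_def
  by (simp add: mat_map_def matrix_matrix_mult_def vec_eq_iff rs_sum rs_mult to_ac_sum)

text \<open>Deviations of norm below 1 vanish under reduction, so the determinant reduces to 1 and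
  cannot have norm below 1.\<close>

lemma near_one_integral:
  assumes "\<And>i j. nrm (A $ i $ j - mat 1 $ i $ j) \<le> nrm pr"
  shows "integral_mat A" "mat_map rs A = mat 1" "nrm (det A) = 1"
proof -
  have m1: "nrm ((mat 1 :: 'f^'n^'n) $ i $ j) \<le> 1" for i j by (simp add: mat_def nrm_one)
  have d: "nrm (A $ i $ j - mat 1 $ i $ j) < 1" for i j
    using assms[of i j] prime_element(1) by linarith
  show int: "integral_mat A"
    unfolding integral_mat_def
  proof (intro allI)
    fix i j
    show "nrm (A $ i $ j) \<le> 1" using nrm_add_le[OF less_imp_le[OF d] m1, of i j i j] by simp
  qed
  have "rs (A $ i $ j) = rs (mat 1 $ i $ j)" for i j
    using rs_add[OF less_imp_le[OF d] m1, of i j i j] rs_kernel[of "A $ i $ j - mat 1 $ i $ j"] d[of i j]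
    by simp
  then show one: "mat_map rs A = mat 1"
    by (simp add: mat_map_def vec_eq_iff mat_def rs_zero rs_one)
  have "rs (det A) \<noteq> 0" using rs_det[OF int] one by simp
  then show "nrm (det A) = 1"
    using integral_mat_det[OF int] rs_kernel[of "det A"] by linarith
qed

text \<open>In an ultrametric a sum is bounded by its largest term, so no factor depending on the
  size of the matrices appears.\<close>

lemma conj_minus_one_bound:
  fixes A B D :: "'f^'n::finite^'n"
  assumes "\<And>i j. nrm (A $ i $ j) \<le> a" "\<And>i j. nrm (D $ i $ j) \<le> c" "\<And>i j. nrm (B $ i $ j) \<le> b" "0 \<le> c"
  shows "nrm ((A ** D ** B) $ i $ j) \<le> a * c * b"
proof -
  have ge: "0 \<le> a" "0 \<le> b" using assms(1,3) nrm_nonneg order_trans by blast+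
  have "nrm ((A ** D) $ i $ k) \<le> a * c" for k
    unfolding matrix_matrix_mult_def using assms ge
    by (auto intro!: nrm_sum_le nrm_mult_le)
  then show ?thesis
    unfolding matrix_matrix_mult_def[of "A ** D"] using assms ge
    by (auto intro!: nrm_sum_le nrm_mult_le)
qed

lemma mat_bound: obtains C where "0 < C" "\<And>i j. nrm ((A :: 'f^'n::finite^'n) $ i $ j) \<le> C"
proof
  let ?C = "Max (range (\<lambda>(i, j). nrm (A $ i $ j)))"
  \<comment> \<open>The maximum with 1 guarantees positivity, also for the zero matrix, so that the
    bound can be divided by.\<close>
  show "0 < max 1 ?C" by simp
  show "nrm (A $ i $ j) \<le> max 1 ?C" for i j
    by (rule max.coboundedI2[OF Max_ge]) auto
qed

end

section \<open>The pro-$p$ Iwahori subgroup and the congruence subgroups\<close>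

context hyperspecial_setting begin

lemma G_subgroup: "subgroup G GL" and G_closed: "zar_closed G"
  using generic_reductive by (simp_all add: connected_reductive_def closed_subgroup_def)

lemma N_subgroup: "subgroup N GL"
  using radical by (simp add: is_unipotent_radical_def conn_normal_unipotent_def closed_subgroup_def)

interpretation F: group "F_points G"
  by (rule group_F_points[OF G_subgroup])

lemma F_inv: "mat_map to_ac g \<in> G \<Longrightarrow> inv\<^bsub>F_points G\<^esub> g ** g = mat 1"
  "mat_map to_ac g \<in> G \<Longrightarrow> g ** inv\<^bsub>F_points G\<^esub> g = mat 1"
  using F.l_inv[of g] F.r_inv[of g] by simp_all

lemma F_inv_mem: "mat_map to_ac g \<in> G \<Longrightarrow> mat_map to_ac (inv\<^bsub>F_points G\<^esub> g) \<in> G"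
  using F.inv_closed[of g] by simp

lemma F_mult_mem: "\<lbrakk>mat_map to_ac g \<in> G; mat_map to_ac h \<in> G\<rbrakk> \<Longrightarrow> mat_map to_ac (g ** h) \<in> G"
  using F.m_closed[of g h] by simp

text \<open>Since \<open>G\<close> is defined over \<open>'f\<close>, clearing denominators in equations with coefficients in \<open>'f\<close>
  shows that the integral equations cut out \<open>G\<close>.\<close>

lemma integral_equations_cut_out:
  assumes g: "invertible (mat_map to_ac g)" and eq: "\<And>p. p \<in> integral_equations nrm G \<Longrightarrow> mpeval p g = 0"
  shows "mat_map to_ac g \<in> G"
proof -
  let ?E = "{p. coeffs_in (range to_ac) p \<and> (\<forall>g\<in>G. mpeval p g = 0)}"
  have E: "mpeval p (mat_map to_ac g) = 0" if p: "p \<in> ?E" for p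
  proof -
    \<comment> \<open>\<open>of_ac\<close> inverts the embedding on its range, so \<open>?p\<close>
      is p with its coefficients taken back to the base field.\<close>
    let ?p = "Poly_Mapping.map of_ac p :: ('f, 'n) mpoly"
    have of0: "of_ac (0 :: 'f alg_closure) = 0" by (rule of_ac_eqI) simp
    have lookup_p: "Poly_Mapping.lookup ?p m = of_ac (Poly_Mapping.lookup p m)" for m
      by (simp add: Poly_Mapping.map.rep_eq when_def of0)
    have ac_of: "to_ac (of_ac (Poly_Mapping.lookup p m)) = Poly_Mapping.lookup p m" for m
    proof (cases "m \<in> Poly_Mapping.keys p")
      case True
      then show ?thesis using p by (auto simp: coeffs_in_def intro!: to_ac_of_ac)
    qed (simp add: in_keys_iff of0)
    obtain c where c: "c \<noteq> 0" "\<forall>x\<in>Poly_Mapping.lookup ?p ` Poly_Mapping.keys ?p. nrm (c * x) \<le> 1"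
      using finite_denominator[of "Poly_Mapping.lookup ?p ` Poly_Mapping.keys ?p"] by auto
    \<comment> \<open>The factor c makes the equation integral and, being nonzero, does not change
      its zeros.\<close>
    let ?q = "Poly_Mapping.single 0 c * ?p"
    have lookup_q: "Poly_Mapping.lookup ?q m = c * Poly_Mapping.lookup ?p m" for m
      by (simp add: Poly_Mapping.map.rep_eq when_def flip: mult_map_scale_conv_mult)
    have p_eq: "Poly_Mapping.map to_ac ?p = p"
    proof (rule poly_mapping_eqI)
      show "Poly_Mapping.lookup (Poly_Mapping.map to_ac ?p) m = Poly_Mapping.lookup p m" for m
        using ac_of[of m] by (auto simp: Poly_Mapping.map.rep_eq when_def lookup_p)
    qed
    have q_eq: "Poly_Mapping.map to_ac ?q = Poly_Mapping.single 0 (to_ac c) * p"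
    proof (rule poly_mapping_eqI)
      show "Poly_Mapping.lookup (Poly_Mapping.map to_ac ?q) m =
          Poly_Mapping.lookup (Poly_Mapping.single 0 (to_ac c) * p) m" for m
        using ac_of[of m] c(1)
        by (auto simp: Poly_Mapping.map.rep_eq when_def lookup_q lookup_p simp flip: mult_map_scale_conv_mult)
    qed
    have "?q \<in> integral_equations nrm G"
      using p c by (auto simp: integral_equations_def coeffs_in_def lookup_q q_eq mpeval_mult in_keys_iff)
    then have "c * mpeval ?p g = 0"
      using eq[of ?q] by (simp add: mpeval_mult mpeval_single monom_eval_def)
    then have "mpeval ?p g = 0" using c(1) by simp
    then have "mpeval (Poly_Mapping.map to_ac ?p) (mat_map to_ac g) = 0" by (simp add: mpeval_to_ac)
    then show ?thesis by (simp add: p_eq)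
  qed
  obtain S where S: "G = zero_locus S" using G_closed by (auto simp: zar_closed_def)
  have "mpeval p (mat_map to_ac g) = 0" if "p \<in> S" for p
  proof -
    have "p \<in> {p. \<forall>g\<in>G. mpeval p g = 0}" using that by (auto simp: S zero_locus_def)
    \<comment> \<open>Being defined over the base field enters here: every equation of
      \<open>G\<close> is a combination of equations with coefficients there.\<close>
    then have "p \<in> ideal_gen ?E" using generic_defined by (simp only: defined_over_def)
    then show ?thesis by (rule mpeval_ideal_gen[OF _ E])
  qed
  then show ?thesis using g by (auto simp: S zero_locus_def)
qed

text \<open>The integral equations cut out \<open>G\<close>, and conversely they hold on
  \<open>G\<close> by definition; so the integral points are the rational points with integral
  entries and unit determinant.\<close>

lemma O_points_iff:
  "g \<in> O_points nrm G \<longleftrightarrow> mat_map to_ac g \<in> G \<and> integral_mat g \<and> nrm (det g) = 1"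
proof
  assume g: "g \<in> O_points nrm G"
  then have "det (mat_map to_ac g) \<noteq> 0" by (auto simp: O_points_def det_to_ac)
  then show "mat_map to_ac g \<in> G \<and> integral_mat g \<and> nrm (det g) = 1"
    using g integral_equations_cut_out[of g]
    by (auto simp: O_points_def integral_mat_def invertible_det_nz)
next
  assume g: "mat_map to_ac g \<in> G \<and> integral_mat g \<and> nrm (det g) = 1"
  have "mpeval p g = 0" if "p \<in> integral_equations nrm G" for p
  proof -
    have "mpeval (Poly_Mapping.map to_ac p) (mat_map to_ac g) = 0"
      using that g by (auto simp: integral_equations_def)
    then show ?thesis by (simp add: mpeval_to_ac)
  qed
  with g show "g \<in> O_points nrm G" by (auto simp: O_points_def integral_mat_def)
qed

lemma O_points_mult: "\<lbrakk>g \<in> O_points nrm G; h \<in> O_points nrm G\<rbrakk> \<Longrightarrow> g ** h \<in> O_points nrm G"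
  by (simp add: O_points_iff F_mult_mem integral_mat_mult det_mul nrm_mult)

lemma O_points_inv:
  assumes g: "g \<in> O_points nrm G" shows "inv\<^bsub>F_points G\<^esub> g \<in> O_points nrm G"
proof -
  have m: "mat_map to_ac g \<in> G" "integral_mat g" "nrm (det g) = 1" using g by (auto simp: O_points_iff)
  have "nrm (det (inv\<^bsub>F_points G\<^esub> g) * det g) = 1"
    using F_inv(1)[OF m(1)] by (simp add: nrm_one flip: det_mul)
  then show ?thesis
    using m F_inv_mem[OF m(1)] integral_mat_inverse[OF m(2,3) F_inv(1)[OF m(1)]]
    by (simp add: O_points_iff nrm_mult)
qed

abbreviation "Iw \<equiv> pro_p_Iwahori nrm rs G N"
abbreviation "K \<equiv> congruence_subgroup nrm pr G"
abbreviation "red \<equiv> mat_map (to_ac \<circ> rs) :: 'f^'n^'n \<Rightarrow> 'r alg_closure^'n^'n"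

lemma red_one: "mat_map rs g = mat 1 \<Longrightarrow> red g = mat 1"
  by (simp add: mat_map_def vec_eq_iff mat_def)

text \<open>Reduction is multiplicative on integral matrices, and \<open>Iw\<close> is the preimage
  of the subgroup \<open>N\<close> under it.\<close>

lemma Iw_subgroup: "subgroup Iw (F_points G)"
proof -
  interpret L: group "GL :: ('r alg_closure^'n^'n) monoid" by (rule group_GL)
  interpret N: subgroup N GL by (rule N_subgroup)
  have int: "integral_mat g" if "g \<in> O_points nrm G" for g using that by (simp add: O_points_iff)
  show ?thesis
  proof (rule F.subgroupI)
    show "Iw \<subseteq> carrier (F_points G)" by (auto simp: pro_p_Iwahori_def O_points_iff)
    have near: "nrm ((mat 1 :: 'f^'n^'n) $ i $ j - mat 1 $ i $ j) \<le> nrm pr" for i j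
      by (simp add: nrm_nonneg)
    have "mat 1 \<in> Iw"
      using F.one_closed near_one_integral[OF near] N.one_closed red_one[OF near_one_integral(2)[OF near]]
      by (simp add: pro_p_Iwahori_def O_points_iff)
    then show "Iw \<noteq> {}" by blast
    show "g \<otimes>\<^bsub>F_points G\<^esub> h \<in> Iw" if "g \<in> Iw" "h \<in> Iw" for g h
      using that N.m_closed[of "red g" "red h"] O_points_mult[of g h] int mat_map_rs_mult[of g h]
      by (auto simp: pro_p_Iwahori_def)
    show "inv\<^bsub>F_points G\<^esub> g \<in> Iw" if "g \<in> Iw" for g
    proof -
      have g: "g \<in> O_points nrm G" "red g \<in> N" "mat_map to_ac g \<in> G"
        using that by (auto simp: pro_p_Iwahori_def O_points_iff)
      note g' = O_points_inv[OF g(1)]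
      \<comment> \<open>The reduction of the inverse is a left inverse of \<open>red g\<close>,
        hence equals the inverse taken in GL over the closure of the residue field.\<close>
      have eq: "red (inv\<^bsub>F_points G\<^esub> g) ** red g = mat 1"
        using mat_map_rs_mult[OF int[OF g'] int[OF g(1)]] F_inv(1)[OF g(3)]
          red_one[OF near_one_integral(2)[OF near]] by simp
      then have "invertible (red (inv\<^bsub>F_points G\<^esub> g))" using invertible_right_inverse by blast
      then have "inv\<^bsub>GL\<^esub> (red g) = red (inv\<^bsub>F_points G\<^esub> g)"
        using L.inv_equality[of "red (inv\<^bsub>F_points G\<^esub> g)" "red g"] eq N.subset g(2) by auto
      then show ?thesis
        using N.m_inv_closed[OF g(2)] g' by (simp add: pro_p_Iwahori_def)
    qed
  qed
qed

lemma nrm_pr_power_le: "1 \<le> m \<Longrightarrow> nrm (pr ^ m) \<le> nrm pr"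
  unfolding nrm_power using power_decreasing[of 1 m "nrm pr"] nrm_pr_pos prime_element(1) by simp

text \<open>For m at least 1, closeness to the identity already forces integral entries and a unit
  determinant.\<close>

lemma K_memI:
  assumes "mat_map to_ac g \<in> G" "1 \<le> m" "\<And>i j. nrm (g $ i $ j - mat 1 $ i $ j) \<le> nrm (pr ^ m)"
  shows "g \<in> K m"
proof -
  have near: "nrm (g $ i $ j - mat 1 $ i $ j) \<le> nrm pr" for i j
    by (rule order_trans[OF assms(3) nrm_pr_power_le[OF assms(2)]])
  show ?thesis
    using assms near_one_integral(1,3)[OF near] by (simp add: congruence_subgroup_def O_points_iff)
qed

text \<open>With m at least 1 the reduction is the identity, which lies in \<open>N\<close>. For m =
  0 the congruence condition is empty and gives all integral points.\<close>

lemma K_subset_Iw: "1 \<le> m \<Longrightarrow> K m \<subseteq> Iw"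
proof
  fix g assume m: "1 \<le> m" and g: "g \<in> K m"
  have near: "nrm (g $ i $ j - mat 1 $ i $ j) \<le> nrm pr" for i j
    by (rule order_trans[OF _ nrm_pr_power_le[OF m]]) (use g in \<open>simp add: congruence_subgroup_def\<close>)
  show "g \<in> Iw"
    using g red_one[OF near_one_integral(2)[OF near]] subgroup.one_closed[OF N_subgroup]
    by (simp add: pro_p_Iwahori_def congruence_subgroup_def)
qed

lemma matrix_diff_ldistrib: "A ** (D - E) = A ** D - A ** (E :: 'f^'n^'n)"
  and matrix_diff_rdistrib: "(D - E) ** A = D ** A - E ** (A :: 'f^'n^'n)"
  by (simp_all add: matrix_matrix_mult_def vec_eq_iff sum_subtractf algebra_simps)

text \<open>Conjugation fixes the identity and therefore acts linearly on the deviation from it, to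
  which the entrywise bounds apply.\<close>

lemma conj_minus_one:
  assumes "mat_map to_ac g \<in> G"
  shows "inv\<^bsub>F_points G\<^esub> g ** k ** g - mat 1 = inv\<^bsub>F_points G\<^esub> g ** (k - mat 1) ** g"
  using F_inv(1)[OF assms]
  by (simp add: matrix_diff_ldistrib matrix_diff_rdistrib)

lemma small_power: "0 < c \<Longrightarrow> \<exists>m\<ge>1. C * nrm (pr ^ m) \<le> c"
proof -
  assume c: "0 < c"
  have "(\<lambda>m. C * nrm pr ^ m) \<longlonglongrightarrow> C * 0"
    by (intro tendsto_mult tendsto_const LIMSEQ_realpow_zero) (use nrm_pr_pos prime_element(1) in auto)
  then have "\<forall>\<^sub>F m in sequentially. C * nrm pr ^ m < c" using c order_tendstoD(2) by fastforce
  then obtain M where "\<forall>m\<ge>M. C * nrm pr ^ m < c" unfolding eventually_sequentially by blast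
  then have "C * nrm pr ^ max 1 M < c" by auto
  then show ?thesis by (intro exI[of _ "max 1 M"]) (simp add: nrm_power)
qed

lemma K_diff:
  assumes "k \<in> K m" shows "nrm ((k - mat 1) $ i $ j) \<le> nrm (pr ^ m)"
  using assms by (simp add: congruence_subgroup_def)

lemma F_Metric_space:
  "Metric_space (carrier (F_points G)) (\<lambda>g h. Max (range (\<lambda>(i, j). nrm (g $ i $ j - h $ i $ j))))"
    (is "Metric_space _ ?d")
proof
  have le: "nrm (g $ i $ j - h $ i $ j) \<le> ?d g h" for g h :: "'f^'n^'n" and i j
    by (rule Max_ge) auto
  have leI: "?d g h \<le> c" if "\<And>i j. nrm (g $ i $ j - h $ i $ j) \<le> c" for g h :: "'f^'n^'n" and c
    by (rule Max.boundedI) (use that in auto)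
  show nn: "0 \<le> ?d g h" for g h :: "'f^'n^'n"
    using le[of g undefined undefined h] nrm_nonneg order_trans by blast
  show "?d g h = ?d h g" for g h :: "'f^'n^'n"
    by (simp add: nrm_diff_comm[of "g $ _ $ _"])
  show "?d g h = 0 \<longleftrightarrow> g = h" for g h :: "'f^'n^'n"
  proof
    assume "?d g h = 0"
    then have "nrm (g $ i $ j - h $ i $ j) = 0" for i j
      using le[of g i j h] nrm_nonneg by (metis order_antisym)
    then show "g = h" by (simp add: vec_eq_iff nrm_zero)
  next
    assume "g = h"
    then show "?d g h = 0" using leI[of g h 0] nn[of g h] by simp
  qed
  show "?d g k \<le> ?d g h + ?d h k" for g h k :: "'f^'n^'n"
  proof (rule leI)
    fix i j
    show "nrm (g $ i $ j - k $ i $ j) \<le> ?d g h + ?d h k"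
      using nrm_ultra[of "g $ i $ j - h $ i $ j" "h $ i $ j - k $ i $ j"] le[of g i j h] le[of h i j k]
        nn[of g h] nn[of h k] by simp
  qed
qed

text \<open>Let C bound the entries of g^-1. For h at distance below |pr^m| / C from g, the matrix
  g^-1 h - 1 = g^-1 (h - g) has entries of norm at most |pr^m|, so h lies in g K m and hence in
  \<open>S\<close>.\<close>

lemma F_openin:
  assumes S: "S \<subseteq> carrier (F_points G)" and m: "1 \<le> m"
    and stable: "\<And>g k. \<lbrakk>g \<in> S; k \<in> K m\<rbrakk> \<Longrightarrow> g ** k \<in> S"
  shows "openin (F_topology nrm G) S"
proof -
  let ?d = "\<lambda>g h :: 'f^'n^'n. Max (range (\<lambda>(i, j). nrm (g $ i $ j - h $ i $ j)))"
  interpret D: Metric_space "carrier (F_points G)" ?d by (rule F_Metric_space)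
  have "\<exists>r>0. D.mball g r \<subseteq> S" if g: "g \<in> S" for g
  proof -
    have gG: "mat_map to_ac g \<in> G" using g S by auto
    obtain C where C: "0 < C" "\<And>i j. nrm ((inv\<^bsub>F_points G\<^esub> g) $ i $ j) \<le> C" using mat_bound by blast
    have "h \<in> S" if "h \<in> D.mball g (nrm (pr ^ m) / C)" for h
    proof -
      have h: "h \<in> carrier (F_points G)" "?d g h < nrm (pr ^ m) / C"
        using that unfolding D.in_mball by blast+
      have hG: "mat_map to_ac h \<in> G" using h(1) by simp
      have dh: "nrm ((h - g) $ i $ j) \<le> nrm (pr ^ m) / C" for i j
      proof -
        have "nrm (g $ i $ j - h $ i $ j) \<le> ?d g h" by (rule Max_ge) auto
        also have "\<dots> < nrm (pr ^ m) / C" by (rule h(2))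
        finally show ?thesis using nrm_diff_comm[of "g $ i $ j"] by simp
      qed
      let ?k = "inv\<^bsub>F_points G\<^esub> g ** h"
      have "?k - mat 1 = inv\<^bsub>F_points G\<^esub> g ** (h - g) ** mat 1"
        using F_inv(1)[OF gG] by (simp add: matrix_diff_ldistrib)
      moreover have "nrm ((mat 1 :: 'f^'n^'n) $ i $ j) \<le> 1" for i j by (simp add: mat_def nrm_one)
      ultimately have "nrm ((?k - mat 1) $ i $ j) \<le> C * (nrm (pr ^ m) / C) * 1" for i j
        using conj_minus_one_bound[OF C(2) dh, of "mat 1" 1 i j] C(1) nrm_nonneg by simp
      then have "nrm (?k $ i $ j - mat 1 $ i $ j) \<le> nrm (pr ^ m)" for i j
        using C(1) by simp
      then have "?k \<in> K m"
        by (rule K_memI[OF F_mult_mem[OF F_inv_mem[OF gG] hG] m])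
      then have "g ** ?k \<in> S" by (rule stable[OF g])
      then show "h \<in> S" using F_inv(2)[OF gG] by (simp add: matrix_mul_assoc)
    qed
    moreover have "0 < nrm (pr ^ m) / C" using C(1) nrm_pr_pos by (simp add: nrm_power)
    ultimately show ?thesis by blast
  qed
  with S show ?thesis unfolding F_topology_def D.openin_mtopology by blast
qed

lemma hecke_tower: "hecke_tower (F_points G) Iw K (F_topology nrm G)"
proof (intro hecke_tower.intro hecke_pair.intro hecke_pair_axioms.intro hecke_tower_axioms.intro
    F.group_axioms)
  have Iw_G: "mat_map to_ac g \<in> G" "g \<in> O_points nrm G" if "g \<in> Iw" for g
    using that by (auto simp: pro_p_Iwahori_def O_points_iff)
  have K_G: "mat_map to_ac k \<in> G" if "k \<in> K m" for k m
    using that by (auto simp: congruence_subgroup_def O_points_iff)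
  show "subgroup Iw (F_points G)" by (rule Iw_subgroup)
  show "x \<in> carrier (F_points G)"
    if "g \<in> carrier (F_points G)" "g \<otimes>\<^bsub>F_points G\<^esub> x \<in> carrier (F_points G)" for g x
  proof -
    have g: "mat_map to_ac g \<in> G" "mat_map to_ac (g ** x) \<in> G" using that by auto
    \<comment> \<open>The multiplication of \<open>F_points\<close> is matrix multiplication on the
      whole type, so x = g^-1 (g x) holds for x not yet known to lie in the group.\<close>
    have "mat_map to_ac (inv\<^bsub>F_points G\<^esub> g ** (g ** x)) \<in> G"
      by (rule F_mult_mem[OF F_inv_mem[OF g(1)] g(2)])
    then show ?thesis using F_inv(1)[OF g(1)] by (simp add: matrix_mul_assoc)
  qed
  show "K m \<subseteq> Iw" if "1 \<le> m" for m by (rule K_subset_Iw[OF that])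
  show "K n \<subseteq> K m" if "m \<le> n" for m n
  proof
    fix g assume g: "g \<in> K n"
    have le: "nrm (pr ^ n) \<le> nrm (pr ^ m)"
      unfolding nrm_power by (rule power_decreasing[OF that]) (use nrm_pr_pos prime_element(1) in auto)
    show "g \<in> K m"
      using g by (auto simp: congruence_subgroup_def intro: order_trans[OF _ le])
  qed
  show "inv\<^bsub>F_points G\<^esub> g \<otimes>\<^bsub>F_points G\<^esub> k \<otimes>\<^bsub>F_points G\<^esub> g \<in> K m"
    if m: "1 \<le> m" and g: "g \<in> Iw" and k: "k \<in> K m" for m g k
  proof -
    note gG = Iw_G[OF g]
    \<comment> \<open>Elements of \<open>Iw\<close> and their inverses have integral entries, so
      conjugation by them does not enlarge the distance to the identity.\<close>
    have b: "nrm ((inv\<^bsub>F_points G\<^esub> g) $ i $ j) \<le> 1" "nrm (g $ i $ j) \<le> 1" for i j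
      using O_points_inv[OF gG(2)] gG(2) by (simp_all add: O_points_iff integral_mat_def)
    have "nrm ((inv\<^bsub>F_points G\<^esub> g ** k ** g - mat 1) $ i $ j) \<le> 1 * nrm (pr ^ m) * 1" for i j
      unfolding conj_minus_one[OF gG(1)] by (rule conj_minus_one_bound[OF b(1) K_diff[OF k] b(2) nrm_nonneg])
    then show ?thesis
      using K_memI[OF F_mult_mem[OF F_mult_mem[OF F_inv_mem[OF gG(1)] K_G[OF k]] gG(1)] m] by simp
  qed
  show "\<exists>m\<ge>1. \<forall>k\<in>K m. inv\<^bsub>F_points G\<^esub> g \<otimes>\<^bsub>F_points G\<^esub> k \<otimes>\<^bsub>F_points G\<^esub> g \<in> Iw"
    if g: "g \<in> carrier (F_points G)" for g
  proof -
    have gG: "mat_map to_ac g \<in> G" using g by simp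
    obtain D where D: "0 < D" "\<And>i j. nrm ((inv\<^bsub>F_points G\<^esub> g) $ i $ j) \<le> D" using mat_bound by blast
    obtain C where C: "0 < C" "\<And>i j. nrm (g $ i $ j) \<le> C" using mat_bound by blast
    \<comment> \<open>Conjugation by a general g stretches distances to the identity by at most D C;
      m is chosen so deep that the conjugate still lands in \<open>K 1\<close>, which lies in
      \<open>Iw\<close>.\<close>
    obtain m where m: "1 \<le> m" "D * C * nrm (pr ^ m) \<le> nrm pr" using small_power[OF nrm_pr_pos] by blast
    have "inv\<^bsub>F_points G\<^esub> g ** k ** g \<in> Iw" if k: "k \<in> K m" for k
    proof -
      have "nrm ((inv\<^bsub>F_points G\<^esub> g ** k ** g - mat 1) $ i $ j) \<le> D * nrm (pr ^ m) * C" for i j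
        unfolding conj_minus_one[OF gG] by (rule conj_minus_one_bound[OF D(2) K_diff[OF k] C(2) nrm_nonneg])
      then have "nrm ((inv\<^bsub>F_points G\<^esub> g ** k ** g) $ i $ j - mat 1 $ i $ j) \<le> nrm (pr ^ 1)" for i j
        using m(2) order_trans by (fastforce simp: ac_simps)
      then have "inv\<^bsub>F_points G\<^esub> g ** k ** g \<in> K 1"
        by (rule K_memI[OF F_mult_mem[OF F_mult_mem[OF F_inv_mem[OF gG] K_G[OF k]] gG] order_refl])
      then show ?thesis using K_subset_Iw[of 1] by blast
    qed
    with m(1) show ?thesis by auto
  qed
  show "openin (F_topology nrm G) S"
    if "S \<subseteq> carrier (F_points G)" "1 \<le> m"
      "\<And>g k. \<lbrakk>g \<in> S; k \<in> K m\<rbrakk> \<Longrightarrow> g \<otimes>\<^bsub>F_points G\<^esub> k \<in> S" for S m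
    using F_openin[OF that(1,2)] that(3) by simp
qed

end

theorem theorem0p1:
  fixes nrm :: "'f::field \<Rightarrow> real" and pr :: 'f and rs :: "'f \<Rightarrow> 'r::field"
    and \<G> :: "('f alg_closure^'n::finite^'n) set"
    and B N :: "('r alg_closure^'n^'n) set"
  defines "G \<equiv> F_points \<G>"
    and "I \<equiv> pro_p_Iwahori nrm rs \<G> N"
    and "K \<equiv> congruence_subgroup nrm pr \<G>"
  assumes "hyperspecial_setting nrm pr rs \<G> B N"
    and sur: "hyp_sur G I TYPE('k::field)"
  shows "fully_faithful_functor
    (torsionfree_category G I K :: ((('f^'n^'n, 'k) hecke, 'm) module, 'm \<Rightarrow> 'm) category)
    (Mod_I_category G (F_topology nrm \<G>) I)
    (t_obj G I) (t_mor G I)"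
  unfolding G_def I_def K_def
  by (rule hecke_tower.t_fully_faithful[OF hyperspecial_setting.hecke_tower[OF assms(4)]
        sur[unfolded G_def I_def]])

end
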